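(* There exists a finitely generated torsion group $G$ with $\beta_1^{(2)}(G)\neq 0$.
   Context: $\beta_1^{(2)}(G)$ denotes the first $L^2$-Betti number of a discrete countable group $G$, in the standard sense (e.g. $\beta_1^{(2)}(G)=\dim_{\mathcal N(G)}H_1(G;\mathcal N(G))$, where $\mathcal N(G)$ is the group von Neumann algebra of $G$ and $\dim_{\mathcal N(G)}$ is Lück's extended von Neumann dimension). A group is torsion if each of its elements has finite order. *)

theory Defs
  imports
    "HOL-Library.Extended_Real"
    "HOL-Analysis.Infinite_Sum"
    "HOL-Algebra.Module"
    "HOL-Algebra.AbelCoset"
    "HOL-Algebra.Generated_Groups"
begin

section \<open>Finitely generated groups and torsion groups\<close>

definition finitely_generated :: "('g, 'm) monoid_scheme \<Rightarrow> bool" where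
  "finitely_generated G \<longleftrightarrow>
     (\<exists>S. finite S \<and> S \<subseteq> carrier G \<and> generate G S = carrier G)"

definition torsion_group :: "('g, 'm) monoid_scheme \<Rightarrow> bool" where
  "torsion_group G \<longleftrightarrow>
     group G \<and> (\<forall>x\<in>carrier G. \<exists>n::nat. n > 0 \<and> x [^]\<^bsub>G\<^esub> n = \<one>\<^bsub>G\<^esub>)"


section \<open>The group von Neumann algebra\<close>

text \<open>Elements of \<open>\<ell>\<^sup>2(G)\<close> are represented by functions on the ambient type that vanish outside
  the carrier; operators on it are extensional functions, so that equality of operators is HOL
  equality.\<close>

definition l2 :: "('g, 'm) monoid_scheme \<Rightarrow> ('g \<Rightarrow> complex) set" where
  "l2 G = {f. (\<forall>x. x \<notin> carrier G \<longrightarrow> f x = 0) \<and> (\<lambda>x. (cmod (f x))\<^sup>2) summable_on carrier G}"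

definition l2_norm :: "('g, 'm) monoid_scheme \<Rightarrow> ('g \<Rightarrow> complex) \<Rightarrow> real" where
  "l2_norm G f = sqrt (\<Sum>\<^sub>\<infinity>x\<in>carrier G. (cmod (f x))\<^sup>2)"

type_synonym 'g l2_op = "('g \<Rightarrow> complex) \<Rightarrow> ('g \<Rightarrow> complex)"

definition l2_bounded_ops :: "('g, 'm) monoid_scheme \<Rightarrow> 'g l2_op set" where
  "l2_bounded_ops G = {T. T \<in> l2 G \<rightarrow>\<^sub>E l2 G
     \<and> (\<forall>f\<in>l2 G. \<forall>h\<in>l2 G. T (\<lambda>x. f x + h x) = (\<lambda>x. T f x + T h x))
     \<and> (\<forall>c. \<forall>f\<in>l2 G. T (\<lambda>x. c * f x) = (\<lambda>x. c * T f x))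
     \<and> (\<exists>C. \<forall>f\<in>l2 G. l2_norm G (T f) \<le> C * l2_norm G f)}"

text \<open>Left translation \<open>\<lambda>\<^sub>g \<delta>\<^sub>x = \<delta>\<^bsub>g x\<^esub>\<close> and right translation \<open>\<rho>\<^sub>g \<delta>\<^sub>x = \<delta>\<^bsub>x g\<^sup>-\<^sup>1\<^esub>\<close>; both are
  homomorphisms in \<open>g\<close>.\<close>

definition left_trans :: "('g, 'm) monoid_scheme \<Rightarrow> 'g \<Rightarrow> 'g l2_op" where
  "left_trans G g = (\<lambda>f\<in>l2 G. \<lambda>x. if x \<in> carrier G then f (inv\<^bsub>G\<^esub> g \<otimes>\<^bsub>G\<^esub> x) else 0)"

definition right_trans :: "('g, 'm) monoid_scheme \<Rightarrow> 'g \<Rightarrow> 'g l2_op" where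
  "right_trans G g = (\<lambda>f\<in>l2 G. \<lambda>x. if x \<in> carrier G then f (x \<otimes>\<^bsub>G\<^esub> g) else 0)"

text \<open>The group von Neumann algebra \<open>\<N>(G)\<close>: the bounded operators on \<open>\<ell>\<^sup>2(G)\<close> that are equivariant
  for left translation. It contains the group ring via \<open>g \<mapsto> \<rho>\<^sub>g\<close>.\<close>

definition vN_algebra :: "('g, 'm) monoid_scheme \<Rightarrow> 'g l2_op ring" where
  "vN_algebra G =
     \<lparr>carrier = {T \<in> l2_bounded_ops G.
        \<forall>g\<in>carrier G. \<forall>f\<in>l2 G. T (left_trans G g f) = left_trans G g (T f)},
      mult = (\<lambda>S T. \<lambda>f\<in>l2 G. S (T f)),
      one = (\<lambda>f\<in>l2 G. f),
      zero = (\<lambda>f\<in>l2 G. \<lambda>x. 0),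
      add = (\<lambda>S T. \<lambda>f\<in>l2 G. \<lambda>x. S f x + T f x)\<rparr>"

text \<open>The standard trace \<open>T \<mapsto> \<langle>T \<delta>\<^sub>1, \<delta>\<^sub>1\<rangle>\<close>.\<close>

definition vN_trace :: "('g, 'm) monoid_scheme \<Rightarrow> 'g l2_op \<Rightarrow> complex" where
  "vN_trace G T = T (\<lambda>x. if x = \<one>\<^bsub>G\<^esub> then 1 else 0) \<one>\<^bsub>G\<^esub>"


section \<open>Left modules\<close>

text \<open>The locale \<^locale>\<open>module\<close> presupposes a commutative ring, whereas \<open>\<N>(G)\<close> is not commutative.
  Left modules are therefore only represented by the record type, whose ring-multiplication fields
  are irrelevant. The locale \<^locale>\<open>submodule\<close> does not involve commutativity.\<close>

definition module_isos ::
    "('r, 'm) ring_scheme \<Rightarrow> ('r, 'a, 'n) module_scheme \<Rightarrow> ('r, 'b, 'k) module_scheme \<Rightarrow> ('a \<Rightarrow> 'b) set"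
  where
  "module_isos R M N = {\<phi>. bij_betw \<phi> (carrier M) (carrier N)
     \<and> (\<forall>x\<in>carrier M. \<forall>y\<in>carrier M. \<phi> (x \<oplus>\<^bsub>M\<^esub> y) = \<phi> x \<oplus>\<^bsub>N\<^esub> \<phi> y)
     \<and> (\<forall>r\<in>carrier R. \<forall>x\<in>carrier M. \<phi> (r \<odot>\<^bsub>M\<^esub> x) = r \<odot>\<^bsub>N\<^esub> \<phi> x)}"

text \<open>The free left module on a set \<open>I\<close>.\<close>

definition free_mod :: "('r, 'm) ring_scheme \<Rightarrow> 'i set \<Rightarrow> ('r, 'i \<Rightarrow> 'r) module" where
  "free_mod R I =
     \<lparr>carrier = {c \<in> I \<rightarrow>\<^sub>E carrier R. finite {i\<in>I. c i \<noteq> \<zero>\<^bsub>R\<^esub>}},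
      mult = undefined, one = undefined,
      zero = (\<lambda>i\<in>I. \<zero>\<^bsub>R\<^esub>),
      add = (\<lambda>c d. \<lambda>i\<in>I. c i \<oplus>\<^bsub>R\<^esub> d i),
      smult = (\<lambda>r c. \<lambda>i\<in>I. r \<otimes>\<^bsub>R\<^esub> c i)\<rparr>"

definition free_supp :: "('r, 'm) ring_scheme \<Rightarrow> 'i set \<Rightarrow> ('i \<Rightarrow> 'r) \<Rightarrow> 'i set" where
  "free_supp R I c = {i\<in>I. c i \<noteq> \<zero>\<^bsub>R\<^esub>}"

definition free_single :: "('r, 'm) ring_scheme \<Rightarrow> 'i set \<Rightarrow> 'r \<Rightarrow> 'i \<Rightarrow> ('i \<Rightarrow> 'r)" where
  "free_single R I r i = (\<lambda>j\<in>I. if j = i then r else \<zero>\<^bsub>R\<^esub>)"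

definition quot_mod :: "('r, 'a, 'n) module_scheme \<Rightarrow> 'a set \<Rightarrow> ('r, 'a set) module" where
  "quot_mod M B =
     \<lparr>carrier = a_rcosets\<^bsub>M\<^esub> B,
      mult = undefined, one = undefined,
      zero = B,
      add = set_add M,
      smult = (\<lambda>r X. \<Union>x\<in>X. B +>\<^bsub>M\<^esub> (r \<odot>\<^bsub>M\<^esub> x))\<rparr>"


section \<open>Lueck's extended von Neumann dimension\<close>

definition idempotent_matrix :: "('r, 'm) ring_scheme \<Rightarrow> nat \<Rightarrow> (nat \<Rightarrow> nat \<Rightarrow> 'r) \<Rightarrow> bool" where
  "idempotent_matrix R n A \<longleftrightarrow>
     (\<forall>i<n. \<forall>j<n. A i j \<in> carrier R) \<and>
     (\<forall>i<n. \<forall>j<n. (\<Oplus>\<^bsub>R\<^esub>k\<in>{..<n}. A i k \<otimes>\<^bsub>R\<^esub> A k j) = A i j)"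

text \<open>The left module \<open>R\<^sup>n A\<close>, i.e. the image of right multiplication by \<open>A\<close> on row vectors.\<close>

definition row_image :: "('r, 'm) ring_scheme \<Rightarrow> nat \<Rightarrow> (nat \<Rightarrow> nat \<Rightarrow> 'r) \<Rightarrow> ('r, nat \<Rightarrow> 'r) module" where
  "row_image R n A = (free_mod R {..<n})
     \<lparr>carrier := (\<lambda>x. \<lambda>j\<in>{..<n}. \<Oplus>\<^bsub>R\<^esub>i\<in>{..<n}. x i \<otimes>\<^bsub>R\<^esub> A i j) ` carrier (free_mod R {..<n})\<rparr>"

text \<open>A left \<open>\<N>(G)\<close>-module \<open>P\<close> is finitely generated projective iff it is isomorphic to \<open>\<N>(G)\<^sup>n A\<close> for
  some idempotent matrix \<open>A\<close>, and then \<open>dim P = tr A\<close>, which is a nonnegative real number independent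
  of the choice of \<open>A\<close>.\<close>

definition fg_projective_dim ::
    "('g, 'm) monoid_scheme \<Rightarrow> ('g l2_op, 'a, 'n) module_scheme \<Rightarrow> real \<Rightarrow> bool" where
  "fg_projective_dim G P d \<longleftrightarrow>
     (\<exists>n A. idempotent_matrix (vN_algebra G) n A
        \<and> module_isos (vN_algebra G) P (row_image (vN_algebra G) n A) \<noteq> {}
        \<and> d = Re (\<Sum>i<n. vN_trace G (A i i)))"

text \<open>The dimension of an arbitrary module is the supremum of the dimensions of its finitely
  generated projective submodules.\<close>

definition vN_dim :: "('g, 'm) monoid_scheme \<Rightarrow> ('g l2_op, 'a, 'n) module_scheme \<Rightarrow> ereal" where
  "vN_dim G M = Sup {ereal d | d P.
     submodule P (vN_algebra G) M \<and> fg_projective_dim G (M\<lparr>carrier := P\<rparr>) d}"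


section \<open>First homology with coefficients in \<open>\<N>(G)\<close>\<close>

text \<open>The complex \<open>\<N>(G) \<otimes>\<^bsub>\<int>G\<^esub> Bar\<^sub>*(G)\<close> in degrees at most 2, where \<open>Bar\<^sub>*(G)\<close> is the inhomogeneous
  (unnormalized) bar resolution:
  \<open>d\<^sub>1 (m [g]) = m g - m\<close> and \<open>d\<^sub>2 (m [g|h]) = m g [h] - m [g h] + m [g]\<close>, with \<open>g\<close> acting on
  \<open>\<N>(G)\<close> from the right as multiplication by \<open>\<rho>\<^sub>g\<close>. The sums range over supports because
  \<^const>\<open>finsum\<close> is only meaningful over finite index sets.\<close>

definition bar1 :: "('g, 'm) monoid_scheme \<Rightarrow> ('g l2_op, 'g \<Rightarrow> 'g l2_op) module" where
  "bar1 G = free_mod (vN_algebra G) (carrier G)"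

definition bar2 :: "('g, 'm) monoid_scheme \<Rightarrow> ('g l2_op, 'g \<times> 'g \<Rightarrow> 'g l2_op) module" where
  "bar2 G = free_mod (vN_algebra G) (carrier G \<times> carrier G)"

definition bar_d1 :: "('g, 'm) monoid_scheme \<Rightarrow> ('g \<Rightarrow> 'g l2_op) \<Rightarrow> 'g l2_op" where
  "bar_d1 G c =
     (let N = vN_algebra G in
      \<Oplus>\<^bsub>N\<^esub>g\<in>free_supp N (carrier G) c. c g \<otimes>\<^bsub>N\<^esub> right_trans G g \<ominus>\<^bsub>N\<^esub> c g)"

definition bar_d2 :: "('g, 'm) monoid_scheme \<Rightarrow> ('g \<times> 'g \<Rightarrow> 'g l2_op) \<Rightarrow> ('g \<Rightarrow> 'g l2_op)" where
  "bar_d2 G c =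
     (let N = vN_algebra G; C1 = bar1 G; s = free_single N (carrier G) in
      \<Oplus>\<^bsub>C1\<^esub>p\<in>free_supp N (carrier G \<times> carrier G) c.
        s (c p \<otimes>\<^bsub>N\<^esub> right_trans G (fst p)) (snd p)
        \<ominus>\<^bsub>C1\<^esub> s (c p) (fst p \<otimes>\<^bsub>G\<^esub> snd p)
        \<oplus>\<^bsub>C1\<^esub> s (c p) (fst p))"

definition H1_vN :: "('g, 'm) monoid_scheme \<Rightarrow> ('g l2_op, ('g \<Rightarrow> 'g l2_op) set) module" where
  "H1_vN G = quot_mod
     ((bar1 G)\<lparr>carrier := {c \<in> carrier (bar1 G). bar_d1 G c = \<zero>\<^bsub>vN_algebra G\<^esub>}\<rparr>)
     (bar_d2 G ` carrier (bar2 G))"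

definition first_L2_betti :: "('g, 'm) monoid_scheme \<Rightarrow> ereal" where
  "first_L2_betti G = vN_dim G (H1_vN G)"

end

theory Submission
  imports Defs "HOL-Complex_Analysis.Great_Picard"
begin

text \<open>
  Let \<open>w\<^sub>1\<^bsup>m\<^sub>1\<^esup>, \<dots>, w\<^sub>n\<^bsup>m\<^sub>n\<^esup>\<close> be words in two letters and \<open>Q\<close> a finite 2-generated group satisfying these
  relations. The edge weights on the Cayley graph of \<open>Q\<close> that are divergence free and have sum zero
  along all relator loops are given by at most \<open>|Q| + \<Sum>\<^sub>i |Q| / ord(w\<^sub>i)\<close> equations in \<open>2 |Q|\<close> unknowns.
  If the orders are so large that \<open>\<Sum>\<^sub>i 1 / ord(w\<^sub>i) \<le> 1/2\<close>, then the projection onto the solutions has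
  trace at least \<open>|Q| / 2\<close>, so after a translation some solution of norm at most one takes a value
  \<open>\<ge> 1/4\<close> at an edge at the identity. Its sums also vanish along every word that is trivial in all
  finite groups satisfying the relations, because otherwise reducing the solution modulo \<open>k\<close> would give
  a finite extension of \<open>Q\<close> in which that word is nontrivial.

  Relators are added one after the other: either some power of the next word is already trivial in
  all finite groups satisfying the previous relations, or a large order of this word can be achieved
  in one of them without lowering the earlier orders, and the corresponding power is added. The words that are
  eventually trivial in all these finite groups define an infinite torsion group \<open>G\<close>, which is a limit of
  finite groups \<open>Q\<close> as above. A pointwise limit of the solutions is a nonzero square summable
  divergence free flow on \<open>G\<close> whose sums along all loops vanish.

  The space of such flows is closed and invariant, hence the image of a projection \<open>p\<close> over \<open>\<N>(G)\<close>
  with positive trace. The elements of \<open>\<N>(G)\<^sup>2 p\<close> are 1-cycles since flows are divergence free. Summing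
  a flow along paths gives a 1-cocycle with values in \<open>\<ell>\<^sup>2(G)\<close>, and these cocycles detect that no nonzero
  element of \<open>\<N>(G)\<^sup>2 p\<close> is a boundary.
\<close>

section \<open>Congruences on words\<close>

text \<open>Dimensions of solution spaces need not pass to limits of groups. A single solution does
  once its value at the identity is bounded below, so ranks are counted only in finite groups.

  Every stage involves two congruences. The flow lives on the finite quotient by \<theta>, but its
  sums are controlled only along pairs of words in \<open>residual_closure R\<close>. Zero sums
  along all loops of the finite Cayley graph would make the flow a gradient, and a divergence free
  gradient on a finite connected graph is zero. In the limit the two congruences merge: the closures
  increase to \<open>N\<close>, and the \<theta> contain them and separate more and more of the
  words that \<open>N\<close> separates. Relations are read off from finite quotients so that this
  separation can take place in finite groups.

  Solutions are taken over the rationals because reduction modulo \<open>k\<close> needs a common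
  denominator. As for the bound on the orders, the vertex equations use up half of the
  \<open>2 |Q|\<close> dimensions; the relators together, however many they are, may use up half of
  the rest.\<close>

definition wpow :: "'a list \<Rightarrow> nat \<Rightarrow> 'a list" where
  "wpow w k = concat (replicate k w)"

lemma wpow_0 [simp]: "wpow w 0 = []"
  and wpow_Suc [simp]: "wpow w (Suc k) = w @ wpow w k"
  by (simp_all add: wpow_def)

lemma wpow_add: "wpow w (i + j) = wpow w i @ wpow w j"
  by (simp add: wpow_def replicate_add)

lemma wpow_mult: "wpow w (i * j) = wpow (wpow w i) j"
  by (induction j) (simp_all add: wpow_add)

lemma wpow_commute: "wpow w k @ w = w @ wpow w k"
  by (induction k) simp_all

text \<open>The quotient of the free monoid by such a congruence is a torsion group. Since inverses are
  positive powers, no formal inverses of letters are needed.\<close>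

locale torsion_congruence =
  fixes \<theta> :: "('a list \<times> 'a list) set"
  assumes equiv: "equiv UNIV \<theta>"
    and append_left: "(s, t) \<in> \<theta> \<Longrightarrow> (v @ s, v @ t) \<in> \<theta>"
    and append_right: "(s, t) \<in> \<theta> \<Longrightarrow> (s @ v, t @ v) \<in> \<theta>"
    and torsion: "\<exists>k>0. (wpow w k, []) \<in> \<theta>"
begin

lemma refl [simp]: "(s, s) \<in> \<theta>"
  using equiv by (simp add: equiv_def refl_on_def)

lemma sym: "(s, t) \<in> \<theta> \<Longrightarrow> (t, s) \<in> \<theta>"
  using equiv by (meson equivE symE)

lemma trans: "(s, t) \<in> \<theta> \<Longrightarrow> (t, v) \<in> \<theta> \<Longrightarrow> (s, v) \<in> \<theta>"
  using equiv by (meson equivE transE)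

lemma append_cong: "(s, s') \<in> \<theta> \<Longrightarrow> (t, t') \<in> \<theta> \<Longrightarrow> (s @ t, s' @ t') \<in> \<theta>"
  by (meson append_left append_right trans)

lemma wpow_Nil: "(s, []) \<in> \<theta> \<Longrightarrow> (wpow s k, []) \<in> \<theta>"
  using append_cong[of s "[]" _ "[]"] by (induction k) simp_all

lemma inverse_word: "\<exists>v. (v @ w, []) \<in> \<theta> \<and> (w @ v, []) \<in> \<theta>"
proof -
  obtain k where "k > 0" "(wpow w k, []) \<in> \<theta>" using torsion by blast
  then obtain j where "k = Suc j" by (cases k) auto
  then show ?thesis
    using \<open>(wpow w k, []) \<in> \<theta>\<close> by (intro exI[of _ "wpow w j"]) (simp add: wpow_commute)
qed

lemma cancel_left: "(v @ s, v @ t) \<in> \<theta> \<longleftrightarrow> (s, t) \<in> \<theta>"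
proof
  assume a: "(v @ s, v @ t) \<in> \<theta>"
  obtain i where i: "(i @ v, []) \<in> \<theta>" using inverse_word by blast
  have "(i @ v @ s, i @ v @ t) \<in> \<theta>" using append_left[OF a] .
  moreover have "((i @ v) @ s, [] @ s) \<in> \<theta>" "((i @ v) @ t, [] @ t) \<in> \<theta>"
    using append_right[OF i] by blast+
  ultimately show "(s, t) \<in> \<theta>" by simp (blast intro: sym trans)
qed (rule append_left)

lemma cancel_right: "(s @ v, t @ v) \<in> \<theta> \<longleftrightarrow> (s, t) \<in> \<theta>"
proof
  assume a: "(s @ v, t @ v) \<in> \<theta>"
  obtain i where i: "(v @ i, []) \<in> \<theta>" using inverse_word by blast
  have "((s @ v) @ i, (t @ v) @ i) \<in> \<theta>" using append_right[OF a] .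
  moreover have "(s @ v @ i, s @ []) \<in> \<theta>" "(t @ v @ i, t @ []) \<in> \<theta>"
    using append_left[OF i] by blast+
  ultimately show "(s, t) \<in> \<theta>" by simp (blast intro: sym trans)
qed (rule append_right)

section \<open>Orders of words and representatives of classes\<close>

definition ord :: "'a list \<Rightarrow> nat" where
  "ord w = (LEAST k. k > 0 \<and> (wpow w k, []) \<in> \<theta>)"

lemma ord_pos: "ord w > 0" and wpow_ord: "(wpow w (ord w), []) \<in> \<theta>"
  using LeastI_ex[OF torsion[of w]] by (auto simp: ord_def)

lemma ord_le: "k > 0 \<Longrightarrow> (wpow w k, []) \<in> \<theta> \<Longrightarrow> ord w \<le> k"
  by (simp add: ord_def Least_le)

lemma ord_dvd:
  assumes "(wpow w m, []) \<in> \<theta>"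
  shows "ord w dvd m"
proof (rule ccontr)
  let ?o = "ord w"
  assume "\<not> ?o dvd m"
  then have pos: "m mod ?o > 0" by (simp add: mod_greater_zero_iff_not_dvd)
  have "wpow w m = wpow (wpow w ?o) (m div ?o) @ wpow w (m mod ?o)"
    by (metis wpow_add wpow_mult mult_div_mod_eq)
  moreover have "(wpow (wpow w ?o) (m div ?o) @ wpow w (m mod ?o), [] @ wpow w (m mod ?o)) \<in> \<theta>"
    using append_right wpow_Nil wpow_ord by blast
  ultimately have "(wpow w (m mod ?o), []) \<in> \<theta>" using assms by (metis append_Nil sym trans)
  then show False using ord_le[OF pos] ord_pos[of w] by (meson mod_less_divisor not_le)
qed

lemma wpow_inj_below_ord:
  assumes "i < ord w" "j < ord w" "(wpow w i, wpow w j) \<in> \<theta>"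
  shows "i = j"
proof -
  have "i = j" if "i \<le> j" "j < ord w" "(wpow w i, wpow w j) \<in> \<theta>" for i j
  proof -
    have "wpow w j = wpow w i @ wpow w (j - i)" using that by (simp flip: wpow_add)
    then have "(wpow w i @ [], wpow w i @ wpow w (j - i)) \<in> \<theta>" using that by simp
    then have "(wpow w (j - i), []) \<in> \<theta>" using cancel_left sym by blast
    then show "i = j" using ord_le[of "j - i" w] that by (cases "i = j") auto
  qed
  then show ?thesis using assms sym by (metis nat_le_linear)
qed

text \<open>Elements of the quotient are encoded by chosen words, so that \<open>range rep\<close>
  serves as the vertex set of the Cayley graph. The chosen word depends only on the class, because
  equivalent words give the choice operator the same predicate.\<close>

definition rep :: "'a list \<Rightarrow> 'a list" where
  "rep w = (SOME v. (w, v) \<in> \<theta>)"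

lemma rep: "(w, rep w) \<in> \<theta>"
  unfolding rep_def by (rule someI[of _ w]) simp

lemma rep_eq_iff: "rep s = rep t \<longleftrightarrow> (s, t) \<in> \<theta>"
proof
  assume "rep s = rep t" then show "(s, t) \<in> \<theta>" using rep[of s] rep[of t] sym trans by metis
next
  assume "(s, t) \<in> \<theta>"
  then have "(s, v) \<in> \<theta> \<longleftrightarrow> (t, v) \<in> \<theta>" for v by (meson sym trans)
  then show "rep s = rep t" by (simp add: rep_def)
qed

lemma rep_rep [simp]: "rep (rep w) = rep w"
  by (metis rep rep_eq_iff)

end

locale finite_congruence = torsion_congruence +
  assumes finite_index: "finite (range rep)"

text \<open>The map \<open>f\<close> may split classes but never merges two of them, so
  \<open>rep w\<close> is a function of \<open>f w\<close>.\<close>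

lemma finite_congruenceI:
  assumes "torsion_congruence \<theta>" "finite (range f)" "\<And>s t. f s = f t \<Longrightarrow> (s, t) \<in> \<theta>"
  shows "finite_congruence \<theta>"
proof -
  interpret torsion_congruence \<theta> by fact
  have "rep w = rep (inv_into UNIV f (f w))" for w
    using assms(3)[of w "inv_into UNIV f (f w)"] by (simp add: rep_eq_iff f_inv_into_f)
  then have "range rep \<subseteq> (rep \<circ> inv_into UNIV f) ` range f" by auto
  then have "finite (range rep)" using assms(2) finite_subset by blast
  then show ?thesis by unfold_locales
qed

lemma finite_congruence_UNIV: "finite_congruence UNIV"
proof (rule finite_congruenceI[where f = "\<lambda>_. ()"])
  show "torsion_congruence UNIV"
    by unfold_locales (auto simp: equiv_def refl_on_def sym_def trans_def)
qed auto

section \<open>Intersections of congruences\<close>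

lemma torsion_congruence_Int:
  assumes "torsion_congruence \<theta>" "torsion_congruence \<eta>"
  shows "torsion_congruence (\<theta> \<inter> \<eta>)"
proof -
  interpret A: torsion_congruence \<theta> by fact
  interpret B: torsion_congruence \<eta> by fact
  show ?thesis
  proof
    show "equiv UNIV (\<theta> \<inter> \<eta>)"
      using A.sym B.sym by (auto intro!: equivI refl_onI symI transI dest: A.trans B.trans)
    show "\<exists>k>0. (wpow w k, []) \<in> \<theta> \<inter> \<eta>" for w
    proof (intro exI conjI)
      show "A.ord w * B.ord w > 0" using A.ord_pos B.ord_pos by simp
      show "(wpow w (A.ord w * B.ord w), []) \<in> \<theta> \<inter> \<eta>"
        using A.wpow_Nil[OF A.wpow_ord] B.wpow_Nil[OF B.wpow_ord]
        by (metis IntI mult.commute wpow_mult)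
    qed
  qed (auto intro: A.append_left B.append_left A.append_right B.append_right)
qed

text \<open>The quotient by an intersection embeds into the product of the two quotients.\<close>

lemma finite_congruence_Int:
  assumes "finite_congruence \<theta>" "finite_congruence \<eta>"
  shows "finite_congruence (\<theta> \<inter> \<eta>)"
proof -
  interpret A: finite_congruence \<theta> by fact
  interpret B: finite_congruence \<eta> by fact
  show ?thesis
  proof (rule finite_congruenceI[where f = "\<lambda>w. (A.rep w, B.rep w)"])
    show "torsion_congruence (\<theta> \<inter> \<eta>)"
      using torsion_congruence_Int A.torsion_congruence_axioms B.torsion_congruence_axioms by blast
    have "range (\<lambda>w. (A.rep w, B.rep w)) \<subseteq> range A.rep \<times> range B.rep" by auto
    then show "finite (range (\<lambda>w. (A.rep w, B.rep w)))"
      using A.finite_index B.finite_index by (meson finite_SigmaI finite_subset)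
  qed (auto simp: A.rep_eq_iff B.rep_eq_iff)
qed

lemma finite_congruence_INT:
  assumes "finite I" "\<And>i. i \<in> I \<Longrightarrow> finite_congruence (\<theta> i)"
  shows "finite_congruence (\<Inter>i\<in>I. \<theta> i)"
  using assms
  by (induction I rule: finite_induct) (auto intro: finite_congruence_UNIV finite_congruence_Int)

lemma ord_mono:
  assumes "torsion_congruence \<theta>" "torsion_congruence \<eta>" "\<theta> \<subseteq> \<eta>"
  shows "torsion_congruence.ord \<eta> w \<le> torsion_congruence.ord \<theta> w"
proof -
  interpret A: torsion_congruence \<theta> by fact
  interpret B: torsion_congruence \<eta> by fact
  show ?thesis using B.ord_le A.ord_pos A.wpow_ord assms(3) by blast
qed

section \<open>Path sums\<close>

text \<open>The transition function is a parameter because paths are followed both on words, by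
  appending letters, and in a group, by multiplying with generators. The weights will be integral,
  rational, real and complex.\<close>

primrec path_sum :: "('q \<Rightarrow> 'a \<Rightarrow> 'q) \<Rightarrow> ('q \<Rightarrow> 'a \<Rightarrow> 'b::comm_monoid_add) \<Rightarrow> 'q \<Rightarrow> 'a list \<Rightarrow> 'b"
  where
    "path_sum \<delta> u q [] = 0"
  | "path_sum \<delta> u q (x # s) = u q x + path_sum \<delta> u (\<delta> q x) s"

lemma path_sum_append:
  "path_sum \<delta> u q (s @ t) = path_sum \<delta> u q s + path_sum \<delta> u (foldl \<delta> q s) t"
  by (induction s arbitrary: q) (auto simp: add.assoc)

abbreviation word_sum :: "('a list \<Rightarrow> 'a \<Rightarrow> 'b::comm_monoid_add) \<Rightarrow> 'a list \<Rightarrow> 'a list \<Rightarrow> 'b" where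
  "word_sum \<equiv> path_sum (\<lambda>q x. q @ [x])"

lemma foldl_snoc [simp]: "foldl (\<lambda>q x. q @ [x]) q s = q @ s"
  by (induction s arbitrary: q) auto

lemma word_sum_append: "word_sum u q (s @ t) = word_sum u q s + word_sum u (q @ s) t"
  by (simp add: path_sum_append)

lemma word_sum_shift: "word_sum (\<lambda>s. u (p @ s)) q s = word_sum u (p @ q) s"
  by (induction s arbitrary: q) auto

lemma path_sum_mult:
  "path_sum \<delta> (\<lambda>q x. c * u q x) q s = (c :: 'b::semiring_0) * path_sum \<delta> u q s"
  by (induction s arbitrary: q) (auto simp: distrib_left)

lemma path_sum_add: "path_sum \<delta> (\<lambda>q x. u q x + v q x) q s = path_sum \<delta> u q s + path_sum \<delta> v q s"
  by (induction s arbitrary: q) (auto simp: algebra_simps)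

lemma tendsto_path_sum:
  fixes u :: "nat \<Rightarrow> 'q \<Rightarrow> 'a \<Rightarrow> 'b::topological_comm_monoid_add"
  assumes "\<And>q x. (\<lambda>n. u n q x) \<longlonglongrightarrow> l q x"
  shows "(\<lambda>n. path_sum \<delta> (u n) q s) \<longlonglongrightarrow> path_sum \<delta> l q s"
  by (induction s arbitrary: q) (auto intro: tendsto_add assms)

lemma word_sum_of_int: "word_sum (\<lambda>s x. of_int (u s x)) q s = (of_int (word_sum u q s) :: 'b::ring_1)"
  by (induction s arbitrary: q) auto

lemma word_sum_of_rat: 
  "word_sum (\<lambda>s x. of_rat (u s x)) q s = (of_rat (word_sum u q s) :: 'b::field_char_0)"
  by (induction s arbitrary: q) (auto simp: of_rat_add)

context torsion_congruence
begin

definition invariant :: "('a list \<Rightarrow> 'a \<Rightarrow> 'b) \<Rightarrow> bool" where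
  "invariant u \<longleftrightarrow> (\<forall>s t. (s, t) \<in> \<theta> \<longrightarrow> u s = u t)"

lemma word_sum_base:
  "invariant u \<Longrightarrow> (p, q) \<in> \<theta> \<Longrightarrow> word_sum u p s = word_sum u q s"
proof (induction s arbitrary: p q)
  case (Cons x s)
  then have "word_sum u (p @ [x]) s = word_sum u (q @ [x]) s" using append_right by blast
  then show ?case using Cons.prems by (simp add: invariant_def)
qed simp

text \<open>As \<open>w\<close> reads a loop, each of the \<open>k\<close> copies is read from an
  equivalent vertex.\<close>

lemma word_sum_wpow:
  fixes u :: "'a list \<Rightarrow> 'a \<Rightarrow> 'b::comm_semiring_1"
  assumes "invariant u" "(w, []) \<in> \<theta>"
  shows "word_sum u q (wpow w k) = of_nat k * word_sum u q w"
proof (induction k)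
  case (Suc k)
  have "(q @ w, q @ []) \<in> \<theta>" using assms(2) by (rule append_left)
  then have "word_sum u (q @ w) (wpow w k) = word_sum u q (wpow w k)"
    using word_sum_base[OF assms(1)] by simp
  then show ?case using Suc by (simp add: word_sum_append algebra_simps)
qed simp

text \<open>Both sides arise from the sum along the power of \<open>w\<close> with exponent
  \<open>k + 1\<close>, by splitting off either the first or the last copy of \<open>w\<close>. The
  last copy starts where the loop has closed, so both contribute equally.\<close>

lemma word_sum_rotate:
  fixes u :: "'a list \<Rightarrow> 'a \<Rightarrow> 'b::cancel_comm_monoid_add"
  assumes "invariant u" "(wpow w k, []) \<in> \<theta>"
  shows "word_sum u (q @ w) (wpow w k) = word_sum u q (wpow w k)"
proof -
  have "(q @ wpow w k, q @ []) \<in> \<theta>" using assms(2) by (rule append_left)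
  then have "word_sum u (q @ wpow w k) w = word_sum u q w"
    using word_sum_base[OF assms(1)] by simp
  then have "word_sum u q (wpow w k @ w) = word_sum u q (wpow w k) + word_sum u q w"
    by (simp add: word_sum_append)
  moreover have "word_sum u q (w @ wpow w k) = word_sum u q w + word_sum u (q @ w) (wpow w k)"
    by (simp add: word_sum_append)
  ultimately show ?thesis by (metis add.commute add_left_cancel wpow_commute)
qed

end

text \<open>The quotient by the congruence below is an extension by the finite abelian group generated by
  the 1-cochain \<open>u\<close> modulo \<open>k\<close>.\<close>

lemma (in finite_congruence) finite_congruence_word_sum_mod:
  fixes u :: "'a list \<Rightarrow> 'a \<Rightarrow> int"
  assumes u: "invariant u" and k: "k > 0"
  shows "finite_congruence {(s, t). (s, t) \<in> \<theta> \<and> (\<forall>q. word_sum u q s mod k = word_sum u q t mod k)}"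
    (is "finite_congruence ?\<eta>")
proof (rule finite_congruenceI)
  show "torsion_congruence ?\<eta>"
  proof
    show "equiv UNIV ?\<eta>"
      by (auto intro!: equivI refl_onI symI transI dest: sym trans)
    show "(v @ s, v @ t) \<in> ?\<eta>" if "(s, t) \<in> ?\<eta>" for s t v
      using that append_left by (auto simp: word_sum_append intro: mod_add_cong)
    show "(s @ v, t @ v) \<in> ?\<eta>" if "(s, t) \<in> ?\<eta>" for s t v
    proof -
      have st: "(s, t) \<in> \<theta>" using that by auto
      then have "word_sum u (q @ s) v = word_sum u (q @ t) v" for q
        using word_sum_base[OF u] append_left by blast
      then show ?thesis
        using that append_right[OF st] by (auto simp: word_sum_append intro: mod_add_cong)
    qed
    show "\<exists>j>0. (wpow w j, []) \<in> ?\<eta>" for w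
    proof (intro exI conjI)
      \<comment> \<open>The factor \<open>ord w\<close> closes the path to a loop; the factor
        \<open>k\<close> then makes its sum divisible by \<open>k\<close>.\<close>
      let ?j = "ord w * nat k"
      show "?j > 0" using ord_pos k by simp
      have "word_sum u q (wpow w ?j) = k * word_sum u q (wpow w (ord w))" for q
        using word_sum_wpow[OF u wpow_ord, of q w "nat k"] k by (simp add: wpow_mult)
      then show "(wpow w ?j, []) \<in> ?\<eta>"
        using wpow_Nil[OF wpow_ord, of w "nat k"] by (simp add: wpow_mult)
    qed
  qed
next
  \<comment> \<open>Sums from representative base points determine all others, which leaves finitely
    many residues to record.\<close>
  let ?f = "\<lambda>s. (rep s, \<lambda>q\<in>range rep. word_sum u q s mod k)"
  have "range ?f \<subseteq> range rep \<times> (range rep \<rightarrow>\<^sub>E {0..<k})" using k by auto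
  then show "finite (range ?f)"
    using finite_index by (meson finite_PiE finite_SigmaI finite_atLeastLessThan_int finite_subset)
  show "(s, t) \<in> ?\<eta>" if "?f s = ?f t" for s t
  proof -
    have "word_sum u q s mod k = word_sum u q t mod k" for q
    proof -
      have "word_sum u (rep q) s mod k = word_sum u (rep q) t mod k"
        using that by (metis (no_types, lifting) Pair_inject rangeI restrict_apply')
      then show ?thesis using word_sum_base[OF u rep] by metis
    qed
    then show ?thesis using that rep_eq_iff by auto
  qed
qed

section \<open>Orthogonal projection onto the solutions of a linear system\<close>

text \<open>The matrix \<open>\<pi>\<close> is that of the orthogonal projection. No vector is normalized, so that rational
  equations give rational entries. Each equation lowers the trace by at most one.\<close>

lemma projection_matrix:
  fixes C :: "('e \<Rightarrow> 'k::linordered_field) set"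
  assumes E: "finite E" and C: "finite C"
  shows "\<exists>\<pi>. (\<forall>e\<in>E. \<forall>f\<in>E. \<pi> e f = \<pi> f e)
    \<and> (\<forall>e\<in>E. \<forall>g\<in>E. (\<Sum>f\<in>E. \<pi> e f * \<pi> f g) = \<pi> e g)
    \<and> (\<forall>c\<in>C. \<forall>e\<in>E. (\<Sum>f\<in>E. \<pi> e f * c f) = 0)
    \<and> (\<Sum>e\<in>E. \<pi> e e) \<ge> of_nat (card E) - of_nat (card C)"
  using C
proof (induction C rule: finite_induct)
  case empty
  have "(\<Sum>f\<in>E. of_bool (e = f) * of_bool (f = g)) = (\<Sum>f\<in>E. if f = e then of_bool (e = g) else 0 :: 'k)"
    for e g by (intro sum.cong) auto
  then show ?case
    using E by (intro exI[of _ "\<lambda>e f. of_bool (e = f)"]) auto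
next
  case (insert c C)
  then obtain \<pi> where sym: "\<And>e f. e \<in> E \<Longrightarrow> f \<in> E \<Longrightarrow> \<pi> e f = \<pi> f e"
    and idem: "\<And>e g. e \<in> E \<Longrightarrow> g \<in> E \<Longrightarrow> (\<Sum>f\<in>E. \<pi> e f * \<pi> f g) = \<pi> e g"
    and ann: "\<And>d e. d \<in> C \<Longrightarrow> e \<in> E \<Longrightarrow> (\<Sum>f\<in>E. \<pi> e f * d f) = 0"
    and tr: "(\<Sum>e\<in>E. \<pi> e e) \<ge> of_nat (card E) - of_nat (card C)"
    by blast
  \<comment> \<open>The vector \<open>a\<close> is the part of the new equation \<open>c\<close>
    inside the current solution space. The solutions that also satisfy \<open>c\<close> are those
    orthogonal to \<open>a\<close>, so the rank one projection onto \<open>a\<close> has to be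
    subtracted; dividing by the squared norm \<open>n\<close> avoids square roots.\<close>
  define a where "a e = (\<Sum>f\<in>E. \<pi> e f * c f)" for e
  have \<pi>a: "(\<Sum>f\<in>E. \<pi> e f * a f) = a e" if "e \<in> E" for e
  proof -
    have "(\<Sum>f\<in>E. \<pi> e f * a f) = (\<Sum>f\<in>E. \<Sum>g\<in>E. \<pi> e f * \<pi> f g * c g)"
      by (simp add: a_def sum_distrib_left mult.assoc)
    also have "\<dots> = (\<Sum>g\<in>E. \<Sum>f\<in>E. \<pi> e f * \<pi> f g * c g)" by (rule sum.swap)
    also have "\<dots> = (\<Sum>g\<in>E. \<pi> e g * c g)"
      using idem that by (intro sum.cong) (auto simp flip: sum_distrib_right)
    finally show ?thesis by (simp add: a_def)
  qed
  define n where "n = (\<Sum>e\<in>E. a e * a e)"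
  have ac: "(\<Sum>e\<in>E. a e * c e) = n"
  proof -
    have "a e * a e = (\<Sum>f\<in>E. a e * (\<pi> e f * c f))" for e
      by (subst (2) a_def) (rule sum_distrib_left)
    then have "n = (\<Sum>e\<in>E. \<Sum>f\<in>E. a e * (\<pi> e f * c f))" by (simp add: n_def)
    also have "\<dots> = (\<Sum>f\<in>E. \<Sum>e\<in>E. a e * (\<pi> e f * c f))" by (rule sum.swap)
    also have "\<dots> = (\<Sum>f\<in>E. a f * c f)"
    proof (rule sum.cong[OF HOL.refl])
      fix f assume f: "f \<in> E"
      have "(\<Sum>e\<in>E. a e * (\<pi> e f * c f)) = (\<Sum>e\<in>E. \<pi> f e * a e * c f)"
        using sym f by (intro sum.cong) (auto simp: algebra_simps)
      also have "\<dots> = a f * c f" using \<pi>a[OF f] by (simp flip: sum_distrib_right)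
      finally show "(\<Sum>e\<in>E. a e * (\<pi> e f * c f)) = a f * c f" .
    qed
    finally show ?thesis by simp
  qed
  show ?case
  \<comment> \<open>In the degenerate case \<open>a\<close> vanishes: the new equation already holds
    on the whole solution space.\<close>
  proof (cases "n = 0")
    case True
    then have "a e = 0" if "e \<in> E" for e
      using that E by (simp add: n_def sum_nonneg_eq_0_iff)
    then have "\<forall>d\<in>insert c C. \<forall>e\<in>E. (\<Sum>f\<in>E. \<pi> e f * d f) = 0"
      using ann by (auto simp: a_def)
    then show ?thesis
      using sym idem tr insert by (intro exI[of _ \<pi>]) auto
  next
    case False
    define \<rho> where "\<rho> e f = \<pi> e f - a e * a f / n" for e f
    have "(\<Sum>f\<in>E. \<rho> e f * \<rho> f g) = \<rho> e g" if e: "e \<in> E" and g: "g \<in> E" for e g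
    proof -
      have "(\<Sum>f\<in>E. \<rho> e f * \<rho> f g) = (\<Sum>f\<in>E. \<pi> e f * \<pi> f g - \<pi> e f * a f * (a g / n)
          - \<pi> g f * a f * (a e / n) + a f * a f * (a e * a g / (n * n)))"
        using sym[OF _ g] by (intro sum.cong) (auto simp: \<rho>_def algebra_simps)
      also have "\<dots> = \<pi> e g - a e * (a g / n) - a g * (a e / n) + n * (a e * a g / (n * n))"
        using idem[OF e g] \<pi>a[OF e] \<pi>a[OF g]
        by (simp add: sum.distrib sum_subtractf n_def flip: sum_distrib_right sum_divide_distrib)
      also have "\<dots> = \<rho> e g" using False by (simp add: \<rho>_def field_simps)
      finally show ?thesis .
    qed
    moreover have "(\<Sum>f\<in>E. \<rho> e f * d f) = 0" if "d \<in> insert c C" "e \<in> E" for d e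
    proof -
      have eq: "(\<Sum>f\<in>E. \<rho> e f * d f) = (\<Sum>f\<in>E. \<pi> e f * d f) - a e / n * (\<Sum>f\<in>E. a f * d f)"
        by (simp add: \<rho>_def algebra_simps sum_subtractf sum_distrib_left)
      show ?thesis
      proof (cases "d = c")
        case True
        then show ?thesis using eq ac False by (simp flip: a_def)
      next
        case d: False
        have "a f * d f = (\<Sum>g\<in>E. c g * (\<pi> g f * d f))" if "f \<in> E" for f
          unfolding a_def sum_distrib_right using sym that by (intro sum.cong) auto
        then have "(\<Sum>f\<in>E. a f * d f) = (\<Sum>f\<in>E. \<Sum>g\<in>E. c g * (\<pi> g f * d f))" by simp
        also have "\<dots> = (\<Sum>g\<in>E. \<Sum>f\<in>E. c g * (\<pi> g f * d f))" by (rule sum.swap)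
        also have "\<dots> = 0" using ann d that by (simp flip: sum_distrib_left)
        finally show ?thesis using eq ann d that by simp
      qed
    qed
    moreover have "(\<Sum>e\<in>E. \<rho> e e) = (\<Sum>e\<in>E. \<pi> e e) - 1"
      using False by (simp add: \<rho>_def sum_subtractf n_def flip: sum_divide_distrib)
    moreover have "\<rho> e f = \<rho> f e" if "e \<in> E" "f \<in> E" for e f
      using sym that by (simp add: \<rho>_def)
    ultimately show ?thesis
      using tr insert by (intro exI[of _ \<rho>]) auto
  qed
qed

text \<open>By symmetry and idempotence, row \<open>e\<close> of a projection matrix has squared
  norm equal to its own entry at \<open>e\<close>. The row with the largest diagonal entry is taken,
  and that entry is at least the average, which the trace bounds from below.\<close>

lemma large_diagonal_solution:
  fixes C :: "('e \<Rightarrow> 'k::linordered_field) set"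
  assumes E: "finite E" "E \<noteq> {}" and C: "finite C"
  shows "\<exists>e\<in>E. \<exists>u. (\<forall>c\<in>C. (\<Sum>f\<in>E. u f * c f) = 0) \<and> (\<Sum>f\<in>E. (u f)\<^sup>2) = u e
    \<and> u e * of_nat (card E) \<ge> of_nat (card E) - of_nat (card C)"
proof -
  obtain \<pi> where sym: "\<And>e f. e \<in> E \<Longrightarrow> f \<in> E \<Longrightarrow> \<pi> e f = \<pi> f e"
    and idem: "\<And>e g. e \<in> E \<Longrightarrow> g \<in> E \<Longrightarrow> (\<Sum>f\<in>E. \<pi> e f * \<pi> f g) = \<pi> e g"
    and ann: "\<And>d e. d \<in> C \<Longrightarrow> e \<in> E \<Longrightarrow> (\<Sum>f\<in>E. \<pi> e f * d f) = 0"
    and tr: "(\<Sum>e\<in>E. \<pi> e e) \<ge> of_nat (card E) - of_nat (card C)"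
    using projection_matrix[OF E(1) C] by blast
  define m where "m = Max ((\<lambda>e. \<pi> e e) ` E)"
  have "m \<in> (\<lambda>e. \<pi> e e) ` E" unfolding m_def using E by (intro Max_in) auto
  then obtain e where e: "e \<in> E" "m = \<pi> e e" by auto
  have "(\<Sum>f\<in>E. \<pi> f f) \<le> (\<Sum>f\<in>E. m)"
    using E by (intro sum_mono) (auto simp: m_def)
  then have "\<pi> e e * of_nat (card E) \<ge> of_nat (card E) - of_nat (card C)"
    using tr e by (simp add: mult.commute)
  moreover have "(\<Sum>f\<in>E. (\<pi> e f)\<^sup>2) = \<pi> e e"
    using idem[OF e(1) e(1)] sym e(1) by (simp add: power2_eq_square)
  ultimately show ?thesis using e ann by (intro bexI[of _ e] exI[of _ "\<pi> e"]) auto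
qed

lemma common_denominator:
  assumes "finite A"
  shows "\<exists>D>0. \<forall>r\<in>A. \<exists>z. of_int D * r = (of_int z :: rat)"
  using assms
proof (induction A rule: finite_induct)
  case empty
  show ?case by (rule exI[of _ 1]) simp
next
  case (insert r A)
  then obtain D where D: "D > 0" "\<forall>r\<in>A. \<exists>z. of_int D * r = (of_int z :: rat)" by blast
  obtain a b where r: "r = Fract a b" "b > 0" "coprime a b" by (rule Rat_cases[of r])
  have "\<exists>z. of_int (D * b) * r = (of_int z :: rat)"
  proof
    have "of_int b * r = (of_int a :: rat)" using r(2) by (simp add: r(1) Fract_of_int_quotient)
    then show "of_int (D * b) * r = (of_int (D * a) :: rat)" by (simp add: mult.assoc)
  qed
  moreover have "\<exists>z. of_int (D * b) * s = (of_int z :: rat)" if s: "s \<in> A" for s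
  proof -
    obtain z where "of_int D * s = (of_int z :: rat)" using D(2) s by blast
    then have "of_int (D * b) * s = (of_int (z * b) :: rat)"
      by (metis mult.assoc mult.commute of_int_mult)
    then show ?thesis by blast
  qed
  ultimately have "\<forall>s\<in>insert r A. \<exists>z. of_int (D * b) * s = (of_int z :: rat)" by blast
  moreover have "D * b > 0" using D(1) r(2) by simp
  ultimately show ?case by blast
qed

lemma card_image_fibres:
  assumes "finite Q" "\<And>q. q \<in> Q \<Longrightarrow> n \<le> card {p \<in> Q. f p = f q}"
  shows "card (f ` Q) * n \<le> card Q"
proof -
  have "(\<Sum>q\<in>Q. 1) = (\<Sum>y\<in>f ` Q. \<Sum>q\<in>{p \<in> Q. f p = y}. 1 :: nat)"
    using assms(1) by (rule sum.image_gen)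
  then have "card Q = (\<Sum>y\<in>f ` Q. card {p \<in> Q. f p = y})"
    by (simp only: card_eq_sum)
  moreover have "(\<Sum>y\<in>f ` Q. n) \<le> (\<Sum>y\<in>f ` Q. card {p \<in> Q. f p = y})"
    using assms(2) by (intro sum_mono) auto
  ultimately show ?thesis by simp
qed

section \<open>Flows on finite quotients\<close>

text \<open>Root and exponent of a relator are kept apart because the cost of the relator is
  governed by the order of its root in the quotient.\<close>

definition satisfies :: "('a list \<times> 'a list) set \<Rightarrow> ('a list \<times> nat) set \<Rightarrow> bool" where
  "satisfies \<theta> R \<longleftrightarrow> (\<forall>(w, m)\<in>R. (wpow w m, []) \<in> \<theta>)"

text \<open>Words are related when no finite group satisfying the relators distinguishes them. This
  need not be a torsion congruence, so its congruence properties are derived separately later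
  on.\<close>

definition residual_closure :: "('a list \<times> nat) set \<Rightarrow> ('a list \<times> 'a list) set" where
  "residual_closure R = \<Inter>{\<theta>. finite_congruence \<theta> \<and> satisfies \<theta> R}"

context finite_congruence
begin

text \<open>This is the 1-chain of a path: the number of times that each edge, given by its initial
  vertex and its label, is traversed.\<close>

definition edge_count :: "'a list \<Rightarrow> 'a list \<Rightarrow> 'a list \<times> 'a \<Rightarrow> rat" where
  "edge_count q s e = word_sum (\<lambda>p x. of_bool (e = (rep p, x))) q s"

text \<open>This turns a prescribed path sum into a linear equation for the edge weights.\<close>

lemma edge_count_pairing:
  fixes g :: "'a list \<times> 'a \<Rightarrow> rat"
  assumes "finite (UNIV :: 'a set)"
  shows "(\<Sum>e\<in>range rep \<times> UNIV. g e * edge_count q s e) = word_sum (\<lambda>p x. g (rep p, x)) q s"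
proof (induction s arbitrary: q)
  case Nil
  then show ?case by (simp add: edge_count_def)
next
  case (Cons x s)
  have "(\<Sum>e\<in>range rep \<times> UNIV. g e * edge_count q (x # s) e)
      = (\<Sum>e\<in>range rep \<times> UNIV. (if e = (rep q, x) then g e else 0) + g e * edge_count (q @ [x]) s e)"
    by (intro sum.cong) (auto simp: edge_count_def algebra_simps)
  also have "\<dots> = g (rep q, x) + word_sum (\<lambda>p x. g (rep p, x)) (q @ [x]) s"
    using finite_index assms by (simp add: sum.distrib Cons.IH)
  finally show ?case by simp
qed

text \<open>The exponent is the order of \<open>w\<close> in the quotient rather than that of the
  relator. The order divides the latter, so zero sums along these loops give zero sums along the
  relator, and the number of equations depends on the order alone.\<close>

definition loops :: "'a list \<Rightarrow> ('a list \<times> 'a \<Rightarrow> rat) set" where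
  "loops w = (\<lambda>q. edge_count q (wpow w (ord w))) ` range rep"

lemma finite_loops: "finite (loops w)"
  by (simp add: loops_def finite_index)

text \<open>The loop at \<open>q\<close> that reads a power of \<open>w\<close> passes through the vertices \<open>q w\<^sup>i\<close>, and started at
  any of these it has the same edges.\<close>

lemma card_loops: "card (loops w) * ord w \<le> card (range rep)"
  unfolding loops_def
proof (rule card_image_fibres)
  fix q assume "q \<in> range rep"
  let ?l = "\<lambda>q. edge_count q (wpow w (ord w))"
  have inv: "invariant (\<lambda>p x. of_bool (e = (rep p, x)) :: rat)" for e
    by (simp add: invariant_def flip: rep_eq_iff)
  have step: "?l (p @ w) = ?l p" for p
    by (rule ext) (simp only: edge_count_def word_sum_rotate[OF inv wpow_ord])
  have l_rep: "?l (rep p) = ?l p" for p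
    by (rule ext) (unfold edge_count_def, rule word_sum_base[OF inv], simp add: sym rep)
  have "?l (q @ wpow w i) = ?l q" for i
  proof (induction i)
    case (Suc i)
    then show ?case using step[of "q @ wpow w i"] by (simp add: wpow_commute)
  qed simp
  then have "(\<lambda>i. rep (q @ wpow w i)) ` {..<ord w} \<subseteq> {p \<in> range rep. ?l p = ?l q}"
    using l_rep by auto
  moreover have "inj_on (\<lambda>i. rep (q @ wpow w i)) {..<ord w}"
    by (auto simp: inj_on_def rep_eq_iff cancel_left intro: wpow_inj_below_ord)
  ultimately show "ord w \<le> card {p \<in> range rep. ?l p = ?l q}"
    using card_inj_on_le[of _ "{..<ord w}"] finite_index by fastforce
qed (rule finite_index)

definition divergence :: "'a list \<Rightarrow> 'a list \<times> 'a \<Rightarrow> rat" where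
  "divergence q e = of_bool (fst e = q) - of_bool (rep (fst e @ [snd e]) = q)"

text \<open>By right cancellation, the only edge with label \<open>x\<close> that ends at
  \<open>q\<close> starts at \<open>q @ v x\<close>.\<close>

lemma divergence_pairing:
  fixes g :: "'a list \<times> 'a \<Rightarrow> rat"
  assumes fin: "finite (UNIV :: 'a set)" and v: "\<And>x. (v x @ [x], []) \<in> \<theta>"
  shows "(\<Sum>e\<in>range rep \<times> UNIV. g e * divergence (rep q) e)
    = (\<Sum>x\<in>UNIV. g (rep q, x)) - (\<Sum>x\<in>UNIV. g (rep (q @ v x), x))"
proof -
  have "rep (rep p @ [x]) = rep q \<longleftrightarrow> rep p = rep (q @ v x)" for p x
  proof -
    have q: "(q @ v x @ [x], q @ []) \<in> \<theta>" using v by (rule append_left)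
    have p: "(p @ [x], rep p @ [x]) \<in> \<theta>" using rep by (rule append_right)
    have "(rep p @ [x], q) \<in> \<theta> \<longleftrightarrow> (p @ [x], (q @ v x) @ [x]) \<in> \<theta>"
      using q p by (simp add: flip: rep_eq_iff) 
    then show ?thesis using cancel_right[of p "[x]" "q @ v x"] by (simp add: rep_eq_iff)
  qed
  then have *: "rep (p @ [x]) = rep q \<longleftrightarrow> p = rep (q @ v x)" if "p \<in> range rep" for p x
    using that by auto
  have "(\<Sum>e\<in>range rep \<times> UNIV. g e * divergence (rep q) e)
      = (\<Sum>p\<in>range rep. \<Sum>x\<in>UNIV. g (p, x) * divergence (rep q) (p, x))"
    by (simp add: sum.cartesian_product)
  also have "\<dots> = (\<Sum>p\<in>range rep. \<Sum>x\<in>UNIV. (if p = rep q then g (p, x) else 0)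
      - (if p = rep (q @ v x) then g (p, x) else 0))"
    using * by (intro sum.cong) (auto simp: divergence_def)
  also have "\<dots> = (\<Sum>x\<in>UNIV. \<Sum>p\<in>range rep. (if p = rep q then g (p, x) else 0)
      - (if p = rep (q @ v x) then g (p, x) else 0))"
    by (rule sum.swap)
  also have "\<dots> = (\<Sum>x\<in>UNIV. g (rep q, x) - g (rep (q @ v x), x))"
    using finite_index by (simp add: sum_subtractf)
  finally show ?thesis by (simp add: sum_subtractf)
qed

text \<open>If the sums of \<open>u\<close> along \<open>s\<close> and \<open>t\<close> were different, then they would be different modulo some
  \<open>k\<close> after clearing denominators, which gives a finite quotient separating \<open>s\<close> and \<open>t\<close>.\<close>

lemma word_sum_residual_closure:
  fixes g :: "'a list \<times> 'a \<Rightarrow> rat"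
  assumes fin: "finite (UNIV :: 'a set)" and R: "satisfies \<theta> R"
    and loops: "\<And>w m c. (w, m) \<in> R \<Longrightarrow> c \<in> loops w \<Longrightarrow> (\<Sum>e\<in>range rep \<times> UNIV. g e * c e) = 0"
    and st: "(s, t) \<in> residual_closure R"
  shows "word_sum (\<lambda>p x. g (rep p, x)) q s = word_sum (\<lambda>p x. g (rep p, x)) q t"
proof -
  let ?u = "\<lambda>p x. g (rep p, x)"
  have "finite (g ` (range rep \<times> UNIV))" using finite_index fin by simp
  then obtain D where D: "D > 0" "\<forall>r\<in>g ` (range rep \<times> UNIV). \<exists>z. of_int D * r = (of_int z :: rat)"
    using common_denominator by blast
  have "\<exists>z. of_int D * ?u p x = (of_int z :: rat)" for p x
    by (rule bspec[OF D(2)]) auto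
  then obtain V where V: "\<And>p x. of_int D * ?u p x = (of_int (V p x) :: rat)" by metis
  have invV: "invariant V"
    unfolding invariant_def
  proof (intro allI impI ext)
    fix s t x assume "(s, t) \<in> \<theta>"
    then have "?u s x = ?u t x" by (simp flip: rep_eq_iff)
    then show "V s x = V t x" using V[of s x] V[of t x] by simp
  qed
  have sumV: "of_int (word_sum V q s) = of_int D * word_sum ?u q s" for q s
    by (simp add: V flip: word_sum_of_int path_sum_mult)
  \<comment> \<open>Relators have sum exactly zero, hence zero modulo every \<open>k\<close>; so all
    the extensions used below satisfy \<open>R\<close> again.\<close>
  have relator: "word_sum V q (wpow w m) = 0" if wm: "(w, m) \<in> R" for q w m
  proof -
    have "edge_count (rep q) (wpow w (ord w)) \<in> loops w" by (auto simp: loops_def)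
    from loops[OF wm this] have "word_sum ?u (rep q) (wpow w (ord w)) = 0"
      by (simp add: edge_count_pairing[OF fin])
    then have "word_sum V (rep q) (wpow w (ord w)) = 0"
      using sumV[of "rep q" "wpow w (ord w)"] by simp
    then have 0: "word_sum V q (wpow w (ord w)) = 0"
      using word_sum_base[OF invV rep] by metis
    have "(wpow w m, []) \<in> \<theta>" using R wm by (auto simp: satisfies_def)
    then obtain j where "m = ord w * j" using ord_dvd by blast
    then show ?thesis using 0 word_sum_wpow[OF invV wpow_ord] by (simp add: wpow_mult)
  qed
  have "word_sum V q s mod k = word_sum V q t mod k" if k: "k > 0" for k
  proof -
    let ?\<eta> = "{(s, t). (s, t) \<in> \<theta> \<and> (\<forall>q. word_sum V q s mod k = word_sum V q t mod k)}"
    have "finite_congruence ?\<eta>" using finite_congruence_word_sum_mod[OF invV k] .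
    moreover have "satisfies ?\<eta> R" using R relator by (auto simp: satisfies_def)
    ultimately have "(s, t) \<in> ?\<eta>" using st by (auto simp: residual_closure_def)
    then show ?thesis by blast
  qed
  \<comment> \<open>A modulus exceeding the absolute value of the difference can only divide it if
    the difference is zero.\<close>
  from this[of "\<bar>word_sum V q s - word_sum V q t\<bar> + 1"]
  have "\<bar>word_sum V q s - word_sum V q t\<bar> + 1 dvd word_sum V q s - word_sum V q t"
    by (simp add: mod_eq_dvd_iff)
  then have "word_sum V q s = word_sum V q t"
    using dvd_imp_le_int[of "word_sum V q s - word_sum V q t"] by fastforce
  then show ?thesis using sumV[of q s] sumV[of q t] D(1) by simp
qed

end

text \<open>Edge weights on the Cayley graph of the quotient by \<open>\<theta>\<close>; in the last condition the words \<open>v x\<close>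
  represent the inverses of the letters.\<close>

definition unit_flow ::
    "('a list \<times> 'a list) set \<Rightarrow> ('a list \<times> 'a list) set \<Rightarrow> ('a list \<Rightarrow> 'a \<Rightarrow> real) \<Rightarrow> bool" where
  "unit_flow \<theta> \<eta> u \<longleftrightarrow>
    (\<forall>s t. (s, t) \<in> \<theta> \<longrightarrow> u s = u t) \<and>
    (\<forall>S. finite S \<longrightarrow> (\<forall>s\<in>S. \<forall>t\<in>S. (s, t) \<in> \<theta> \<longrightarrow> s = t) \<longrightarrow> (\<Sum>s\<in>S. \<Sum>x\<in>UNIV. (u s x)\<^sup>2) \<le> 1) \<and>
    (\<forall>s t q. (s, t) \<in> \<eta> \<longrightarrow> word_sum u q s = word_sum u q t) \<and>
    (\<forall>v q. (\<forall>x. (v x @ [x], []) \<in> \<theta>) \<longrightarrow> (\<Sum>x\<in>UNIV. u (q @ v x) x) = (\<Sum>x\<in>UNIV. u q x))"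

lemma unit_flowD:
  assumes "unit_flow \<theta> \<eta> u"
  shows "(s, t) \<in> \<theta> \<Longrightarrow> u s = u t"
    and "finite S \<Longrightarrow> (\<And>s t. s \<in> S \<Longrightarrow> t \<in> S \<Longrightarrow> (s, t) \<in> \<theta> \<Longrightarrow> s = t) \<Longrightarrow>
      (\<Sum>s\<in>S. \<Sum>x\<in>UNIV. (u s x)\<^sup>2) \<le> 1"
    and "(s, t) \<in> \<eta> \<Longrightarrow> word_sum u q s = word_sum u q t"
    and "(\<And>x. (v x @ [x], []) \<in> \<theta>) \<Longrightarrow> (\<Sum>x\<in>UNIV. u (q @ v x) x) = (\<Sum>x\<in>UNIV. u q x)"
  using assms by (auto simp: unit_flow_def)

text \<open>The flow is invariant under \<theta>, whereas path independence is asserted for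
  \<open>residual_closure R\<close>, which is contained in \<theta>. Loops that close only in this
  particular quotient may have nonzero sums.\<close>

lemma finite_quotient_flow:
  fixes \<theta> :: "(bool list \<times> bool list) set"
  assumes "finite_congruence \<theta>" and finR: "finite R" and R: "satisfies \<theta> R"
    and small: "(\<Sum>(w, m)\<in>R. 1 / real (torsion_congruence.ord \<theta> w)) \<le> 1 / 2"
  shows "\<exists>u. unit_flow \<theta> (residual_closure R) u \<and> (\<exists>x. u [] x \<ge> 1 / 4)"
proof -
  interpret finite_congruence \<theta> by fact
  let ?Q = "range rep" and ?E = "range rep \<times> (UNIV :: bool set)"
  let ?n = "real (card ?Q)"
  have finE: "finite ?E" and cardE: "card ?E = 2 * card ?Q"
    using finite_index by (simp_all add: card_cartesian_product)
  have n: "?n > 0" using finite_index by (simp add: card_gt_0_iff)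
  define C where "C = divergence ` ?Q \<union> (\<Union>(w, m)\<in>R. loops w)"
  have finC: "finite C" using finite_index finR finite_loops by (auto simp: C_def)
  have "card C \<le> card (divergence ` ?Q) + card (\<Union>(w, m)\<in>R. loops w)"
    unfolding C_def by (rule card_Un_le)
  also have "\<dots> \<le> card ?Q + (\<Sum>(w, m)\<in>R. card (loops w))"
    using card_image_le[OF finite_index] card_UN_le[OF finR, of "\<lambda>(w, m). loops w"]
    by (intro add_mono) (auto simp: case_prod_unfold)
  finally have "real (card C) \<le> ?n + (\<Sum>(w, m)\<in>R. real (card (loops w)))"
    by (simp add: case_prod_unfold flip: of_nat_sum of_nat_add)
  also have "(\<Sum>(w, m)\<in>R. real (card (loops w))) \<le> (\<Sum>(w, m)\<in>R. ?n * (1 / real (ord w)))"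
  proof (rule sum_mono, clarify)
    fix w m
    have "real (card (loops w)) * real (ord w) \<le> ?n"
      using card_loops[of w] by (simp flip: of_nat_mult)
    then show "real (card (loops w)) \<le> ?n * (1 / real (ord w))"
      using ord_pos[of w] by (simp add: field_simps)
  qed
  also have "\<dots> = ?n * (\<Sum>(w, m)\<in>R. 1 / real (ord w))"
    by (simp add: sum_distrib_left case_prod_unfold)
  also have "\<dots> \<le> ?n * (1 / 2)" using small n by (intro mult_left_mono) auto
  finally have cardC: "real (card C) \<le> 3 / 2 * ?n" by simp
  have "?E \<noteq> {}" by auto
  from large_diagonal_solution[OF finE this finC]
  obtain e g where e: "e \<in> ?E" and gC: "\<And>c. c \<in> C \<Longrightarrow> (\<Sum>f\<in>?E. g f * c f) = 0"
    and g2: "(\<Sum>f\<in>?E. (g f)\<^sup>2) = g e"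
    and ge: "g e * of_nat (card ?E) \<ge> of_nat (card ?E) - of_nat (card C)"
    by blast
  obtain q0 x0 where e_def: "e = (rep q0, x0)" using e by auto
  \<comment> \<open>With \<open>2 * ?n\<close> edges and at most \<open>3 / 2 * ?n\<close>
    equations, the inequality reads \<open>?n / 2 \<le> 2 * ?n * g e\<close>.\<close>
  have "real_of_rat (of_nat (card ?E) - of_nat (card C)) \<le> real_of_rat (g e * of_nat (card ?E))"
    using ge by (simp only: of_rat_less_eq)
  then have "2 * ?n - card C \<le> real_of_rat (g e) * (2 * ?n)"
    by (simp add: of_rat_diff of_rat_mult cardE)
  moreover have "real_of_rat (g e) * (2 * ?n) = 2 * (?n * real_of_rat (g e))" by simp
  ultimately have "?n * (1 / 4) \<le> ?n * real_of_rat (g e)" using cardC by linarith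
  then have ge4: "real_of_rat (g e) \<ge> 1 / 4" using n mult_le_cancel_left_pos by blast
  \<comment> \<open>The squared norm of \<open>g\<close> equals \<open>g e\<close> and dominates the
    square of this entry. So the entry, and with it the squared norm, is at most one.\<close>
  have "(g e)\<^sup>2 \<le> g e"
    using member_le_sum[OF e, of "\<lambda>f. (g f)\<^sup>2"] finE g2 by simp
  moreover have "g e > 0" using ge4 by (metis less_le_trans of_rat_less_0_iff zero_less_of_rat_iff zero_less_divide_1_iff zero_less_numeral)
  ultimately have ge1: "g e \<le> 1"
    by (simp add: power2_eq_square mult_le_cancel_right1 not_less)
  \<comment> \<open>Translating by \<open>q0\<close> moves the edge with the large entry to the
    empty word.\<close>
  define u where "u s x = real_of_rat (g (rep (q0 @ s), x))" for s x
  have rep_shift: "rep (q0 @ s) = rep (q0 @ t) \<longleftrightarrow> (s, t) \<in> \<theta>" for s t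
    by (simp add: rep_eq_iff cancel_left)
  have sum_u: "word_sum u q s = real_of_rat (word_sum (\<lambda>p x. g (rep p, x)) (q0 @ q) s)" for q s
    unfolding u_def word_sum_of_rat
    using word_sum_shift[of "\<lambda>p x. g (rep p, x)" q0 q s] by simp
  have "\<forall>s t. (s, t) \<in> \<theta> \<longrightarrow> u s = u t"
    by (auto simp: u_def fun_eq_iff simp flip: rep_shift)
  moreover have "u [] x0 \<ge> 1 / 4" using ge4 by (simp add: u_def e_def)
  moreover have "(\<Sum>s\<in>S. \<Sum>x\<in>UNIV. (u s x)\<^sup>2) \<le> 1"
    if S: "finite S" "\<forall>s\<in>S. \<forall>t\<in>S. (s, t) \<in> \<theta> \<longrightarrow> s = t" for S
  proof -
    let ?h = "\<lambda>s. rep (q0 @ s)"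
    have inj: "inj_on ?h S" using S(2) by (auto simp: inj_on_def rep_shift)
    have "(\<Sum>s\<in>S. \<Sum>x\<in>UNIV. (g (?h s, x))\<^sup>2) = (\<Sum>f\<in>?h ` S \<times> UNIV. (g f)\<^sup>2)"
      by (simp add: sum.cartesian_product' sum.reindex[OF inj])
    also have "\<dots> \<le> (\<Sum>f\<in>?E. (g f)\<^sup>2)"
      using finE by (intro sum_mono2) auto
    also have "\<dots> \<le> 1" using g2 ge1 by simp
    finally have "real_of_rat (\<Sum>s\<in>S. \<Sum>x\<in>UNIV. (g (?h s, x))\<^sup>2) \<le> real_of_rat 1"
      by (simp only: of_rat_less_eq)
    then show ?thesis by (simp add: u_def of_rat_sum of_rat_power UNIV_bool of_rat_add)
  qed
  moreover have "word_sum u q s = word_sum u q t" if st: "(s, t) \<in> residual_closure R" for s t q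
  proof -
    have "word_sum (\<lambda>p x. g (rep p, x)) (q0 @ q) s = word_sum (\<lambda>p x. g (rep p, x)) (q0 @ q) t"
      by (rule word_sum_residual_closure[OF _ R _ st]) (use gC in \<open>force simp: C_def\<close>)+
    then show ?thesis by (simp add: sum_u)
  qed
  moreover have "(\<Sum>x\<in>UNIV. u (q @ v x) x) = (\<Sum>x\<in>UNIV. u q x)"
    if v: "\<forall>x. (v x @ [x], []) \<in> \<theta>" for v q
  proof -
    have "(\<Sum>e\<in>?E. g e * divergence (rep (q0 @ q)) e) = 0"
      by (rule gC) (auto simp: C_def)
    then have "(\<Sum>x\<in>UNIV. g (rep (q0 @ q @ v x), x)) = (\<Sum>x\<in>UNIV. g (rep (q0 @ q), x))"
      using divergence_pairing[of v g "q0 @ q"] v by simp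
    then show ?thesis by (simp add: u_def flip: of_rat_sum)
  qed
  ultimately show ?thesis
    unfolding unit_flow_def by (intro exI[of _ u] conjI exI[of _ x0] allI impI) auto
qed

section \<open>A torsion quotient carrying a square summable flow\<close>

text \<open>The strict inequality leaves a positive margin for the next relator.\<close>

definition admissible :: "('a list \<times> nat) set \<Rightarrow> bool" where
  "admissible R \<longleftrightarrow> finite R \<and> (\<exists>\<theta>. finite_congruence \<theta> \<and> satisfies \<theta> R \<and>
     (\<Sum>(w, m)\<in>R. 1 / real (torsion_congruence.ord \<theta> w)) < 1 / 2)"

section \<open>Elementary properties of the residual closure\<close>

lemma satisfies_INT: "satisfies (\<Inter>i\<in>I. \<theta> i) R \<longleftrightarrow> (\<forall>i\<in>I. satisfies (\<theta> i) R)"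
  by (auto simp: satisfies_def)

lemma satisfies_Int: "satisfies (\<theta> \<inter> \<eta>) R \<longleftrightarrow> satisfies \<theta> R \<and> satisfies \<eta> R"
  by (auto simp: satisfies_def)

lemma residual_closure_mono: "R \<subseteq> R' \<Longrightarrow> residual_closure R \<subseteq> residual_closure R'"
  unfolding residual_closure_def satisfies_def by (rule Inter_anti_mono) blast

lemma residual_closureI:
  "(\<And>\<theta>. finite_congruence \<theta> \<Longrightarrow> satisfies \<theta> R \<Longrightarrow> p \<in> \<theta>) \<Longrightarrow> p \<in> residual_closure R"
  by (auto simp: residual_closure_def)

lemma residual_closureD:
  "p \<in> residual_closure R \<Longrightarrow> finite_congruence \<theta> \<Longrightarrow> satisfies \<theta> R \<Longrightarrow> p \<in> \<theta>"
  by (auto simp: residual_closure_def)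

lemma residual_closure_refl: "(s, s) \<in> residual_closure R"
  by (meson residual_closureI torsion_congruence.refl finite_congruence.axioms(1))

lemma residual_closure_sym: "(s, t) \<in> residual_closure R \<Longrightarrow> (t, s) \<in> residual_closure R"
  by (meson residual_closureI residual_closureD torsion_congruence.sym finite_congruence.axioms(1))

lemma residual_closure_trans:
  "(s, t) \<in> residual_closure R \<Longrightarrow> (t, v) \<in> residual_closure R \<Longrightarrow> (s, v) \<in> residual_closure R"
  by (meson residual_closureI residual_closureD torsion_congruence.trans finite_congruence.axioms(1))

lemma residual_closure_append_left:
  "(s, t) \<in> residual_closure R \<Longrightarrow> (v @ s, v @ t) \<in> residual_closure R"
  by (meson residual_closureI residual_closureD torsion_congruence.append_left finite_congruence.axioms(1))

lemma residual_closure_append_right: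
  "(s, t) \<in> residual_closure R \<Longrightarrow> (s @ v, t @ v) \<in> residual_closure R"
  by (meson residual_closureI residual_closureD torsion_congruence.append_right finite_congruence.axioms(1))

lemma residual_closure_subset: "finite_congruence \<theta> \<Longrightarrow> satisfies \<theta> R \<Longrightarrow> residual_closure R \<subseteq> \<theta>"
  by (auto simp: residual_closure_def)

lemma residual_closure_relator: "(w, m) \<in> R \<Longrightarrow> (wpow w m, []) \<in> residual_closure R"
  by (auto simp: residual_closure_def satisfies_def)

text \<open>Orders can only grow in a finer quotient; so the estimate on the relators survives every
  refinement.\<close>

lemma sum_inverse_ord_antimono:
  assumes "torsion_congruence \<theta>" "torsion_congruence \<eta>" "\<eta> \<subseteq> \<theta>"
  shows "(\<Sum>(w, m)\<in>R. 1 / real (torsion_congruence.ord \<eta> w))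
    \<le> (\<Sum>(w, m)\<in>R. 1 / real (torsion_congruence.ord \<theta> w))"
proof (rule sum_mono, clarify)
  fix w
  show "1 / real (torsion_congruence.ord \<eta> w) \<le> 1 / real (torsion_congruence.ord \<theta> w)"
    using ord_mono[OF assms(2,1,3), of w] torsion_congruence.ord_pos[OF assms(1), of w]
    by (intro divide_left_mono) auto
qed

text \<open>Each pair in \<open>P\<close> is separated by some finite quotient satisfying
  \<open>R\<close>. Intersecting these finitely many congruences with \<theta> separates all of them
  at once and does not lower any order.\<close>

lemma separating_congruence:
  assumes \<theta>: "finite_congruence \<theta>" "satisfies \<theta> R" and P: "finite P" "P \<inter> residual_closure R = {}"
  obtains \<eta> where "finite_congruence \<eta>" "satisfies \<eta> R" "\<eta> \<subseteq> \<theta>" "P \<inter> \<eta> = {}"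
proof -
  have "\<exists>\<zeta>. finite_congruence \<zeta> \<and> satisfies \<zeta> R \<and> p \<notin> \<zeta>" if p: "p \<in> P" for p
    using P(2) p by (auto simp: residual_closure_def)
  then obtain \<zeta> where \<zeta>: "\<And>p. p \<in> P \<Longrightarrow> finite_congruence (\<zeta> p) \<and> satisfies (\<zeta> p) R \<and> p \<notin> \<zeta> p"
    by metis
  let ?\<eta> = "\<theta> \<inter> (\<Inter>p\<in>P. \<zeta> p)"
  show thesis
  proof (rule that)
    show "finite_congruence ?\<eta>"
      using \<theta> \<zeta> P(1) by (intro finite_congruence_Int finite_congruence_INT) auto
    show "satisfies ?\<eta> R" using \<theta> \<zeta> by (auto simp: satisfies_Int satisfies_INT)
  qed (use \<zeta> in auto)
qed

text \<open>The exponent of the added relator is the order of \<open>w\<close> in the separating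
  quotient \<eta>. Therefore \<eta> itself satisfies the enlarged set and witnesses that it is
  admissible.\<close>

lemma admissible_extension:
  assumes "admissible R"
  shows "\<exists>R'. R \<subseteq> R' \<and> admissible R' \<and> (\<exists>k>0. (wpow w k, []) \<in> residual_closure R')"
proof (cases "\<exists>k>0. (wpow w k, []) \<in> residual_closure R")
  case True
  then show ?thesis using assms by blast
next
  case False
  obtain \<theta> where R: "finite R" and \<theta>: "finite_congruence \<theta>" "satisfies \<theta> R"
    and small: "(\<Sum>(w, m)\<in>R. 1 / real (torsion_congruence.ord \<theta> w)) < 1 / 2"
    using assms by (auto simp: admissible_def)
  define \<epsilon> where "\<epsilon> = 1 / 2 - (\<Sum>(w, m)\<in>R. 1 / real (torsion_congruence.ord \<theta> w))"
  \<comment> \<open>An order of \<open>w\<close> above \<open>Suc L\<close> keeps the new summand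
    below the margin. Such an order is forced by separating the powers with exponents
    \<open>1\<close> to \<open>Suc L\<close> from the empty word.\<close>
  obtain L where L: "1 / real (Suc L) < \<epsilon>"
    using small nat_approx_posE[of \<epsilon>] by (auto simp: \<epsilon>_def)
  have "(wpow w k, []) \<notin> residual_closure R" if "k \<in> {1..Suc L}" for k
    using False that by (metis atLeastAtMost_iff less_eq_Suc_le One_nat_def)
  then have "(\<lambda>k. (wpow w k, [])) ` {1..Suc L} \<inter> residual_closure R = {}" by blast
  from separating_congruence[OF \<theta> _ this]
  obtain \<eta> where \<eta>: "finite_congruence \<eta>" "satisfies \<eta> R" "\<eta> \<subseteq> \<theta>"
    and sep: "(\<lambda>k. (wpow w k, [])) ` {1..Suc L} \<inter> \<eta> = {}" by auto
  interpret T: finite_congruence \<theta> by fact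
  interpret H: finite_congruence \<eta> by fact
  let ?m = "H.ord w"
  have "?m \<notin> {1..Suc L}" using sep H.wpow_ord by blast
  then have m: "?m > Suc L" using H.ord_pos[of w] by auto
  \<comment> \<open>If the relator were already present, a power of \<open>w\<close> would lie in
    the residual closure, against the case assumption. So the sum gains exactly one term.\<close>
  have new: "(w, ?m) \<notin> R" using False H.ord_pos residual_closure_relator by blast
  have "(\<Sum>(v, m)\<in>insert (w, ?m) R. 1 / real (H.ord v)) = 1 / real ?m + (\<Sum>(v, m)\<in>R. 1 / real (H.ord v))"
    using R new by simp
  moreover have "1 / real ?m \<le> 1 / real (Suc L)" using m by (intro divide_left_mono) auto
  moreover have "(\<Sum>(v, m)\<in>R. 1 / real (H.ord v)) \<le> (\<Sum>(v, m)\<in>R. 1 / real (T.ord v))"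
    using sum_inverse_ord_antimono T.torsion_congruence_axioms H.torsion_congruence_axioms \<eta>(3) by blast
  ultimately have "(\<Sum>(v, m)\<in>insert (w, ?m) R. 1 / real (H.ord v)) < 1 / 2"
    using L by (simp add: \<epsilon>_def)
  moreover have "satisfies \<eta> (insert (w, ?m) R)"
    using \<eta>(2) H.wpow_ord by (auto simp: satisfies_def)
  ultimately have "admissible (insert (w, ?m) R)"
    using R \<eta>(1) by (auto simp: admissible_def)
  moreover have "(wpow w ?m, []) \<in> residual_closure (insert (w, ?m) R)"
    by (rule residual_closure_relator) simp
  ultimately show ?thesis using H.ord_pos by blast
qed

lemma LIMSEQ_eventually_eq:
  fixes X Y :: "nat \<Rightarrow> 'a::t2_space"
  assumes "X \<longlonglongrightarrow> a" "Y \<longlonglongrightarrow> b" "\<forall>\<^sub>F n in sequentially. X n = Y n"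
  shows "a = b"
  by (rule LIMSEQ_unique[OF Lim_transform_eventually[OF assms(1,3)] assms(2)])

text \<open>Relators are chosen along an enumeration of all words, which makes every word torsion in
  the union \<open>N\<close>. The finite flows have entries bounded by one, so a diagonal
  subsequence converges at every edge; each clause of \<open>unit_flow\<close> concerns finitely
  many edges and passes to the limit.\<close>

lemma torsion_quotient_flow:
  obtains N :: "(bool list \<times> bool list) set" and u :: "bool list \<Rightarrow> bool \<Rightarrow> real"
  where "torsion_congruence N" "unit_flow N N u" "\<exists>x. u [] x \<noteq> 0"
proof -
  have "\<exists>R :: nat \<Rightarrow> (bool list \<times> nat) set. \<forall>n. admissible (R n) \<and> R n \<subseteq> R (Suc n) \<and>
      (\<exists>k>0. (wpow (from_nat n) k, []) \<in> residual_closure (R (Suc n)))"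
  proof (rule dependent_nat_choice[where P = "\<lambda>_. admissible" and Q = "\<lambda>n R R'. R \<subseteq> R' \<and>
      (\<exists>k>0. (wpow (from_nat n) k, []) \<in> residual_closure R')"])
    show "\<exists>R :: (bool list \<times> nat) set. admissible R"
      by (rule exI[of _ "{}"]) (auto simp: admissible_def satisfies_def intro: finite_congruence_UNIV)
  qed (use admissible_extension in blast)
  then obtain R :: "nat \<Rightarrow> (bool list \<times> nat) set" where adm: "\<And>n. admissible (R n)"
    and R_Suc: "\<And>n. R n \<subseteq> R (Suc n)"
    and R_torsion: "\<And>n. \<exists>k>0. (wpow (from_nat n) k, []) \<in> residual_closure (R (Suc n))"
    by blast
  have R_mono: "residual_closure (R m) \<subseteq> residual_closure (R n)" if "m \<le> n" for m n
    using residual_closure_mono lift_Suc_mono_le[of R, OF R_Suc that] by blast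
  define N where "N = (\<Union>n. residual_closure (R n))"
  have N_ev: "\<forall>\<^sub>F n in sequentially. (s, t) \<in> residual_closure (R n)" if "(s, t) \<in> N" for s t
    using that R_mono by (force simp: N_def eventually_sequentially)
  have N_fin: "\<exists>n. (s, t) \<in> residual_closure (R n) \<and> (s', t') \<in> residual_closure (R n)"
    if "(s, t) \<in> N" "(s', t') \<in> N" for s t s' t'
    using eventually_happens[OF eventually_conj[OF N_ev[OF that(1)] N_ev[OF that(2)]]] by simp
  have N: "torsion_congruence N"
  proof
    show "equiv UNIV N"
    proof (intro equivI refl_onI symI transI)
      show "(s, v) \<in> N" if "(s, t) \<in> N" "(t, v) \<in> N" for s t v
        using N_fin[OF that] residual_closure_trans by (fastforce simp: N_def)
    qed (use residual_closure_refl residual_closure_sym in \<open>fastforce simp: N_def\<close>)+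
    show "(v @ s, v @ t) \<in> N" "(s @ v, t @ v) \<in> N" if "(s, t) \<in> N" for s t v
      using that residual_closure_append_left residual_closure_append_right
      by (fastforce simp: N_def)+
    show "\<exists>k>0. (wpow w k, []) \<in> N" for w
      using R_torsion[of "to_nat w"] by (auto simp: N_def)
  qed
  \<comment> \<open>These congruences converge to \<open>N\<close>: each contains the closure of
    \<open>R n\<close>, hence eventually any given pair of \<open>N\<close>, and the last clause
    eventually excludes any given pair outside \<open>N\<close>.\<close>
  have "\<exists>\<theta>. finite_congruence \<theta> \<and> satisfies \<theta> (R n) \<and>
      (\<Sum>(w, m)\<in>R n. 1 / real (torsion_congruence.ord \<theta> w)) \<le> 1 / 2 \<and>
      (\<forall>s t. to_nat s < n \<longrightarrow> to_nat t < n \<longrightarrow> (s, t) \<notin> N \<longrightarrow> (s, t) \<notin> \<theta>)" for n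
  proof -
    obtain \<theta> where \<theta>: "finite_congruence \<theta>" "satisfies \<theta> (R n)"
      and small: "(\<Sum>(w, m)\<in>R n. 1 / real (torsion_congruence.ord \<theta> w)) < 1 / 2"
      using adm[of n] by (auto simp: admissible_def)
    define B :: "bool list set" where "B = from_nat ` {..<n}"
    have B: "s \<in> B" if "to_nat s < n" for s
      using that by (metis B_def from_nat_to_nat imageI lessThan_iff)
    \<comment> \<open>Since \<open>N\<close> contains the closure of \<open>R n\<close>, pairs
      outside \<open>N\<close> can be separated by finite quotients satisfying
      \<open>R n\<close>.\<close>
    have "finite (B \<times> B - N)" "(B \<times> B - N) \<inter> residual_closure (R n) = {}"
      by (auto simp: B_def N_def)
    from separating_congruence[OF \<theta> this] obtain \<eta> where \<eta>: "finite_congruence \<eta>"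
      "satisfies \<eta> (R n)" "\<eta> \<subseteq> \<theta>" "(B \<times> B - N) \<inter> \<eta> = {}" by blast
    have "(\<Sum>(w, m)\<in>R n. 1 / real (torsion_congruence.ord \<eta> w)) \<le> 1 / 2"
      using sum_inverse_ord_antimono[of \<theta> \<eta> "R n"] small \<theta>(1) \<eta>(1,3) finite_congruence.axioms(1)
      by (smt (verit))
    then show ?thesis using \<eta> B by blast
  qed
  then obtain \<theta> where \<theta>: "\<And>n. finite_congruence (\<theta> n)" "\<And>n. satisfies (\<theta> n) (R n)"
    "\<And>n. (\<Sum>(w, m)\<in>R n. 1 / real (torsion_congruence.ord (\<theta> n) w)) \<le> 1 / 2"
    and sep: "\<And>n s t. to_nat s < n \<Longrightarrow> to_nat t < n \<Longrightarrow> (s, t) \<notin> N \<Longrightarrow> (s, t) \<notin> \<theta> n"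
    by metis
  have N_\<theta>: "\<forall>\<^sub>F n in sequentially. (s, t) \<in> \<theta> n" if "(s, t) \<in> N" for s t
    using N_ev[OF that] by eventually_elim (use residual_closure_subset \<theta> in blast)
  have "finite (R n)" for n using adm by (simp add: admissible_def)
  then have "\<forall>n. \<exists>u. unit_flow (\<theta> n) (residual_closure (R n)) u \<and> (\<exists>x. u [] x \<ge> 1 / 4)"
    using finite_quotient_flow \<theta> by blast
  then obtain f where f: "\<And>n. unit_flow (\<theta> n) (residual_closure (R n)) (f n)"
    and f_base: "\<And>n. \<exists>x. f n [] x \<ge> 1 / 4"
    by metis
  note f_inv = unit_flowD(1)[OF f] and f_norm = unit_flowD(2)[OF f]
    and f_loop = unit_flowD(3)[OF f] and f_div = unit_flowD(4)[OF f]
  have f_bound: "norm (f n s x) \<le> 1" for n s x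
  proof -
    have "(f n s x)\<^sup>2 \<le> (\<Sum>x\<in>UNIV. (f n s x)\<^sup>2)" by (rule member_le_sum) auto
    also have "\<dots> \<le> 1" using f_norm[of "{s}" n] by simp
    finally show ?thesis by (simp add: abs_square_le_1)
  qed
  obtain k where k: "strict_mono k"
    and conv: "\<And>p. p \<in> UNIV \<Longrightarrow> \<exists>l. (\<lambda>n. f (k n) (fst p) (snd p)) \<longlonglongrightarrow> l"
    by (rule function_convergent_subsequence[of UNIV "\<lambda>n p. f n (fst p) (snd p)" 1])
      (use f_bound in auto)
  have "\<exists>l. (\<lambda>n. f (k n) s x) \<longlonglongrightarrow> l" for s x using conv[of "(s, x)"] by simp
  then obtain u where u: "\<And>s x. (\<lambda>n. f (k n) s x) \<longlonglongrightarrow> u s x" by metis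
  have ev: "\<forall>\<^sub>F n in sequentially. P (k n)" if "\<forall>\<^sub>F n in sequentially. P n" for P
    by (rule eventually_subseq[OF k that])
  show thesis
  proof (rule that[OF N])
    \<comment> \<open>The letter at which \<open>f n\<close> is at least \<open>1/4\<close> may vary
      with \<open>n\<close>; the sum of squares over both letters gives a bound independent of
      it.\<close>
    have "1 / 16 \<le> (\<Sum>x\<in>UNIV. (u [] x)\<^sup>2)"
    proof (rule LIMSEQ_le_const)
      show "(\<lambda>n. \<Sum>x\<in>UNIV. (f (k n) [] x)\<^sup>2) \<longlonglongrightarrow> (\<Sum>x\<in>UNIV. (u [] x)\<^sup>2)"
        by (intro tendsto_sum tendsto_power u)
      have "1 / 16 \<le> (\<Sum>x\<in>UNIV. (f n [] x)\<^sup>2)" for n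
      proof -
        obtain x where "f n [] x \<ge> 1 / 4" using f_base by blast
        then have "(1 / 4)\<^sup>2 \<le> (f n [] x)\<^sup>2" by (intro power_mono) auto
        also have "\<dots> \<le> (\<Sum>x\<in>UNIV. (f n [] x)\<^sup>2)" by (rule member_le_sum) auto
        finally show ?thesis by (simp add: power2_eq_square)
      qed
      then show "\<exists>n0. \<forall>n\<ge>n0. 1 / 16 \<le> (\<Sum>x\<in>UNIV. (f (k n) [] x)\<^sup>2)" by blast
    qed
    then show "\<exists>x. u [] x \<noteq> 0" by (rule contrapos_pp) simp
  next
    show "unit_flow N N u"
      unfolding unit_flow_def
    proof (intro conjI allI impI)
      fix s t assume st: "(s, t) \<in> N"
      show "u s = u t"
      proof
        fix x
        have "\<forall>\<^sub>F n in sequentially. f (k n) s x = f (k n) t x"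
          using ev[OF N_\<theta>[OF st]] by eventually_elim (simp add: f_inv)
        then show "u s x = u t x"
          by (rule LIMSEQ_eventually_eq[OF u u])
      qed
    next
      fix s t q assume st: "(s, t) \<in> N"
      have "\<forall>\<^sub>F n in sequentially. word_sum (f (k n)) q s = word_sum (f (k n)) q t"
        using ev[OF N_ev[OF st]] by eventually_elim (rule f_loop)
      then show "word_sum u q s = word_sum u q t"
        by (rule LIMSEQ_eventually_eq[OF tendsto_path_sum[OF u] tendsto_path_sum[OF u]])
    next
      fix S :: "bool list set"
      assume S: "finite S" "\<forall>s\<in>S. \<forall>t\<in>S. (s, t) \<in> N \<longrightarrow> s = t"
      obtain n0 where n0: "\<And>s. s \<in> S \<Longrightarrow> to_nat s < n0"
        using finite_nat_set_iff_bounded[of "to_nat ` S"] S(1) by auto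
      show "(\<Sum>s\<in>S. \<Sum>x\<in>UNIV. (u s x)\<^sup>2) \<le> 1"
      proof (rule LIMSEQ_le_const2)
        show "(\<lambda>n. \<Sum>s\<in>S. \<Sum>x\<in>UNIV. (f (k n) s x)\<^sup>2) \<longlonglongrightarrow> (\<Sum>s\<in>S. \<Sum>x\<in>UNIV. (u s x)\<^sup>2)"
          by (intro tendsto_sum tendsto_power u)
        \<comment> \<open>Once \<open>n\<close> exceeds the codes of the finitely many words in
          \<open>S\<close>, the finite quotient separates them as \<open>N\<close> does, and the
          norm bound there applies to \<open>S\<close>.\<close>
        show "\<exists>n0. \<forall>n\<ge>n0. (\<Sum>s\<in>S. \<Sum>x\<in>UNIV. (f (k n) s x)\<^sup>2) \<le> 1"
        proof (intro exI[of _ n0] allI impI f_norm S(1))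
          fix n s t assume "n0 \<le> n" "s \<in> S" "t \<in> S" "(s, t) \<in> \<theta> (k n)"
          moreover have "n \<le> k n" using k by (rule strict_mono_imp_increasing)
          ultimately have "(s, t) \<in> N"
            using sep[of s "k n" t] n0 by (meson less_le_trans order.trans)
          then show "s = t" using S(2) \<open>s \<in> S\<close> \<open>t \<in> S\<close> by blast
        qed
      qed
    next
      fix v q assume "\<forall>x. (v x @ [x], []) \<in> N"
      then have "\<forall>\<^sub>F n in sequentially. \<forall>x. (v x @ [x], []) \<in> \<theta> n"
        using N_\<theta> by (simp add: eventually_all_finite)
      then have "\<forall>\<^sub>F n in sequentially. (\<Sum>x\<in>UNIV. f (k n) (q @ v x) x) = (\<Sum>x\<in>UNIV. f (k n) q x)"
        by (rule eventually_mono[OF ev]) (auto intro: f_div)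
      moreover have "(\<lambda>n. \<Sum>x\<in>UNIV. f (k n) (q @ v x) x) \<longlonglongrightarrow> (\<Sum>x\<in>UNIV. u (q @ v x) x)"
        "(\<lambda>n. \<Sum>x\<in>UNIV. f (k n) q x) \<longlonglongrightarrow> (\<Sum>x\<in>UNIV. u q x)"
        by (intro tendsto_sum u)+
      ultimately show "(\<Sum>x\<in>UNIV. u (q @ v x) x) = (\<Sum>x\<in>UNIV. u q x)"
        using LIMSEQ_eventually_eq by blast
    qed
  qed
qed

section \<open>Projections in spaces of square summable functions\<close>

text \<open>The sum ranges over the whole type, so the same lemmas serve for functions on
  \<open>G\<close> extended by zero and for functions on pairs of a letter and a group
  element.\<close>

definition sq_summable :: "('i \<Rightarrow> complex) \<Rightarrow> bool" where
  "sq_summable f \<longleftrightarrow> (\<lambda>i. (cmod (f i))\<^sup>2) summable_on UNIV"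

definition nsq :: "('i \<Rightarrow> complex) \<Rightarrow> real" where
  "nsq f = (\<Sum>\<^sub>\<infinity>i. (cmod (f i))\<^sup>2)"

definition ip :: "('i \<Rightarrow> complex) \<Rightarrow> ('i \<Rightarrow> complex) \<Rightarrow> complex" where
  "ip f g = (\<Sum>\<^sub>\<infinity>i. f i * cnj (g i))"

lemma sq_summableI:
  assumes "\<And>S. finite S \<Longrightarrow> (\<Sum>i\<in>S. (cmod (f i))\<^sup>2) \<le> B"
  shows "sq_summable f" "nsq f \<le> B"
proof -
  show *: "sq_summable f"
    unfolding sq_summable_def
    by (rule nonneg_bdd_above_summable_on) (use assms in \<open>auto intro!: bdd_aboveI[of _ B]\<close>)
  show "nsq f \<le> B"
    using * assms unfolding sq_summable_def nsq_def by (intro infsum_le_finite_sums) auto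
qed

lemma sum_le_nsq: "sq_summable f \<Longrightarrow> finite S \<Longrightarrow> (\<Sum>i\<in>S. (cmod (f i))\<^sup>2) \<le> nsq f"
  unfolding sq_summable_def nsq_def by (rule finite_sum_le_infsum) auto

lemma cmod_le_nsq: "sq_summable f \<Longrightarrow> (cmod (f i))\<^sup>2 \<le> nsq f"
  using sum_le_nsq[of f "{i}"] by simp

lemma nsq_nonneg: "nsq f \<ge> 0"
  by (simp add: nsq_def infsum_nonneg)

lemma sq_summable_zero [simp]: "sq_summable (\<lambda>i. 0)"
  by (simp add: sq_summable_def)

lemma nsq_eq_0:
  assumes "sq_summable f" "nsq f \<le> 0"
  shows "f i = 0"
proof -
  have "(cmod (f i))\<^sup>2 \<le> 0" using cmod_le_nsq[OF assms(1), of i] assms(2) by linarith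
  then show ?thesis by simp
qed

lemma sq_summable_cmult:
  assumes "sq_summable f"
  shows "sq_summable (\<lambda>i. c * f i)" and "nsq (\<lambda>i. c * f i) = (cmod c)\<^sup>2 * nsq f"
  using assms summable_on_cmult_right[of "\<lambda>i. (cmod (f i))\<^sup>2" UNIV "(cmod c)\<^sup>2"]
  by (simp_all add: sq_summable_def nsq_def norm_mult power_mult_distrib infsum_cmult_right')

lemma sq_summable_add:
  assumes "sq_summable f" "sq_summable g"
  shows "sq_summable (\<lambda>i. f i + g i)"
proof (rule sq_summableI(1))
  fix S :: "'a set" assume S: "finite S"
  have "(cmod (f i + g i))\<^sup>2 \<le> 2 * (cmod (f i))\<^sup>2 + 2 * (cmod (g i))\<^sup>2" for i
  proof -
    have "(cmod (f i + g i))\<^sup>2 \<le> (cmod (f i) + cmod (g i))\<^sup>2"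
      by (intro power_mono norm_triangle_ineq) auto
    also have "\<dots> \<le> 2 * (cmod (f i))\<^sup>2 + 2 * (cmod (g i))\<^sup>2"
      using sum_squares_bound[of "cmod (f i)" "cmod (g i)"] by (simp add: power2_sum)
    finally show ?thesis .
  qed
  then have "(\<Sum>i\<in>S. (cmod (f i + g i))\<^sup>2) \<le> (\<Sum>i\<in>S. 2 * (cmod (f i))\<^sup>2 + 2 * (cmod (g i))\<^sup>2)"
    by (rule sum_mono)
  also have "\<dots> \<le> 2 * nsq f + 2 * nsq g"
    using sum_le_nsq[OF assms(1) S] sum_le_nsq[OF assms(2) S]
    by (simp add: sum.distrib flip: sum_distrib_left)
  finally show "(\<Sum>i\<in>S. (cmod (f i + g i))\<^sup>2) \<le> 2 * nsq f + 2 * nsq g" .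
qed

lemma sq_summable_diff:
  assumes "sq_summable f" "sq_summable g"
  shows "sq_summable (\<lambda>i. f i - g i)"
  using sq_summable_add[OF assms(1) sq_summable_cmult(1)[OF assms(2), of "-1"]] by simp

lemma sq_summable_sum:
  assumes "\<And>k. k \<in> K \<Longrightarrow> sq_summable (f k)"
  shows "sq_summable (\<lambda>i. \<Sum>k\<in>K. f k i)"
  using assms by (induction K rule: infinite_finite_induct) (auto intro: sq_summable_add)

lemma ip_summable:
  assumes "sq_summable f" "sq_summable g"
  shows "(\<lambda>i. f i * cnj (g i)) summable_on UNIV"
proof (rule abs_summable_summable, rule abs_summable_product)
  show "(\<lambda>i. norm (f i * f i)) summable_on UNIV"
    using assms(1) by (simp add: sq_summable_def norm_mult power2_eq_square)
  show "(\<lambda>i. norm (cnj (g i) * cnj (g i))) summable_on UNIV"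
    using assms(2) by (simp add: sq_summable_def norm_mult power2_eq_square)
qed

lemma ip_add_left:
  assumes "sq_summable f" "sq_summable g" "sq_summable h"
  shows "ip (\<lambda>i. f i + g i) h = ip f h + ip g h"
  using infsum_add[OF ip_summable[OF assms(1,3)] ip_summable[OF assms(2,3)]]
  by (simp add: ip_def distrib_right)

lemma ip_cmult_left: "ip (\<lambda>i. c * f i) h = c * ip f h"
  by (simp add: ip_def mult.assoc infsum_cmult_right')

lemma ip_commute: "ip f g = cnj (ip g f)"
  by (simp add: ip_def mult.commute flip: infsum_cnj)

lemma ip_diff_left:
  assumes "sq_summable f" "sq_summable g" "sq_summable h"
  shows "ip (\<lambda>i. f i - g i) h = ip f h - ip g h"
  using ip_add_left[OF assms(1) sq_summable_cmult(1)[OF assms(2)] assms(3), of "-1"]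
    ip_cmult_left[of "-1" g h] by simp

lemma ip_cmult_right: "ip f (\<lambda>i. c * h i) = cnj c * ip f h"
  by (subst (1 2) ip_commute) (simp add: ip_cmult_left)

lemma ip_self:
  assumes "sq_summable f"
  shows "ip f f = of_real (nsq f)"
proof -
  have "((\<lambda>i. of_real ((cmod (f i))\<^sup>2)) has_sum (of_real (nsq f) :: complex)) UNIV"
    using assms unfolding sq_summable_def nsq_def by (intro has_sum_of_real has_sum_infsum)
  moreover have "(\<lambda>i. of_real ((cmod (f i))\<^sup>2)) = (\<lambda>i. f i * cnj (f i))"
    using complex_norm_square by simp
  ultimately show ?thesis unfolding ip_def by (intro infsumI) simp
qed

lemma nsq_diff:
  assumes "sq_summable f" "sq_summable g"
  shows "nsq (\<lambda>i. f i - g i) = nsq f + nsq g - 2 * Re (ip f g)"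
proof -
  let ?d = "\<lambda>i. f i - g i"
  have d: "sq_summable ?d" by (rule sq_summable_diff[OF assms])
  have "ip ?d ?d = ip f ?d - ip g ?d" by (rule ip_diff_left[OF assms d])
  also have "ip f ?d = cnj (ip f f - ip g f)"
    by (subst ip_commute) (simp add: ip_diff_left assms)
  also have "ip g ?d = cnj (ip f g - ip g g)"
    by (subst ip_commute) (simp add: ip_diff_left assms)
  finally have "Re (ip ?d ?d) = Re (cnj (ip f f - ip g f) - cnj (ip f g - ip g g))" by simp
  moreover have "Re (ip g f) = Re (ip f g)" by (subst ip_commute) simp
  ultimately show ?thesis by (simp add: ip_self assms d)
qed

text \<open>Closedness under pointwise limits is stronger than norm closedness. It suits spaces cut
  out by equations that each involve finitely many coordinates. A countable index type provides
  diagonal subsequences.\<close>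

locale pointwise_closed_subspace =
  fixes H :: "('i::countable \<Rightarrow> complex) set"
  assumes sq_summable: "h \<in> H \<Longrightarrow> sq_summable h"
    and zero: "(\<lambda>i. 0) \<in> H"
    and add: "g \<in> H \<Longrightarrow> h \<in> H \<Longrightarrow> (\<lambda>i. g i + h i) \<in> H"
    and cmult: "h \<in> H \<Longrightarrow> (\<lambda>i. c * h i) \<in> H"
    and closed: "(\<And>n. f n \<in> H) \<Longrightarrow> (\<And>i. (\<lambda>n. f n i) \<longlonglongrightarrow> l i) \<Longrightarrow> sq_summable l \<Longrightarrow> l \<in> H"
begin

lemma diff: "g \<in> H \<Longrightarrow> h \<in> H \<Longrightarrow> (\<lambda>i. g i - h i) \<in> H"
  using add[OF _ cmult[of h "-1"]] by simp

text \<open>A pointwise limit of a minimizing sequence is a minimizer, by Fatou's lemma; no completeness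
  argument is needed.\<close>

lemma exists_projection:
  assumes f: "sq_summable f"
  shows "\<exists>h\<in>H. \<forall>g\<in>H. ip (\<lambda>i. f i - h i) g = 0"
proof -
  define D where "D = (INF h\<in>H. nsq (\<lambda>i. f i - h i))"
  have bdd: "bdd_below ((\<lambda>h. nsq (\<lambda>i. f i - h i)) ` H)"
    by (rule bdd_belowI[of _ 0]) (auto simp: nsq_nonneg)
  have D_le: "D \<le> nsq (\<lambda>i. f i - h i)" if "h \<in> H" for h
    unfolding D_def by (rule cINF_lower[OF bdd that])
  have "\<exists>h\<in>H. nsq (\<lambda>i. f i - h i) < D + 1 / real (Suc n)" for n
    using cINF_less_iff[of H "\<lambda>h. nsq (\<lambda>i. f i - h i)" "D + 1 / real (Suc n)"] bdd zero
    by (auto simp: D_def)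
  then obtain h where hH: "\<And>n. h n \<in> H"
    and hD: "\<And>n. nsq (\<lambda>i. f i - h n i) < D + 1 / real (Suc n)"
    by metis
  have sq: "sq_summable (\<lambda>i. f i - h n i)" for n
    by (rule sq_summable_diff[OF f sq_summable[OF hH]])
  \<comment> \<open>A uniform bound on the entries yields a subsequence that converges at every
    index.\<close>
  have "norm (f i - h n i) \<le> sqrt (D + 1)" for n i
  proof (rule real_le_rsqrt)
    have "1 / real (Suc n) \<le> 1" by simp
    then show "(norm (f i - h n i))\<^sup>2 \<le> D + 1"
      using cmod_le_nsq[OF sq, of i n] hD[of n] by linarith
  qed
  then obtain k where k: "strict_mono k"
    and conv: "\<And>i. i \<in> UNIV \<Longrightarrow> \<exists>l. (\<lambda>n. f i - h (k n) i) \<longlonglongrightarrow> l"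
    using function_convergent_subsequence[OF countableI_type, of UNIV "\<lambda>n i. f i - h n i" "sqrt (D + 1)"]
    by blast
  then obtain e where e: "\<And>i. (\<lambda>n. f i - h (k n) i) \<longlonglongrightarrow> e i" by (metis UNIV_I)
  have fin: "(\<Sum>i\<in>S. (cmod (e i))\<^sup>2) \<le> D" if S: "finite S" for S
  proof (rule LIMSEQ_le)
    show "(\<lambda>n. \<Sum>i\<in>S. (cmod (f i - h (k n) i))\<^sup>2) \<longlonglongrightarrow> (\<Sum>i\<in>S. (cmod (e i))\<^sup>2)"
      by (intro tendsto_sum tendsto_power tendsto_norm e)
    have "(\<lambda>n. D + 1 / real (Suc n)) \<longlonglongrightarrow> D + 0"
      by (intro tendsto_add tendsto_const LIMSEQ_Suc lim_1_over_n)
    then show "(\<lambda>n. D + 1 / real (Suc (k n))) \<longlonglongrightarrow> D"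
      using LIMSEQ_subseq_LIMSEQ[OF _ k] by (fastforce simp: o_def)
    show "\<exists>N. \<forall>n\<ge>N. (\<Sum>i\<in>S. (cmod (f i - h (k n) i))\<^sup>2) \<le> D + 1 / real (Suc (k n))"
      using sum_le_nsq[OF sq S] hD by (meson less_imp_le order_trans)
  qed
  have sqe: "sq_summable e" and nsqe: "nsq e \<le> D" using sq_summableI[of e D] fin by blast+
  define p where "p i = f i - e i" for i
  have "p \<in> H"
  proof (rule closed)
    show "h (k n) \<in> H" for n by (rule hH)
    show "(\<lambda>n. h (k n) i) \<longlonglongrightarrow> p i" for i
      using tendsto_diff[OF tendsto_const[of "f i"] e[of i]] by (simp add: p_def)
    show "sq_summable p" unfolding p_def by (rule sq_summable_diff[OF f sqe])
  qed
  moreover have "ip (\<lambda>i. f i - p i) g = 0" if g: "g \<in> H" for g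
  proof -
    \<comment> \<open>Moving \<open>p\<close> by \<open>c * g\<close> changes the squared distance
      by \<open>(t |a|)^2 nsq g - 2 t |a|^2\<close>. The chosen \<open>t\<close> keeps
      \<open>t * nsq g\<close> below 2, so a nonzero \<open>a\<close> would contradict
      minimality.\<close>
    define a where "a = ip e g"
    define t where "t = 1 / (nsq g + 1)"
    define c where "c = of_real t * a"
    have "(\<lambda>i. p i + c * g i) \<in> H" by (intro add cmult \<open>p \<in> H\<close> g)
    from D_le[OF this] have "D \<le> nsq (\<lambda>i. e i - c * g i)" by (simp add: p_def algebra_simps)
    also have "\<dots> = nsq e + (cmod c)\<^sup>2 * nsq g - 2 * Re (cnj c * a)"
      by (simp add: nsq_diff sqe sq_summable_cmult sq_summable g ip_cmult_right a_def)
    also have "cnj c * a = of_real (t * (cmod a)\<^sup>2)"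
      using complex_norm_square[of a] by (simp add: c_def mult_ac)
    finally have "0 \<le> (t * cmod a)\<^sup>2 * nsq g - 2 * (t * (cmod a)\<^sup>2)"
      using nsqe by (simp add: c_def norm_mult power_mult_distrib)
    also have "\<dots> = (t * (cmod a)\<^sup>2) * (t * nsq g - 2)"
      by (simp add: power2_eq_square algebra_simps)
    finally have "0 \<le> (t * (cmod a)\<^sup>2) * (t * nsq g - 2)" .
    moreover have "t * nsq g - 2 < 0" "t > 0"
      using nsq_nonneg[of g] by (simp_all add: t_def field_simps)
    ultimately have "(cmod a)\<^sup>2 \<le> 0"
      by (simp add: zero_le_mult_iff mult_le_0_iff)
    then show ?thesis by (simp add: a_def p_def)
  qed
  ultimately show ?thesis by blast
qed

definition proj :: "('i \<Rightarrow> complex) \<Rightarrow> ('i \<Rightarrow> complex)" where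
  "proj f = (SOME h. h \<in> H \<and> (\<forall>g\<in>H. ip (\<lambda>i. f i - h i) g = 0))"

lemma proj:
  assumes "sq_summable f"
  shows proj_in: "proj f \<in> H" and proj_orthogonal: "g \<in> H \<Longrightarrow> ip (\<lambda>i. f i - proj f i) g = 0"
proof -
  have "\<exists>h. h \<in> H \<and> (\<forall>g\<in>H. ip (\<lambda>i. f i - h i) g = 0)"
    using exists_projection[OF assms] by blast
  from someI_ex[OF this]
  show "proj f \<in> H" "g \<in> H \<Longrightarrow> ip (\<lambda>i. f i - proj f i) g = 0" by (auto simp: proj_def)
qed

lemma ip_proj:
  assumes "sq_summable f" "g \<in> H"
  shows "ip (proj f) g = ip f g"
  using proj_orthogonal[OF assms] ip_diff_left[OF assms(1) sq_summable[OF proj_in[OF assms(1)]] sq_summable[OF assms(2)]]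
  by simp

text \<open>The difference of two candidates lies in \<open>H\<close> and is orthogonal to
  \<open>H\<close>, hence to itself. Linearity and equivariance of the projection are read off from
  this characterization.\<close>

lemma proj_eqI:
  assumes f: "sq_summable f" and h: "h \<in> H" and ip: "\<And>g. g \<in> H \<Longrightarrow> ip f g = ip h g"
  shows "proj f = h"
proof
  fix i
  let ?d = "\<lambda>i. proj f i - h i"
  have d: "?d \<in> H" by (rule diff[OF proj_in[OF f] h])
  have "ip ?d ?d = ip (proj f) ?d - ip h ?d"
    by (intro ip_diff_left sq_summable proj_in f h d)
  also have "\<dots> = 0" using ip_proj[OF f d] ip[OF d] by simp
  finally have "nsq ?d = 0" by (simp add: ip_self sq_summable d)
  then show "proj f i = h i" using nsq_eq_0[OF sq_summable[OF d], of i] by simp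
qed

lemma proj_id: "h \<in> H \<Longrightarrow> proj h = h"
  by (rule proj_eqI) (auto intro: sq_summable)

lemma proj_add:
  assumes "sq_summable f" "sq_summable g"
  shows "proj (\<lambda>i. f i + g i) = (\<lambda>i. proj f i + proj g i)"
proof (rule proj_eqI)
  fix h assume "h \<in> H"
  then show "ip (\<lambda>i. f i + g i) h = ip (\<lambda>i. proj f i + proj g i) h"
    using assms by (simp add: ip_add_left sq_summable proj_in ip_proj)
qed (use assms in \<open>auto intro: sq_summable_add add proj_in\<close>)

lemma proj_cmult:
  assumes "sq_summable f"
  shows "proj (\<lambda>i. c * f i) = (\<lambda>i. c * proj f i)"
proof (rule proj_eqI)
  fix h assume "h \<in> H"
  then show "ip (\<lambda>i. c * f i) h = ip (\<lambda>i. c * proj f i) h"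
    using assms by (simp add: ip_cmult_left ip_proj)
qed (use assms in \<open>auto intro: sq_summable_cmult cmult proj_in\<close>)

lemma proj_eq_0: "sq_summable f \<Longrightarrow> (\<And>g. g \<in> H \<Longrightarrow> ip f g = 0) \<Longrightarrow> proj f = (\<lambda>i. 0)"
  by (rule proj_eqI) (auto intro: zero simp: ip_def)

lemma ip_proj_self: "sq_summable f \<Longrightarrow> ip (proj f) f = of_real (nsq (proj f))"
  by (subst ip_commute) (simp add: proj_in sq_summable ip_self flip: ip_proj)

lemma nsq_proj_le:
  assumes "sq_summable f"
  shows "nsq (proj f) \<le> nsq f"
proof -
  have "0 \<le> nsq (\<lambda>i. f i - proj f i)" by (rule nsq_nonneg)
  also have "\<dots> = nsq f + nsq (proj f) - 2 * Re (ip f (proj f))"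
    by (rule nsq_diff[OF assms sq_summable[OF proj_in[OF assms]]])
  also have "ip f (proj f) = of_real (nsq (proj f))"
    using ip_proj[OF assms proj_in[OF assms]] by (simp add: ip_self sq_summable proj_in assms)
  finally show ?thesis by simp
qed

end

section \<open>Free modules\<close>

context abelian_group
begin

lemma free_mod_carrier_iff:
  "c \<in> carrier (free_mod G I) \<longleftrightarrow> c \<in> I \<rightarrow>\<^sub>E carrier G \<and> finite (free_supp G I c)"
  by (simp add: free_mod_def free_supp_def)

lemma free_mod_closed: "c \<in> carrier (free_mod G I) \<Longrightarrow> i \<in> I \<Longrightarrow> c i \<in> carrier G"
  by (auto simp: free_mod_carrier_iff)

lemma free_mod_finite_supp: "c \<in> carrier (free_mod G I) \<Longrightarrow> finite (free_supp G I c)"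
  by (simp add: free_mod_carrier_iff)

lemma free_mod_ext:
  assumes "c \<in> carrier (free_mod G I)" "d \<in> carrier (free_mod G I)" "\<And>i. i \<in> I \<Longrightarrow> c i = d i"
  shows "c = d"
  using assms by (auto simp: free_mod_carrier_iff intro: PiE_ext)

lemma free_modI:
  assumes "\<And>i. i \<in> I \<Longrightarrow> f i \<in> carrier G" "finite J" "\<And>i. i \<in> I \<Longrightarrow> i \<notin> J \<Longrightarrow> f i = \<zero>"
  shows "(\<lambda>i\<in>I. f i) \<in> carrier (free_mod G I)"
proof -
  have "free_supp G I (\<lambda>i\<in>I. f i) \<subseteq> J" using assms(3) by (auto simp: free_supp_def)
  then show ?thesis using assms(1,2) by (auto simp: free_mod_carrier_iff intro: finite_subset)
qed

lemma free_mod_add_eq: "c \<oplus>\<^bsub>free_mod G I\<^esub> d = (\<lambda>i\<in>I. c i \<oplus> d i)"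
  and free_mod_zero_eq: "\<zero>\<^bsub>free_mod G I\<^esub> = (\<lambda>i\<in>I. \<zero>)"
  and free_mod_smult_eq: "r \<odot>\<^bsub>free_mod G I\<^esub> c = (\<lambda>i\<in>I. r \<otimes> c i)"
  by (simp_all add: free_mod_def)

lemma free_supp_zero: "i \<in> I \<Longrightarrow> i \<notin> free_supp G I c \<Longrightarrow> c i = \<zero>"
  by (simp add: free_supp_def)

lemma free_mod_add_closed:
  assumes "c \<in> carrier (free_mod G I)" "d \<in> carrier (free_mod G I)"
  shows "c \<oplus>\<^bsub>free_mod G I\<^esub> d \<in> carrier (free_mod G I)"
  unfolding free_mod_add_eq
  by (rule free_modI[of _ _ "free_supp G I c \<union> free_supp G I d"])
    (use assms in \<open>auto simp: free_mod_closed free_mod_finite_supp free_supp_zero\<close>)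

lemma free_mod_zero_closed: "\<zero>\<^bsub>free_mod G I\<^esub> \<in> carrier (free_mod G I)"
  unfolding free_mod_zero_eq by (rule free_modI[of _ _ "{}"]) auto

lemma free_mod_uminus_closed:
  assumes "c \<in> carrier (free_mod G I)"
  shows "(\<lambda>i\<in>I. \<ominus> c i) \<in> carrier (free_mod G I)"
  by (rule free_modI[of _ _ "free_supp G I c"])
    (use assms in \<open>auto simp: free_mod_closed free_mod_finite_supp free_supp_zero\<close>)

lemma abelian_group_free_mod: "abelian_group (free_mod G I)"
proof (rule abelian_groupI)
  fix c assume c: "c \<in> carrier (free_mod G I)"
  show "\<exists>d\<in>carrier (free_mod G I). d \<oplus>\<^bsub>free_mod G I\<^esub> c = \<zero>\<^bsub>free_mod G I\<^esub>"
  proof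
    show "(\<lambda>i\<in>I. \<ominus> c i) \<oplus>\<^bsub>free_mod G I\<^esub> c = \<zero>\<^bsub>free_mod G I\<^esub>"
      using c by (auto simp: free_mod_add_eq free_mod_zero_eq free_mod_closed l_neg)
  qed (rule free_mod_uminus_closed[OF c])
next
  show "\<zero>\<^bsub>free_mod G I\<^esub> \<oplus>\<^bsub>free_mod G I\<^esub> c = c" if "c \<in> carrier (free_mod G I)" for c
    by (rule free_mod_ext[OF free_mod_add_closed[OF free_mod_zero_closed that] that])
      (use that in \<open>simp add: free_mod_add_eq free_mod_zero_eq free_mod_closed\<close>)
next
  fix c d e
  assume *: "c \<in> carrier (free_mod G I)" "d \<in> carrier (free_mod G I)" "e \<in> carrier (free_mod G I)"
  then show "(c \<oplus>\<^bsub>free_mod G I\<^esub> d) \<oplus>\<^bsub>free_mod G I\<^esub> e = c \<oplus>\<^bsub>free_mod G I\<^esub> (d \<oplus>\<^bsub>free_mod G I\<^esub> e)"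
    "c \<oplus>\<^bsub>free_mod G I\<^esub> d = d \<oplus>\<^bsub>free_mod G I\<^esub> c"
    by (auto simp: free_mod_add_eq free_mod_closed a_assoc intro!: restrict_ext intro: a_comm)
qed (auto intro: free_mod_add_closed free_mod_zero_closed)

lemma free_mod_uminus_eq:
  assumes "c \<in> carrier (free_mod G I)"
  shows "\<ominus>\<^bsub>free_mod G I\<^esub> c = (\<lambda>i\<in>I. \<ominus> c i)"
proof -
  interpret F: abelian_group "free_mod G I" by (rule abelian_group_free_mod)
  show ?thesis
    using assms by (intro F.minus_equality)
      (auto simp: free_mod_uminus_closed free_mod_add_eq free_mod_zero_eq free_mod_closed l_neg)
qed

lemma free_mod_minus_eq:
  assumes "c \<in> carrier (free_mod G I)" "d \<in> carrier (free_mod G I)"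
  shows "c \<ominus>\<^bsub>free_mod G I\<^esub> d = (\<lambda>i\<in>I. c i \<ominus> d i)"
  using assms by (auto simp: a_minus_def free_mod_uminus_eq free_mod_add_eq intro!: restrict_ext)

lemma free_mod_finsum:
  assumes "finite S" "\<And>s. s \<in> S \<Longrightarrow> c s \<in> carrier (free_mod G I)" "i \<in> I"
  shows "(\<Oplus>\<^bsub>free_mod G I\<^esub>s\<in>S. c s) i = (\<Oplus>s\<in>S. c s i)"
proof -
  interpret F: abelian_group "free_mod G I" by (rule abelian_group_free_mod)
  show ?thesis
    using assms(1,2)
  proof (induction S rule: finite_induct)
    case empty
    then show ?case using assms(3) by (simp add: free_mod_zero_eq)
  next
    case (insert s S)
    then have "(\<Oplus>\<^bsub>free_mod G I\<^esub>s\<in>insert s S. c s) = c s \<oplus>\<^bsub>free_mod G I\<^esub> (\<Oplus>\<^bsub>free_mod G I\<^esub>s\<in>S. c s)"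
      by (intro F.finsum_insert) auto
    moreover have "(\<Oplus>s\<in>insert s S. c s i) = c s i \<oplus> (\<Oplus>s\<in>S. c s i)"
      using insert assms(3) by (intro finsum_insert) (auto intro: free_mod_closed)
    ultimately show ?case using insert assms(3) by (simp add: free_mod_add_eq)
  qed
qed

lemma free_single_closed:
  assumes "r \<in> carrier G"
  shows "free_single G I r i \<in> carrier (free_mod G I)"
  unfolding free_single_def by (rule free_modI[of _ _ "{i}"]) (use assms in auto)

end

section \<open>The group von Neumann algebra\<close>

text \<open>Vanishing outside the carrier lets sums over the carrier be replaced by sums over the
  type.\<close>

lemma l2_iff: "f \<in> l2 G \<longleftrightarrow> (\<forall>x. x \<notin> carrier G \<longrightarrow> f x = 0) \<and> sq_summable f"
proof -
  have "(\<lambda>x. (cmod (f x))\<^sup>2) summable_on carrier G \<longleftrightarrow> (\<lambda>x. (cmod (f x))\<^sup>2) summable_on UNIV"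
    if "\<forall>x. x \<notin> carrier G \<longrightarrow> f x = 0"
    using that by (intro summable_on_cong_neutral) auto
  then show ?thesis by (auto simp: l2_def sq_summable_def)
qed

lemma l2_norm_eq: "f \<in> l2 G \<Longrightarrow> l2_norm G f = sqrt (nsq f)"
  unfolding l2_norm_def nsq_def l2_iff by (intro arg_cong[of _ _ sqrt] infsum_cong_neutral) auto

lemma l2_zero: "(\<lambda>x. 0) \<in> l2 G"
  and l2_add: "f \<in> l2 G \<Longrightarrow> g \<in> l2 G \<Longrightarrow> (\<lambda>x. f x + g x) \<in> l2 G"
  and l2_diff: "f \<in> l2 G \<Longrightarrow> g \<in> l2 G \<Longrightarrow> (\<lambda>x. f x - g x) \<in> l2 G"
  and l2_cmult: "f \<in> l2 G \<Longrightarrow> (\<lambda>x. c * f x) \<in> l2 G"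
  and l2_sum: "(\<And>i. i \<in> I \<Longrightarrow> F i \<in> l2 G) \<Longrightarrow> (\<lambda>x. \<Sum>i\<in>I. F i x) \<in> l2 G"
  by (auto simp: l2_iff sq_summable_add sq_summable_diff sq_summable_cmult intro: sq_summable_sum)

lemma nsq_add_le:
  assumes "sq_summable f" "sq_summable g"
  shows "nsq (\<lambda>i. f i + g i) \<le> 2 * nsq f + 2 * nsq g"
proof -
  have g: "sq_summable (\<lambda>i. - g i)" "nsq (\<lambda>i. - g i) = nsq g"
    using sq_summable_cmult[OF assms(2), of "-1"] by auto
  have "nsq (\<lambda>i. f i - - g i) = nsq f + nsq g - 2 * Re (ip f (\<lambda>i. - g i))"
    using nsq_diff[OF assms(1) g(1)] g(2) by simp
  moreover have "nsq (\<lambda>i. f i - g i) = nsq f + nsq g - 2 * Re (ip f g)"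
    by (rule nsq_diff[OF assms])
  moreover have "ip f (\<lambda>i. - g i) = - ip f g"
    using ip_cmult_right[of f "-1" g] by simp
  ultimately show ?thesis using nsq_nonneg[of "\<lambda>i. f i - g i"] by simp
qed

lemma vN_carrier_iff:
  "T \<in> carrier (vN_algebra G) \<longleftrightarrow> T \<in> l2 G \<rightarrow>\<^sub>E l2 G
     \<and> (\<forall>f\<in>l2 G. \<forall>h\<in>l2 G. T (\<lambda>x. f x + h x) = (\<lambda>x. T f x + T h x))
     \<and> (\<forall>c. \<forall>f\<in>l2 G. T (\<lambda>x. c * f x) = (\<lambda>x. c * T f x))
     \<and> (\<exists>K. \<forall>f\<in>l2 G. nsq (T f) \<le> K * nsq f)
     \<and> (\<forall>g\<in>carrier G. \<forall>f\<in>l2 G. T (left_trans G g f) = left_trans G g (T f))"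
proof -
  have "(\<exists>C. \<forall>f\<in>l2 G. l2_norm G (T f) \<le> C * l2_norm G f) \<longleftrightarrow> (\<exists>K. \<forall>f\<in>l2 G. nsq (T f) \<le> K * nsq f)"
    if T: "T \<in> l2 G \<rightarrow>\<^sub>E l2 G"
  proof
    assume "\<exists>C. \<forall>f\<in>l2 G. l2_norm G (T f) \<le> C * l2_norm G f"
    then obtain C where C: "\<And>f. f \<in> l2 G \<Longrightarrow> l2_norm G (T f) \<le> C * l2_norm G f" by blast
    have "nsq (T f) \<le> C\<^sup>2 * nsq f" if f: "f \<in> l2 G" for f
    proof -
      have "sqrt (nsq (T f)) \<le> C * sqrt (nsq f)"
        using C[OF f] l2_norm_eq[OF f] l2_norm_eq[OF PiE_mem[OF T f]] by simp
      then have "(sqrt (nsq (T f)))\<^sup>2 \<le> (C * sqrt (nsq f))\<^sup>2"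
        by (intro power_mono) (auto simp: nsq_nonneg)
      then show ?thesis by (simp add: power_mult_distrib nsq_nonneg)
    qed
    then show "\<exists>K. \<forall>f\<in>l2 G. nsq (T f) \<le> K * nsq f" by blast
  next
    assume "\<exists>K. \<forall>f\<in>l2 G. nsq (T f) \<le> K * nsq f"
    then obtain K where K: "\<And>f. f \<in> l2 G \<Longrightarrow> nsq (T f) \<le> K * nsq f" by blast
    \<comment> \<open>The real \<open>sqrt\<close> is odd and multiplicative on all reals, so the
      sign of \<open>K\<close> does not matter.\<close>
    have "l2_norm G (T f) \<le> sqrt K * l2_norm G f" if f: "f \<in> l2 G" for f
      using real_sqrt_le_mono[OF K[OF f]] l2_norm_eq[OF f] l2_norm_eq[OF PiE_mem[OF T f]]
      by (simp add: real_sqrt_mult)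
    then show "\<exists>C. \<forall>f\<in>l2 G. l2_norm G (T f) \<le> C * l2_norm G f" by blast
  qed
  then show ?thesis by (auto simp: vN_algebra_def l2_bounded_ops_def)
qed

lemma vN_closed: "T \<in> carrier (vN_algebra G) \<Longrightarrow> f \<in> l2 G \<Longrightarrow> T f \<in> l2 G"
  and vN_add: "T \<in> carrier (vN_algebra G) \<Longrightarrow> f \<in> l2 G \<Longrightarrow> h \<in> l2 G \<Longrightarrow>
    T (\<lambda>x. f x + h x) = (\<lambda>x. T f x + T h x)"
  and vN_cmult: "T \<in> carrier (vN_algebra G) \<Longrightarrow> f \<in> l2 G \<Longrightarrow> T (\<lambda>x. c * f x) = (\<lambda>x. c * T f x)"
  and vN_left_trans: "T \<in> carrier (vN_algebra G) \<Longrightarrow> g \<in> carrier G \<Longrightarrow> f \<in> l2 G \<Longrightarrow>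
    T (left_trans G g f) = left_trans G g (T f)"
  by (auto simp: vN_carrier_iff)

lemma vN_bounded:
  assumes "T \<in> carrier (vN_algebra G)"
  obtains K where "\<And>f. f \<in> l2 G \<Longrightarrow> nsq (T f) \<le> K * nsq f"
proof -
  have "\<exists>K. \<forall>f\<in>l2 G. nsq (T f) \<le> K * nsq f" using assms by (simp add: vN_carrier_iff)
  then show thesis using that by blast
qed

lemma vN_zero: "T \<in> carrier (vN_algebra G) \<Longrightarrow> T (\<lambda>x. 0) = (\<lambda>x. 0)"
  using vN_cmult[of T G "\<lambda>x. 0" 0] l2_zero[of G] by simp

lemma vN_diff:
  assumes "T \<in> carrier (vN_algebra G)" "f \<in> l2 G" "h \<in> l2 G"
  shows "T (\<lambda>x. f x - h x) = (\<lambda>x. T f x - T h x)"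
  using vN_add[OF assms(1,2) l2_cmult[OF assms(3), of "-1"]] vN_cmult[OF assms(1,3), of "-1"] by simp

lemma vN_sum:
  assumes "T \<in> carrier (vN_algebra G)" "\<And>i. i \<in> I \<Longrightarrow> F i \<in> l2 G"
  shows "T (\<lambda>x. \<Sum>i\<in>I. F i x) = (\<lambda>x. \<Sum>i\<in>I. T (F i) x)"
  using assms(2)
proof (induction I rule: infinite_finite_induct)
  case (insert i I)
  have "T (\<lambda>x. F i x + (\<Sum>i\<in>I. F i x)) = (\<lambda>x. T (F i) x + T (\<lambda>x. \<Sum>i\<in>I. F i x) x)"
    using insert.prems by (intro vN_add[OF assms(1)] l2_sum) auto
  moreover have "T (\<lambda>x. \<Sum>i\<in>I. F i x) = (\<lambda>x. \<Sum>i\<in>I. T (F i) x)"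
    by (rule insert.IH) (simp add: insert.prems)
  ultimately show ?case using insert.hyps by simp
qed (simp_all add: vN_zero[OF assms(1)])

lemma vN_ext:
  assumes "S \<in> carrier (vN_algebra G)" "T \<in> carrier (vN_algebra G)"
    "\<And>f x. f \<in> l2 G \<Longrightarrow> S f x = T f x"
  shows "S = T"
proof (rule PiE_ext)
  show "S \<in> l2 G \<rightarrow>\<^sub>E l2 G" "T \<in> l2 G \<rightarrow>\<^sub>E l2 G" using assms(1,2) by (simp_all add: vN_carrier_iff)
  show "S f = T f" if "f \<in> l2 G" for f using assms(3)[OF that] by (rule ext)
qed

lemma vN_simps:
  "\<zero>\<^bsub>vN_algebra G\<^esub> = (\<lambda>f\<in>l2 G. \<lambda>x. 0)"
  "S \<oplus>\<^bsub>vN_algebra G\<^esub> T = (\<lambda>f\<in>l2 G. \<lambda>x. S f x + T f x)"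
  "S \<otimes>\<^bsub>vN_algebra G\<^esub> T = (\<lambda>f\<in>l2 G. S (T f))"
  by (simp_all add: vN_algebra_def)

lemma left_trans_apply: "f \<in> l2 G \<Longrightarrow>
    left_trans G g f x = (if x \<in> carrier G then f (inv\<^bsub>G\<^esub> g \<otimes>\<^bsub>G\<^esub> x) else 0)"
  and right_trans_apply: "f \<in> l2 G \<Longrightarrow>
    right_trans G g f x = (if x \<in> carrier G then f (x \<otimes>\<^bsub>G\<^esub> g) else 0)"
  by (simp_all add: left_trans_def right_trans_def)

lemma vN_carrierI:
  assumes "\<And>f. f \<in> l2 G \<Longrightarrow> F f \<in> l2 G"
    and "\<And>f h. f \<in> l2 G \<Longrightarrow> h \<in> l2 G \<Longrightarrow> F (\<lambda>x. f x + h x) = (\<lambda>x. F f x + F h x)"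
    and "\<And>c f. f \<in> l2 G \<Longrightarrow> F (\<lambda>x. c * f x) = (\<lambda>x. c * F f x)"
    and "\<And>f. f \<in> l2 G \<Longrightarrow> nsq (F f) \<le> K * nsq f"
    and "\<And>g f. g \<in> carrier G \<Longrightarrow> f \<in> l2 G \<Longrightarrow> left_trans G g f \<in> l2 G"
    and "\<And>g f. g \<in> carrier G \<Longrightarrow> f \<in> l2 G \<Longrightarrow> F (left_trans G g f) = left_trans G g (F f)"
  shows "(\<lambda>f\<in>l2 G. F f) \<in> carrier (vN_algebra G)"
  using assms unfolding vN_carrier_iff by (auto simp: l2_add l2_cmult intro!: exI[of _ K])

context group
begin

abbreviation vN :: "'a l2_op ring" (\<open>\<N>\<close>) where
  "\<N> \<equiv> vN_algebra G"

lemma bij_betw_left: "g \<in> carrier G \<Longrightarrow> bij_betw (\<lambda>x. inv g \<otimes> x) (carrier G) (carrier G)"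
  by (rule bij_betw_byWitness[where f' = "\<lambda>x. g \<otimes> x"]) (auto simp flip: m_assoc)

lemma bij_betw_right: "g \<in> carrier G \<Longrightarrow> bij_betw (\<lambda>x. x \<otimes> g) (carrier G) (carrier G)"
  by (rule bij_betw_byWitness[where f' = "\<lambda>x. x \<otimes> inv g"]) (auto simp: m_assoc)

lemma l2_reindex:
  assumes "f \<in> l2 G" "bij_betw \<pi> (carrier G) (carrier G)"
  defines "f' \<equiv> \<lambda>x. if x \<in> carrier G then f (\<pi> x) else 0"
  shows "f' \<in> l2 G" and "nsq f' = nsq f"
proof -
  have "(\<lambda>x. (cmod (f' x))\<^sup>2) summable_on carrier G \<longleftrightarrow> (\<lambda>x. (cmod (f (\<pi> x)))\<^sup>2) summable_on carrier G"
    by (rule summable_on_cong) (simp add: f'_def)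
  also have "\<dots> \<longleftrightarrow> (\<lambda>x. (cmod (f x))\<^sup>2) summable_on carrier G"
    by (rule summable_on_reindex_bij_betw[OF assms(2)])
  finally show f': "f' \<in> l2 G" using assms(1) by (simp add: l2_def f'_def)
  have "(\<Sum>\<^sub>\<infinity>x\<in>carrier G. (cmod (f' x))\<^sup>2) = (\<Sum>\<^sub>\<infinity>x\<in>carrier G. (cmod (f (\<pi> x)))\<^sup>2)"
    by (rule infsum_cong) (simp add: f'_def)
  also have "\<dots> = (\<Sum>\<^sub>\<infinity>x\<in>carrier G. (cmod (f x))\<^sup>2)"
    by (rule infsum_reindex_bij_betw[OF assms(2)])
  finally have "l2_norm G f' = l2_norm G f" by (simp add: l2_norm_def)
  then show "nsq f' = nsq f" using l2_norm_eq[OF f'] l2_norm_eq[OF assms(1)] by simp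
qed

lemma left_trans_l2: "g \<in> carrier G \<Longrightarrow> f \<in> l2 G \<Longrightarrow> left_trans G g f \<in> l2 G"
  using l2_reindex(1)[OF _ bij_betw_left] by (simp add: left_trans_def)

lemma right_trans_l2: "g \<in> carrier G \<Longrightarrow> f \<in> l2 G \<Longrightarrow> right_trans G g f \<in> l2 G"
  and nsq_right_trans: "g \<in> carrier G \<Longrightarrow> f \<in> l2 G \<Longrightarrow> nsq (right_trans G g f) = nsq f"
  using l2_reindex[OF _ bij_betw_right] by (simp_all add: right_trans_def)

text \<open>Left and right translations commute by associativity.\<close>

lemma right_trans_closed:
  assumes "g \<in> carrier G"
  shows "right_trans G g \<in> carrier \<N>"
proof -
  have "(\<lambda>f\<in>l2 G. right_trans G g f) \<in> carrier \<N>"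
  proof (rule vN_carrierI)
    fix h f assume hf: "h \<in> carrier G" "f \<in> l2 G"
    show "right_trans G g (left_trans G h f) = left_trans G h (right_trans G g f)"
      using hf assms
      by (intro ext) (simp add: right_trans_apply left_trans_apply left_trans_l2 right_trans_l2 m_assoc)
  next
    show "right_trans G g (\<lambda>x. f x + h x) = (\<lambda>x. right_trans G g f x + right_trans G g h x)"
      if "f \<in> l2 G" "h \<in> l2 G" for f h
      using that by (intro ext) (simp add: right_trans_apply l2_add)
    show "right_trans G g (\<lambda>x. c * f x) = (\<lambda>x. c * right_trans G g f x)" if "f \<in> l2 G" for c f
      using that by (intro ext) (simp add: right_trans_apply l2_cmult)
    show "nsq (right_trans G g f) \<le> 1 * nsq f" if "f \<in> l2 G" for f
      using nsq_right_trans[OF assms that] by simp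
  qed (auto simp: right_trans_l2 assms left_trans_l2)
  moreover have "(\<lambda>f\<in>l2 G. right_trans G g f) = right_trans G g"
    by (auto simp: right_trans_def)
  ultimately show ?thesis by simp
qed

lemma vN_mult_closed:
  assumes S: "S \<in> carrier \<N>" and T: "T \<in> carrier \<N>"
  shows "S \<otimes>\<^bsub>\<N>\<^esub> T \<in> carrier \<N>"
proof -
  obtain K where K: "\<And>f. f \<in> l2 G \<Longrightarrow> nsq (S f) \<le> K * nsq f" by (rule vN_bounded[OF S]) blast
  obtain L where L: "\<And>f. f \<in> l2 G \<Longrightarrow> nsq (T f) \<le> L * nsq f" by (rule vN_bounded[OF T]) blast
  have "nsq (S (T f)) \<le> (\<bar>K\<bar> * L) * nsq f" if f: "f \<in> l2 G" for f
  proof -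
    have "nsq (S (T f)) \<le> K * nsq (T f)" using K vN_closed[OF T f] .
    also have "\<dots> \<le> \<bar>K\<bar> * nsq (T f)" by (intro mult_right_mono nsq_nonneg) simp
    also have "\<dots> \<le> \<bar>K\<bar> * (L * nsq f)" by (intro mult_left_mono L[OF f]) simp
    finally show ?thesis by (simp add: mult.assoc)
  qed
  then show ?thesis
    unfolding vN_simps
    by (rule vN_carrierI[rotated 3])
      (auto simp: vN_closed[OF S] vN_closed[OF T] vN_add[OF S] vN_add[OF T] vN_cmult[OF S]
        vN_cmult[OF T] vN_left_trans[OF S] vN_left_trans[OF T] left_trans_l2)
qed

lemma vN_add_closed:
  assumes S: "S \<in> carrier \<N>" and T: "T \<in> carrier \<N>"
  shows "S \<oplus>\<^bsub>\<N>\<^esub> T \<in> carrier \<N>"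
proof -
  obtain K where K: "\<And>f. f \<in> l2 G \<Longrightarrow> nsq (S f) \<le> K * nsq f" by (rule vN_bounded[OF S]) blast
  obtain L where L: "\<And>f. f \<in> l2 G \<Longrightarrow> nsq (T f) \<le> L * nsq f" by (rule vN_bounded[OF T]) blast
  have "nsq (\<lambda>x. S f x + T f x) \<le> (2 * K + 2 * L) * nsq f" if f: "f \<in> l2 G" for f
    using nsq_add_le[of "S f" "T f"] K[OF f] L[OF f] vN_closed[OF S f] vN_closed[OF T f]
    by (simp add: l2_iff algebra_simps)
  then show ?thesis
    unfolding vN_simps
  proof (rule vN_carrierI[rotated 3])
    fix g f assume gf: "g \<in> carrier G" "f \<in> l2 G"
    have "left_trans G g (\<lambda>x. S f x + T f x) = (\<lambda>x. left_trans G g (S f) x + left_trans G g (T f) x)"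
      using vN_closed[OF S gf(2)] vN_closed[OF T gf(2)]
      by (intro ext) (simp add: left_trans_apply l2_add)
    then show "(\<lambda>x. S (left_trans G g f) x + T (left_trans G g f) x) = left_trans G g (\<lambda>x. S f x + T f x)"
      using vN_left_trans[OF S gf] vN_left_trans[OF T gf] by simp
  qed (auto simp: vN_closed[OF S] vN_closed[OF T] vN_add[OF S] vN_add[OF T] vN_cmult[OF S]
      vN_cmult[OF T] left_trans_l2 l2_add algebra_simps)
qed

lemma vN_zero_closed: "\<zero>\<^bsub>\<N>\<^esub> \<in> carrier \<N>"
  unfolding vN_simps
  by (rule vN_carrierI[where K = 0]) (auto simp: l2_zero left_trans_apply left_trans_l2 nsq_def)

text \<open>With \<open>c = -1\<close> this makes negation a scalar multiplication, so subsets
  closed under addition and scalars are closed under negatives.\<close>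

definition vN_scalar :: "complex \<Rightarrow> 'a l2_op" where
  "vN_scalar c = (\<lambda>f\<in>l2 G. \<lambda>x. c * f x)"

lemma vN_scalar_closed: "vN_scalar c \<in> carrier \<N>"
  unfolding vN_scalar_def
proof (rule vN_carrierI)
  fix f assume f: "f \<in> l2 G"
  then show "nsq (\<lambda>x. c * f x) \<le> (cmod c)\<^sup>2 * nsq f" by (simp add: l2_iff sq_summable_cmult)
  show "(\<lambda>x. c * left_trans G g f x) = left_trans G g (\<lambda>x. c * f x)" for g
    using f by (intro ext) (simp add: left_trans_apply l2_cmult)
qed (auto simp: l2_cmult left_trans_l2 algebra_simps)

lemma vN_neg:
  assumes S: "S \<in> carrier \<N>"
  shows "vN_scalar (-1) \<otimes>\<^bsub>\<N>\<^esub> S \<oplus>\<^bsub>\<N>\<^esub> S = \<zero>\<^bsub>\<N>\<^esub>"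
proof -
  have T: "vN_scalar (-1) \<otimes>\<^bsub>\<N>\<^esub> S \<in> carrier \<N>"
    by (rule vN_mult_closed[OF vN_scalar_closed S])
  show ?thesis
  proof (rule vN_ext[OF vN_add_closed[OF T S] vN_zero_closed])
    fix f x assume f: "f \<in> l2 G"
    show "(vN_scalar (-1) \<otimes>\<^bsub>\<N>\<^esub> S \<oplus>\<^bsub>\<N>\<^esub> S) f x = \<zero>\<^bsub>\<N>\<^esub> f x"
      using f vN_closed[OF S f] by (simp add: vN_simps vN_scalar_def)
  qed
qed

text \<open>This supplies finite sums and negatives. Products enter through closure lemmas and
  through evaluation at functions.\<close>

lemma abelian_group_vN: "abelian_group \<N>"
proof (rule abelian_groupI)
  fix S assume S: "S \<in> carrier \<N>"
  show "\<zero>\<^bsub>\<N>\<^esub> \<oplus>\<^bsub>\<N>\<^esub> S = S"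
    by (rule vN_ext[OF vN_add_closed[OF vN_zero_closed S] S]) (simp add: vN_simps)
  show "\<exists>T\<in>carrier \<N>. T \<oplus>\<^bsub>\<N>\<^esub> S = \<zero>\<^bsub>\<N>\<^esub>"
  proof
    show T: "vN_scalar (-1) \<otimes>\<^bsub>\<N>\<^esub> S \<in> carrier \<N>"
      by (rule vN_mult_closed[OF vN_scalar_closed S])
    show "vN_scalar (-1) \<otimes>\<^bsub>\<N>\<^esub> S \<oplus>\<^bsub>\<N>\<^esub> S = \<zero>\<^bsub>\<N>\<^esub>"
      by (rule vN_neg[OF S])
  qed
next
  fix S T U
  show "(S \<oplus>\<^bsub>\<N>\<^esub> T) \<oplus>\<^bsub>\<N>\<^esub> U = S \<oplus>\<^bsub>\<N>\<^esub> (T \<oplus>\<^bsub>\<N>\<^esub> U)"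
    unfolding vN_simps by (rule restrict_ext) (simp add: add.assoc)
  show "S \<oplus>\<^bsub>\<N>\<^esub> T = T \<oplus>\<^bsub>\<N>\<^esub> S"
    unfolding vN_simps by (rule restrict_ext) (simp add: add.commute)
qed (fact vN_add_closed vN_zero_closed)+

lemma vN_uminus_eq:
  assumes S: "S \<in> carrier \<N>"
  shows "\<ominus>\<^bsub>\<N>\<^esub> S = vN_scalar (-1) \<otimes>\<^bsub>\<N>\<^esub> S"
proof -
  interpret N: abelian_group "\<N>" by (rule abelian_group_vN)
  have T: "vN_scalar (-1) \<otimes>\<^bsub>\<N>\<^esub> S \<in> carrier \<N>"
    by (rule vN_mult_closed[OF vN_scalar_closed S])
  show ?thesis
  proof (rule N.minus_equality[OF _ S T])
    show "vN_scalar (-1) \<otimes>\<^bsub>\<N>\<^esub> S \<oplus>\<^bsub>\<N>\<^esub> S = \<zero>\<^bsub>\<N>\<^esub>"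
      by (rule vN_neg[OF S])
  qed
qed

lemma vN_minus_eval:
  assumes "S \<in> carrier \<N>" "T \<in> carrier \<N>" "f \<in> l2 G"
  shows "(S \<ominus>\<^bsub>\<N>\<^esub> T) f = (\<lambda>x. S f x - T f x)"
  using assms by (simp add: a_minus_def vN_uminus_eq vN_simps vN_scalar_def vN_closed)

lemma vN_finsum_eval:
  assumes "finite I" "\<And>i. i \<in> I \<Longrightarrow> T i \<in> carrier \<N>" "f \<in> l2 G"
  shows "(\<Oplus>\<^bsub>\<N>\<^esub>i\<in>I. T i) f = (\<lambda>x. \<Sum>i\<in>I. T i f x)"
proof -
  interpret N: abelian_group "\<N>" by (rule abelian_group_vN)
  show ?thesis
    using assms(1,2)
  proof (induction I rule: finite_induct)
    case empty
    then show ?case using assms(3) by (simp add: vN_simps)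
  next
    case (insert i I)
    have eq: "(\<Oplus>\<^bsub>\<N>\<^esub>i\<in>insert i I. T i) = T i \<oplus>\<^bsub>\<N>\<^esub> (\<Oplus>\<^bsub>\<N>\<^esub>i\<in>I. T i)"
      using insert.hyps insert.prems by (intro N.finsum_insert Pi_I) blast+
    have IH: "(\<Oplus>\<^bsub>\<N>\<^esub>i\<in>I. T i) f = (\<lambda>x. \<Sum>i\<in>I. T i f x)"
      by (rule insert.IH) (simp add: insert.prems)
    show ?case
      unfolding eq vN_simps(2) using assms(3) insert.hyps by (simp add: IH)
  qed
qed

end

section \<open>The bar complex\<close>

context group
begin

interpretation vN: abelian_group "\<N>"
  by (rule abelian_group_vN)

text \<open>This pairs 1-chains over \<N> with 1-cochains having values in \<open>l2 G\<close>.
  Inner cocycles recover \<open>bar_d1\<close>, and arbitrary cocycles annihilate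
  boundaries.\<close>

definition pairing :: "('a \<Rightarrow> 'a l2_op) \<Rightarrow> ('a \<Rightarrow> 'a \<Rightarrow> complex) \<Rightarrow> 'a \<Rightarrow> complex" where
  "pairing c \<beta> = (\<lambda>x. \<Sum>g\<in>free_supp \<N> (carrier G) c. c g (\<beta> g) x)"

lemma vN_zero_eval: "f \<in> l2 G \<Longrightarrow> \<zero>\<^bsub>\<N>\<^esub> f = (\<lambda>x. 0)"
  by (simp add: vN_simps)

lemma vN_mult_eval: "f \<in> l2 G \<Longrightarrow> (S \<otimes>\<^bsub>\<N>\<^esub> T) f = S (T f)"
  by (simp add: vN_simps)

lemma vN_add_eval: "f \<in> l2 G \<Longrightarrow> (S \<oplus>\<^bsub>\<N>\<^esub> T) f = (\<lambda>x. S f x + T f x)"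
  by (simp add: vN_simps)

lemma bar1_closed: "c \<in> carrier (bar1 G) \<Longrightarrow> g \<in> carrier G \<Longrightarrow> c g \<in> carrier \<N>"
  unfolding bar1_def by (rule vN.free_mod_closed)

lemma bar2_closed: "c \<in> carrier (bar2 G) \<Longrightarrow> g \<in> carrier G \<Longrightarrow> h \<in> carrier G \<Longrightarrow>
    c (g, h) \<in> carrier \<N>"
  unfolding bar2_def by (rule vN.free_mod_closed) auto

lemma bar1_ext:
  assumes "c \<in> carrier (bar1 G)" "d \<in> carrier (bar1 G)"
    "\<And>g f x. g \<in> carrier G \<Longrightarrow> f \<in> l2 G \<Longrightarrow> c g f x = d g f x"
  shows "c = d"
  using assms(1,2) unfolding bar1_def
proof (rule vN.free_mod_ext)
  fix g assume "g \<in> carrier G"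
  then show "c g = d g" using bar1_closed assms by (intro vN_ext) auto
qed

lemma bar1_simps:
  "g \<in> carrier G \<Longrightarrow> (c \<oplus>\<^bsub>bar1 G\<^esub> d) g = c g \<oplus>\<^bsub>\<N>\<^esub> d g"
  "g \<in> carrier G \<Longrightarrow> (r \<odot>\<^bsub>bar1 G\<^esub> c) g = r \<otimes>\<^bsub>\<N>\<^esub> c g"
  "g \<in> carrier G \<Longrightarrow> \<zero>\<^bsub>bar1 G\<^esub> g = \<zero>\<^bsub>\<N>\<^esub>"
  by (simp_all add: bar1_def vN.free_mod_add_eq vN.free_mod_smult_eq vN.free_mod_zero_eq)

lemma free_mod_smult_closed:
  assumes "r \<in> carrier \<N>" "c \<in> carrier (free_mod \<N> I)"
  shows "r \<odot>\<^bsub>free_mod \<N> I\<^esub> c \<in> carrier (free_mod \<N> I)"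
  unfolding vN.free_mod_smult_eq
proof (rule vN.free_modI)
  show "r \<otimes>\<^bsub>\<N>\<^esub> c i \<in> carrier \<N>" if "i \<in> I" for i
    using that assms by (intro vN_mult_closed vN.free_mod_closed[OF assms(2)])
  show "finite (free_supp \<N> I c)" using assms(2) by (rule vN.free_mod_finite_supp)
  fix i assume "i \<in> I" "i \<notin> free_supp \<N> I c"
  then have "c i = \<zero>\<^bsub>\<N>\<^esub>" by (rule vN.free_supp_zero)
  then show "r \<otimes>\<^bsub>\<N>\<^esub> c i = \<zero>\<^bsub>\<N>\<^esub>"
    using vN_zero[OF assms(1)] by (auto simp: vN_simps l2_zero)
qed

lemma bar1_smult_closed:
  "r \<in> carrier \<N> \<Longrightarrow> c \<in> carrier (bar1 G) \<Longrightarrow> r \<odot>\<^bsub>bar1 G\<^esub> c \<in> carrier (bar1 G)"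
  unfolding bar1_def by (rule free_mod_smult_closed)

lemma bar1_add_closed:
  "c \<in> carrier (bar1 G) \<Longrightarrow> d \<in> carrier (bar1 G) \<Longrightarrow> c \<oplus>\<^bsub>bar1 G\<^esub> d \<in> carrier (bar1 G)"
  unfolding bar1_def by (rule vN.free_mod_add_closed)

lemma abelian_group_bar1: "abelian_group (bar1 G)"
  unfolding bar1_def by (rule vN.abelian_group_free_mod)

lemma free_mod_uminus_smult:
  assumes c: "c \<in> carrier (free_mod \<N> I)"
  shows "\<ominus>\<^bsub>free_mod \<N> I\<^esub> c = vN_scalar (-1) \<odot>\<^bsub>free_mod \<N> I\<^esub> c"
  unfolding vN.free_mod_uminus_eq[OF c] vN.free_mod_smult_eq
  by (rule restrict_ext) (rule vN_uminus_eq[OF vN.free_mod_closed[OF c]])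

lemma pairing_superset:
  assumes c: "c \<in> carrier (bar1 G)" and \<beta>: "\<And>g. g \<in> carrier G \<Longrightarrow> \<beta> g \<in> l2 G"
    and S: "finite S" "free_supp \<N> (carrier G) c \<subseteq> S" "S \<subseteq> carrier G"
  shows "pairing c \<beta> x = (\<Sum>g\<in>S. c g (\<beta> g) x)"
  unfolding pairing_def
proof (rule sum.mono_neutral_left[OF S(1,2)], rule ballI)
  fix g assume "g \<in> S - free_supp \<N> (carrier G) c"
  then have g: "g \<in> carrier G" "c g = \<zero>\<^bsub>\<N>\<^esub>"
    using S(3) by (auto simp: free_supp_def)
  then show "c g (\<beta> g) x = 0" by (simp add: vN_zero_eval \<beta>)
qed

lemma finite_supp_bar1: "c \<in> carrier (bar1 G) \<Longrightarrow> finite (free_supp \<N> (carrier G) c)"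
  unfolding bar1_def by (rule vN.free_mod_finite_supp)

lemma finite_supp_bar2:
  "c \<in> carrier (bar2 G) \<Longrightarrow> finite (free_supp \<N> (carrier G \<times> carrier G) c)"
  unfolding bar2_def by (rule vN.free_mod_finite_supp)

lemma l2_if: "f \<in> l2 G \<Longrightarrow> (\<lambda>x. if P then f x else 0) \<in> l2 G"
  by (cases P) (auto simp: l2_zero)

lemma free_supp_subset: "free_supp R I c \<subseteq> I"
  by (auto simp: free_supp_def)

lemma pairing_add:
  assumes c: "c \<in> carrier (bar1 G)" and d: "d \<in> carrier (bar1 G)"
    and \<beta>: "\<And>g. g \<in> carrier G \<Longrightarrow> \<beta> g \<in> l2 G"
  shows "pairing (c \<oplus>\<^bsub>bar1 G\<^esub> d) \<beta> x = pairing c \<beta> x + pairing d \<beta> x"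
proof -
  let ?s = "free_supp \<N> (carrier G)"
  let ?S = "?s c \<union> ?s d \<union> ?s (c \<oplus>\<^bsub>bar1 G\<^esub> d)"
  have cd: "c \<oplus>\<^bsub>bar1 G\<^esub> d \<in> carrier (bar1 G)" by (rule bar1_add_closed[OF c d])
  have S: "finite ?S" "?S \<subseteq> carrier G"
    using finite_supp_bar1[OF c] finite_supp_bar1[OF d] finite_supp_bar1[OF cd]
    by (simp_all add: free_supp_subset)
  have "(c \<oplus>\<^bsub>bar1 G\<^esub> d) g (\<beta> g) x = c g (\<beta> g) x + d g (\<beta> g) x" if "g \<in> ?S" for g
    using that S(2) \<beta> by (subst bar1_simps(1)) (auto simp: vN_add_eval)
  then have "(\<Sum>g\<in>?S. (c \<oplus>\<^bsub>bar1 G\<^esub> d) g (\<beta> g) x) = (\<Sum>g\<in>?S. c g (\<beta> g) x) + (\<Sum>g\<in>?S. d g (\<beta> g) x)"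
    by (simp only: sum.distrib cong: sum.cong)
  moreover have "pairing c \<beta> x = (\<Sum>g\<in>?S. c g (\<beta> g) x)"
    by (rule pairing_superset[OF c \<beta> S(1) _ S(2)]) auto
  moreover have "pairing d \<beta> x = (\<Sum>g\<in>?S. d g (\<beta> g) x)"
    by (rule pairing_superset[OF d \<beta> S(1) _ S(2)]) auto
  moreover have "pairing (c \<oplus>\<^bsub>bar1 G\<^esub> d) \<beta> x = (\<Sum>g\<in>?S. (c \<oplus>\<^bsub>bar1 G\<^esub> d) g (\<beta> g) x)"
    by (rule pairing_superset[OF cd \<beta> S(1) _ S(2)]) auto
  ultimately show ?thesis by simp
qed

lemma pairing_smult:
  assumes r: "r \<in> carrier \<N>" and c: "c \<in> carrier (bar1 G)"
    and \<beta>: "\<And>g. g \<in> carrier G \<Longrightarrow> \<beta> g \<in> l2 G"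
  shows "pairing (r \<odot>\<^bsub>bar1 G\<^esub> c) \<beta> = r (pairing c \<beta>)"
proof -
  let ?s = "free_supp \<N> (carrier G)"
  let ?S = "?s c \<union> ?s (r \<odot>\<^bsub>bar1 G\<^esub> c)"
  have rc: "r \<odot>\<^bsub>bar1 G\<^esub> c \<in> carrier (bar1 G)" by (rule bar1_smult_closed[OF r c])
  have S: "finite ?S" "?S \<subseteq> carrier G"
    using finite_supp_bar1[OF c] finite_supp_bar1[OF rc] by (simp_all add: free_supp_subset)
  have \<beta>_S: "c g (\<beta> g) \<in> l2 G" if "g \<in> ?S" for g
    using that S(2) c \<beta> by (intro vN_closed[of "c g"] bar1_closed) auto
  have "(r \<odot>\<^bsub>bar1 G\<^esub> c) g (\<beta> g) x = r (c g (\<beta> g)) x" if "g \<in> ?S" for g x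
    using that S(2) \<beta> by (subst bar1_simps(2)) (auto simp: vN_mult_eval)
  then have "pairing (r \<odot>\<^bsub>bar1 G\<^esub> c) \<beta> = (\<lambda>x. \<Sum>g\<in>?S. r (c g (\<beta> g)) x)"
    using pairing_superset[OF rc \<beta> S(1) _ S(2)] by (intro ext) simp
  also have "\<dots> = r (\<lambda>x. \<Sum>g\<in>?S. c g (\<beta> g) x)" by (rule vN_sum[OF r \<beta>_S, symmetric])
  also have "(\<lambda>x. \<Sum>g\<in>?S. c g (\<beta> g) x) = pairing c \<beta>"
    using pairing_superset[OF c \<beta> S(1) _ S(2)] by (intro ext) simp
  finally show ?thesis .
qed

section \<open>The boundary maps evaluated at square summable functions\<close>

lemma bar_d1_closed:
  assumes c: "c \<in> carrier (bar1 G)"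
  shows "bar_d1 G c \<in> carrier \<N>"
  unfolding bar_d1_def Let_def
  by (intro vN.finsum_closed Pi_I vN.minus_closed vN_mult_closed bar1_closed[OF c] right_trans_closed)
    (auto simp: free_supp_def)

text \<open>The family \<open>right_trans G g f - f\<close>, indexed by \<open>g\<close>, is the
  inner cocycle of \<open>f\<close>; being a cycle means pairing to zero with all inner
  cocycles.\<close>

lemma bar_d1_eval:
  assumes c: "c \<in> carrier (bar1 G)" and f: "f \<in> l2 G"
  shows "bar_d1 G c f = pairing c (\<lambda>g x. right_trans G g f x - f x)"
proof -
  let ?S = "free_supp \<N> (carrier G) c"
  have closed: "c g \<in> carrier \<N>"
    "c g \<otimes>\<^bsub>\<N>\<^esub> right_trans G g \<in> carrier \<N>" if "g \<in> carrier G" for g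
    using that c by (auto intro: bar1_closed vN_mult_closed right_trans_closed)
  have "bar_d1 G c f = (\<lambda>x. \<Sum>g\<in>?S. (c g \<otimes>\<^bsub>\<N>\<^esub> right_trans G g \<ominus>\<^bsub>\<N>\<^esub> c g) f x)"
    unfolding bar_d1_def Let_def
    by (intro vN_finsum_eval finite_supp_bar1 c f vN.minus_closed closed) (auto simp: free_supp_def)
  moreover have "(c g \<otimes>\<^bsub>\<N>\<^esub> right_trans G g \<ominus>\<^bsub>\<N>\<^esub> c g) f x
      = c g (\<lambda>x. right_trans G g f x - f x) x" if "g \<in> ?S" for g x
  proof -
    have g: "g \<in> carrier G" using that by (simp add: free_supp_def)
    show ?thesis
      using vN_minus_eval[OF closed(2,1)[OF g] f] vN_diff[OF closed(1)[OF g] right_trans_l2[OF g f] f] f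
      by (simp add: vN_mult_eval)
  qed
  ultimately show ?thesis by (simp add: pairing_def)
qed

definition d2_term :: "('a \<times> 'a \<Rightarrow> 'a l2_op) \<Rightarrow> 'a \<times> 'a \<Rightarrow> 'a \<Rightarrow> 'a l2_op" where
  "d2_term c p = free_single \<N> (carrier G) (c p \<otimes>\<^bsub>\<N>\<^esub> right_trans G (fst p)) (snd p)
     \<ominus>\<^bsub>bar1 G\<^esub> free_single \<N> (carrier G) (c p) (fst p \<otimes> snd p)
     \<oplus>\<^bsub>bar1 G\<^esub> free_single \<N> (carrier G) (c p) (fst p)"

lemma d2_term_closed:
  assumes c: "c \<in> carrier (bar2 G)" and p: "p \<in> carrier G \<times> carrier G"
  shows "d2_term c p \<in> carrier (bar1 G)"
proof -
  interpret B: abelian_group "bar1 G" by (rule abelian_group_bar1)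
  have cp: "c p \<in> carrier \<N>" using bar2_closed[OF c] p by auto
  have s: "free_single \<N> (carrier G) r g \<in> carrier (bar1 G)"
    if "r \<in> carrier \<N>" for r g
    unfolding bar1_def by (rule vN.free_single_closed[OF that])
  show ?thesis
    unfolding d2_term_def using p
    by (intro B.a_closed B.minus_closed s cp vN_mult_closed right_trans_closed) auto
qed

text \<open>The three basis elements involved may coincide, hence a sum of three conditional terms
  instead of a case distinction.\<close>

lemma d2_term_eval:
  assumes c: "c \<in> carrier (bar2 G)" and p: "p \<in> carrier G \<times> carrier G"
    and k: "k \<in> carrier G" and f: "f \<in> l2 G"
  shows "d2_term c p k f x = (if k = snd p then c p (right_trans G (fst p) f) x else 0)
    - (if k = fst p \<otimes> snd p then c p f x else 0) + (if k = fst p then c p f x else 0)"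
proof -
  let ?s = "free_single \<N> (carrier G)"
  have cp: "c p \<in> carrier \<N>" using bar2_closed[OF c] p by auto
  have cr: "c p \<otimes>\<^bsub>\<N>\<^esub> right_trans G (fst p) \<in> carrier \<N>"
    using p by (intro vN_mult_closed cp right_trans_closed) auto
  have s: "?s r g \<in> carrier (bar1 G)" if "r \<in> carrier \<N>" for r g
    unfolding bar1_def by (rule vN.free_single_closed[OF that])
  have ev: "?s r g k f x = (if k = g then r f x else 0)" for r g
    using k f by (simp add: free_single_def vN_zero_eval)
  have sk: "?s r g k \<in> carrier \<N>" if "r \<in> carrier \<N>" for r g
    using bar1_closed[OF s[OF that] k] .
  have "d2_term c p k f x = (?s (c p \<otimes>\<^bsub>\<N>\<^esub> right_trans G (fst p)) (snd p)
     \<ominus>\<^bsub>bar1 G\<^esub> ?s (c p) (fst p \<otimes> snd p)) k f x + ?s (c p) (fst p) k f x"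
    unfolding d2_term_def using k f by (simp add: bar1_simps vN_add_eval)
  also have "(?s (c p \<otimes>\<^bsub>\<N>\<^esub> right_trans G (fst p)) (snd p)
     \<ominus>\<^bsub>bar1 G\<^esub> ?s (c p) (fst p \<otimes> snd p)) k
     = ?s (c p \<otimes>\<^bsub>\<N>\<^esub> right_trans G (fst p)) (snd p) k \<ominus>\<^bsub>\<N>\<^esub> ?s (c p) (fst p \<otimes> snd p) k"
    using vN.free_mod_minus_eq[OF s[OF cr, unfolded bar1_def] s[OF cp, unfolded bar1_def]] k
    by (simp add: bar1_def)
  finally show ?thesis
    using f by (simp add: vN_minus_eval[OF sk[OF cr] sk[OF cp] f] ev vN_mult_eval)
qed

lemma bar_d2_eq: "bar_d2 G c = (\<Oplus>\<^bsub>bar1 G\<^esub>p\<in>free_supp \<N> (carrier G \<times> carrier G) c. d2_term c p)"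
  by (simp add: bar_d2_def Let_def d2_term_def)

lemma bar_d2_closed:
  assumes "c \<in> carrier (bar2 G)"
  shows "bar_d2 G c \<in> carrier (bar1 G)"
proof -
  interpret B: abelian_group "bar1 G" by (rule abelian_group_bar1)
  show ?thesis
    unfolding bar_d2_eq
    by (intro B.finsum_closed Pi_I d2_term_closed[OF assms]) (auto simp: free_supp_def)
qed

text \<open>The index set may be larger than the support, so that values at \<open>c\<close>,
  \<open>d\<close> and their sum can be compared over one set.\<close>

lemma bar_d2_eval:
  assumes c: "c \<in> carrier (bar2 G)" and k: "k \<in> carrier G" and f: "f \<in> l2 G"
    and S: "finite S" "free_supp \<N> (carrier G \<times> carrier G) c \<subseteq> S" "S \<subseteq> carrier G \<times> carrier G"
  shows "bar_d2 G c k f x = (\<Sum>p\<in>S. (if k = snd p then c p (right_trans G (fst p) f) x else 0)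
    - (if k = fst p \<otimes> snd p then c p f x else 0) + (if k = fst p then c p f x else 0))"
    (is "_ = (\<Sum>p\<in>S. ?t p)")
proof -
  let ?S = "free_supp \<N> (carrier G \<times> carrier G) c"
  have S': "p \<in> carrier G \<times> carrier G" if "p \<in> ?S" for p using that by (simp add: free_supp_def)
  have fin: "finite ?S" by (rule finite_supp_bar2[OF c])
  have "bar_d2 G c k = (\<Oplus>\<^bsub>\<N>\<^esub>p\<in>?S. d2_term c p k)"
    unfolding bar_d2_eq bar1_def
    by (rule vN.free_mod_finsum[OF fin _ k]) (rule d2_term_closed[OF c S', unfolded bar1_def])
  moreover have "(\<Oplus>\<^bsub>\<N>\<^esub>p\<in>?S. d2_term c p k) f = (\<lambda>x. \<Sum>p\<in>?S. d2_term c p k f x)"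
    by (rule vN_finsum_eval[OF fin _ f]) (rule bar1_closed[OF d2_term_closed[OF c S'] k])
  ultimately have "bar_d2 G c k f x = (\<Sum>p\<in>?S. d2_term c p k f x)" by simp
  also have "\<dots> = (\<Sum>p\<in>?S. ?t p)"
    by (rule sum.cong[OF refl]) (rule d2_term_eval[OF c S' k f])
  also have "\<dots> = (\<Sum>p\<in>S. ?t p)"
  proof (rule sum.mono_neutral_left[OF S(1,2)], rule ballI)
    fix p assume p: "p \<in> S - ?S"
    then have pc: "p \<in> carrier G \<times> carrier G" and "c p = \<zero>\<^bsub>\<N>\<^esub>"
      using S(3) by (auto simp: free_supp_def)
    moreover have "right_trans G (fst p) f \<in> l2 G" using pc f by (auto intro: right_trans_l2)
    ultimately show "?t p = 0" using f by (simp add: vN_zero_eval)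
  qed
  finally show ?thesis .
qed

lemma bar_d2_add:
  assumes c: "c \<in> carrier (bar2 G)" and d: "d \<in> carrier (bar2 G)"
  shows "bar_d2 G (c \<oplus>\<^bsub>bar2 G\<^esub> d) = bar_d2 G c \<oplus>\<^bsub>bar1 G\<^esub> bar_d2 G d"
proof (rule bar1_ext)
  have cd: "c \<oplus>\<^bsub>bar2 G\<^esub> d \<in> carrier (bar2 G)"
    using c d unfolding bar2_def by (rule vN.free_mod_add_closed)
  show "bar_d2 G (c \<oplus>\<^bsub>bar2 G\<^esub> d) \<in> carrier (bar1 G)" by (rule bar_d2_closed[OF cd])
  show "bar_d2 G c \<oplus>\<^bsub>bar1 G\<^esub> bar_d2 G d \<in> carrier (bar1 G)"
    by (rule bar1_add_closed[OF bar_d2_closed[OF c] bar_d2_closed[OF d]])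
  fix k x :: 'a and f assume k: "k \<in> carrier G" and f: "f \<in> l2 G"
  let ?s = "free_supp \<N> (carrier G \<times> carrier G)"
  let ?S = "?s c \<union> ?s d \<union> ?s (c \<oplus>\<^bsub>bar2 G\<^esub> d)"
  have S: "finite ?S" "?S \<subseteq> carrier G \<times> carrier G"
    using finite_supp_bar2[OF c] finite_supp_bar2[OF d] finite_supp_bar2[OF cd]
    by (simp_all add: free_supp_subset)
  let ?t = "\<lambda>(c :: 'a \<times> 'a \<Rightarrow> 'a l2_op) p. (if k = snd p then c p (right_trans G (fst p) f) x else 0)
    - (if k = fst p \<otimes> snd p then c p f x else 0) + (if k = fst p then c p f x else 0)"
  have add: "(c \<oplus>\<^bsub>bar2 G\<^esub> d) p h x = c p h x + d p h x" if "p \<in> ?S" "h \<in> l2 G" for p h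
  proof -
    have "p \<in> carrier G \<times> carrier G" using that(1) S(2) by blast
    then show ?thesis using that(2) by (simp add: bar2_def vN.free_mod_add_eq vN_add_eval)
  qed
  have rt: "right_trans G (fst p) f \<in> l2 G" if "p \<in> ?S" for p
    using that S(2) f by (intro right_trans_l2) auto
  have sub: "?s c \<subseteq> ?S" "?s d \<subseteq> ?S" "?s (c \<oplus>\<^bsub>bar2 G\<^esub> d) \<subseteq> ?S" by auto
  have "bar_d2 G (c \<oplus>\<^bsub>bar2 G\<^esub> d) k f x = bar_d2 G c k f x + bar_d2 G d k f x"
    unfolding bar_d2_eval[OF c k f S(1) sub(1) S(2)] bar_d2_eval[OF d k f S(1) sub(2) S(2)]
      bar_d2_eval[OF cd k f S(1) sub(3) S(2)] sum.distrib[symmetric]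
  proof (rule sum.cong[OF refl])
    fix p assume p: "p \<in> ?S"
    show "?t (c \<oplus>\<^bsub>bar2 G\<^esub> d) p = ?t c p + ?t d p"
      unfolding add[OF p rt[OF p]] add[OF p f] by simp
  qed
  then show "bar_d2 G (c \<oplus>\<^bsub>bar2 G\<^esub> d) k f x = (bar_d2 G c \<oplus>\<^bsub>bar1 G\<^esub> bar_d2 G d) k f x"
    using k f by (simp add: bar1_simps vN_add_eval)
qed

lemma bar_d2_smult:
  assumes r: "r \<in> carrier \<N>" and c: "c \<in> carrier (bar2 G)"
  shows "bar_d2 G (r \<odot>\<^bsub>bar2 G\<^esub> c) = r \<odot>\<^bsub>bar1 G\<^esub> bar_d2 G c"
proof (rule bar1_ext)
  have rc: "r \<odot>\<^bsub>bar2 G\<^esub> c \<in> carrier (bar2 G)"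
    using r c unfolding bar2_def by (rule free_mod_smult_closed)
  show "bar_d2 G (r \<odot>\<^bsub>bar2 G\<^esub> c) \<in> carrier (bar1 G)" by (rule bar_d2_closed[OF rc])
  show "r \<odot>\<^bsub>bar1 G\<^esub> bar_d2 G c \<in> carrier (bar1 G)"
    by (rule bar1_smult_closed[OF r bar_d2_closed[OF c]])
  fix k x :: 'a and f assume k: "k \<in> carrier G" and f: "f \<in> l2 G"
  let ?s = "free_supp \<N> (carrier G \<times> carrier G)"
  let ?S = "?s c \<union> ?s (r \<odot>\<^bsub>bar2 G\<^esub> c)"
  let ?t = "\<lambda>p x. (if k = snd p then c p (right_trans G (fst p) f) x else 0)
    - (if k = fst p \<otimes> snd p then c p f x else 0) + (if k = fst p then c p f x else 0)"
  have S: "finite ?S" "?S \<subseteq> carrier G \<times> carrier G"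
    using finite_supp_bar2[OF c] finite_supp_bar2[OF rc] by (simp_all add: free_supp_subset)
  have rt: "right_trans G (fst p) f \<in> l2 G" if "p \<in> ?S" for p
    using that S(2) f by (intro right_trans_l2) auto
  have cl: "c p h \<in> l2 G" if "p \<in> ?S" "h \<in> l2 G" for p h
  proof -
    have "p \<in> carrier G \<times> carrier G" using that(1) S(2) by blast
    then show ?thesis using bar2_closed[OF c] that(2) by (auto intro: vN_closed)
  qed
  have sm: "(r \<odot>\<^bsub>bar2 G\<^esub> c) p h = r (c p h)" if "p \<in> ?S" "h \<in> l2 G" for p h
  proof -
    have "p \<in> carrier G \<times> carrier G" using that(1) S(2) by blast
    then show ?thesis using that(2) by (simp add: bar2_def vN.free_mod_smult_eq vN_mult_eval)
  qed
  let ?a = "\<lambda>p. \<lambda>x. if k = snd p then c p (right_trans G (fst p) f) x else 0"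
  let ?b = "\<lambda>p. \<lambda>x. if k = fst p \<otimes> snd p then c p f x else 0"
  let ?e = "\<lambda>p. \<lambda>x. if k = fst p then c p f x else 0"
  have l2: "?a p \<in> l2 G" "?b p \<in> l2 G" "?e p \<in> l2 G" if "p \<in> ?S" for p
    using cl[OF that rt[OF that]] cl[OF that f] by (simp_all add: l2_if)
  have t_l2: "?t p \<in> l2 G" if "p \<in> ?S" for p
    using l2[OF that] by (intro l2_add l2_diff)
  have rt_eval: "r (?t p) x = (if k = snd p then r (c p (right_trans G (fst p) f)) x else 0)
      - (if k = fst p \<otimes> snd p then r (c p f) x else 0) + (if k = fst p then r (c p f) x else 0)"
    if p: "p \<in> ?S" for p
    using vN_add[OF r l2_diff[OF l2(1,2)[OF p]] l2(3)[OF p]] vN_diff[OF r l2(1,2)[OF p]]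
    by (simp add: vN_zero[OF r])
  have "bar_d2 G (r \<odot>\<^bsub>bar2 G\<^esub> c) k f x = (\<Sum>p\<in>?S. r (?t p) x)"
    unfolding bar_d2_eval[OF rc k f S(1) Un_upper2 S(2)]
  proof (rule sum.cong[OF refl])
    fix p assume p: "p \<in> ?S"
    show "(if k = snd p then (r \<odot>\<^bsub>bar2 G\<^esub> c) p (right_trans G (fst p) f) x else 0)
      - (if k = fst p \<otimes> snd p then (r \<odot>\<^bsub>bar2 G\<^esub> c) p f x else 0)
      + (if k = fst p then (r \<odot>\<^bsub>bar2 G\<^esub> c) p f x else 0) = r (?t p) x"
      unfolding rt_eval[OF p] sm[OF p rt[OF p]] sm[OF p f] ..
  qed
  also have "\<dots> = r (\<lambda>x. \<Sum>p\<in>?S. ?t p x) x"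
    using vN_sum[OF r, of ?S ?t] t_l2 by simp
  also have "(\<lambda>x. \<Sum>p\<in>?S. ?t p x) = bar_d2 G c k f"
    by (rule ext) (rule bar_d2_eval[OF c k f S(1) Un_upper1 S(2), symmetric])
  finally show "bar_d2 G (r \<odot>\<^bsub>bar2 G\<^esub> c) k f x = (r \<odot>\<^bsub>bar1 G\<^esub> bar_d2 G c) k f x"
    using k f by (simp add: bar1_simps vN_mult_eval)
qed

text \<open>After the sums are interchanged, each basis element \<open>[g|h]\<close> with
  coefficient \<open>m\<close> contributes \<open>m\<close> applied to the translate of
  \<open>\<beta> h\<close> by \<open>g\<close>, minus \<open>\<beta> (g \<otimes> h)\<close>, plus
  \<open>\<beta> g\<close>. This is zero by the cocycle identity.\<close>

lemma pairing_bar_d2: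
  assumes c: "c \<in> carrier (bar2 G)" and \<beta>: "\<And>g. g \<in> carrier G \<Longrightarrow> \<beta> g \<in> l2 G"
    and cocycle: "\<And>g h. g \<in> carrier G \<Longrightarrow> h \<in> carrier G \<Longrightarrow>
      \<beta> (g \<otimes> h) = (\<lambda>x. right_trans G g (\<beta> h) x + \<beta> g x)"
  shows "pairing (bar_d2 G c) \<beta> x = 0"
proof -
  let ?S = "free_supp \<N> (carrier G \<times> carrier G) c"
  let ?K = "snd ` ?S \<union> (\<lambda>p. fst p \<otimes> snd p) ` ?S \<union> fst ` ?S"
  have fin: "finite ?S" by (rule finite_supp_bar2[OF c])
  have S: "?S \<subseteq> carrier G \<times> carrier G" by (rule free_supp_subset)
  have K: "finite ?K" "?K \<subseteq> carrier G" using fin S by auto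
  have ev: "bar_d2 G c k f x = (\<Sum>p\<in>?S. (if k = snd p then c p (right_trans G (fst p) f) x else 0)
    - (if k = fst p \<otimes> snd p then c p f x else 0) + (if k = fst p then c p f x else 0))"
    if "k \<in> carrier G" "f \<in> l2 G" for k f x
    using bar_d2_eval[OF c that fin order.refl S] .
  have supp: "free_supp \<N> (carrier G) (bar_d2 G c) \<subseteq> ?K"
  proof (rule subsetI, rule ccontr)
    fix k assume k: "k \<in> free_supp \<N> (carrier G) (bar_d2 G c)" and nk: "k \<notin> ?K"
    have kc: "k \<in> carrier G" using k by (simp add: free_supp_def)
    have ne: "k \<noteq> snd p \<and> k \<noteq> fst p \<otimes> snd p \<and> k \<noteq> fst p" if "p \<in> ?S" for p using that nk by blast
    have "bar_d2 G c k = \<zero>\<^bsub>\<N>\<^esub>"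
    proof (rule vN_ext[OF bar1_closed[OF bar_d2_closed[OF c] kc] vN_zero_closed])
      fix f x assume f: "f \<in> l2 G"
      show "bar_d2 G c k f x = \<zero>\<^bsub>\<N>\<^esub> f x"
        unfolding ev[OF kc f] vN_zero_eval[OF f] using ne by (intro sum.neutral) auto
    qed
    then show False using k by (simp add: free_supp_def)
  qed
  have "pairing (bar_d2 G c) \<beta> x = (\<Sum>k\<in>?K. bar_d2 G c k (\<beta> k) x)"
    by (rule pairing_superset[OF bar_d2_closed[OF c] \<beta> K(1) supp K(2)])
  also have "\<dots> = (\<Sum>k\<in>?K. \<Sum>p\<in>?S. (if k = snd p then c p (right_trans G (fst p) (\<beta> k)) x else 0)
    - (if k = fst p \<otimes> snd p then c p (\<beta> k) x else 0) + (if k = fst p then c p (\<beta> k) x else 0))"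
    using K(2) \<beta> by (intro sum.cong refl ev) auto
  also have "\<dots> = (\<Sum>p\<in>?S. \<Sum>k\<in>?K. (if k = snd p then c p (right_trans G (fst p) (\<beta> k)) x else 0)
    - (if k = fst p \<otimes> snd p then c p (\<beta> k) x else 0) + (if k = fst p then c p (\<beta> k) x else 0))"
    by (rule sum.swap)
  also have "\<dots> = (\<Sum>p\<in>?S. 0)"
  proof (rule sum.cong[OF refl])
    fix p assume p: "p \<in> ?S"
    then have gh: "fst p \<in> carrier G" "snd p \<in> carrier G" using S by auto
    have cp: "c p \<in> carrier \<N>" using bar2_closed[OF c gh] by simp
    have inK: "snd p \<in> ?K" "fst p \<otimes> snd p \<in> ?K" "fst p \<in> ?K" using p by blast+
    have "(\<Sum>k\<in>?K. (if k = snd p then c p (right_trans G (fst p) (\<beta> k)) x else 0)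
        - (if k = fst p \<otimes> snd p then c p (\<beta> k) x else 0) + (if k = fst p then c p (\<beta> k) x else 0))
      = c p (right_trans G (fst p) (\<beta> (snd p))) x - c p (\<beta> (fst p \<otimes> snd p)) x + c p (\<beta> (fst p)) x"
      using K(1) inK by (simp only: sum.distrib sum_subtractf sum.delta if_True)
    also have "\<dots> = 0"
      using vN_add[OF cp right_trans_l2[OF gh(1) \<beta>[OF gh(2)]] \<beta>[OF gh(1)]] cocycle[OF gh] by simp
    finally show "(\<Sum>k\<in>?K. (if k = snd p then c p (right_trans G (fst p) (\<beta> k)) x else 0)
        - (if k = fst p \<otimes> snd p then c p (\<beta> k) x else 0) + (if k = fst p then c p (\<beta> k) x else 0)) = 0" .
  qed
  finally show ?thesis by simp
qed

lemma bar_d1_zero_iff: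
  assumes "c \<in> carrier (bar1 G)"
  shows "bar_d1 G c = \<zero>\<^bsub>\<N>\<^esub> \<longleftrightarrow>
    (\<forall>f\<in>l2 G. pairing c (\<lambda>g x. right_trans G g f x - f x) = (\<lambda>x. 0))"
proof
  assume "bar_d1 G c = \<zero>\<^bsub>\<N>\<^esub>"
  then show "\<forall>f\<in>l2 G. pairing c (\<lambda>g x. right_trans G g f x - f x) = (\<lambda>x. 0)"
    by (simp add: vN_zero_eval flip: bar_d1_eval[OF assms])
next
  assume *: "\<forall>f\<in>l2 G. pairing c (\<lambda>g x. right_trans G g f x - f x) = (\<lambda>x. 0)"
  show "bar_d1 G c = \<zero>\<^bsub>\<N>\<^esub>"
  proof (rule vN_ext[OF bar_d1_closed[OF assms] vN_zero_closed])
    fix f x assume f: "f \<in> l2 G"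
    show "bar_d1 G c f x = \<zero>\<^bsub>\<N>\<^esub> f x"
      using * f by (simp add: bar_d1_eval[OF assms f] vN_zero_eval)
  qed
qed

text \<open>Inner cocycles satisfy the cocycle identity, so boundaries pair to zero with
  them.\<close>

lemma bar_d1_d2:
  assumes "c \<in> carrier (bar2 G)"
  shows "bar_d1 G (bar_d2 G c) = \<zero>\<^bsub>\<N>\<^esub>"
  unfolding bar_d1_zero_iff[OF bar_d2_closed[OF assms]]
proof (intro ballI ext)
  fix f x assume f: "f \<in> l2 G"
  show "pairing (bar_d2 G c) (\<lambda>g x. right_trans G g f x - f x) x = 0"
  proof (rule pairing_bar_d2[OF assms])
    show l2: "(\<lambda>x. right_trans G g f x - f x) \<in> l2 G" if "g \<in> carrier G" for g
      using that f by (intro l2_diff right_trans_l2)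
    fix g h assume gh: "g \<in> carrier G" "h \<in> carrier G"
    show "(\<lambda>x. right_trans G (g \<otimes> h) f x - f x)
      = (\<lambda>x. right_trans G g (\<lambda>x. right_trans G h f x - f x) x + (right_trans G g f x - f x))"
      using gh f l2[OF gh(2)] by (intro ext) (simp add: right_trans_apply m_assoc)
  qed
qed

end

section \<open>Projective submodules of the first homology\<close>

context group
begin

interpretation vN: abelian_group "\<N>"
  by (rule abelian_group_vN)

definition cycles :: "('a \<Rightarrow> 'a l2_op) set" where
  "cycles = {c \<in> carrier (bar1 G). bar_d1 G c = \<zero>\<^bsub>\<N>\<^esub>}"

definition boundaries :: "('a \<Rightarrow> 'a l2_op) set" where
  "boundaries = bar_d2 G ` carrier (bar2 G)"

lemma vN_scalar_bar1_inverse: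
  "c \<in> carrier (bar1 G) \<Longrightarrow> inv\<^bsub>add_monoid (bar1 G)\<^esub> c = vN_scalar (-1) \<odot>\<^bsub>bar1 G\<^esub> c"
  using free_mod_uminus_smult[of c "carrier G"] by (simp add: bar1_def a_inv_def)

lemma subgroup_bar1I:
  assumes "V \<subseteq> carrier (bar1 G)" "V \<noteq> {}"
    and "\<And>c d. c \<in> V \<Longrightarrow> d \<in> V \<Longrightarrow> c \<oplus>\<^bsub>bar1 G\<^esub> d \<in> V"
    and "\<And>r c. r \<in> carrier \<N> \<Longrightarrow> c \<in> V \<Longrightarrow> r \<odot>\<^bsub>bar1 G\<^esub> c \<in> V"
  shows "subgroup V (add_monoid (bar1 G))"
proof (rule group.subgroupI)
  show "group (add_monoid (bar1 G))"
    using abelian_group.a_group[OF abelian_group_bar1] .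
  show "inv\<^bsub>add_monoid (bar1 G)\<^esub> c \<in> V" if "c \<in> V" for c
    using that assms(1) by (subst vN_scalar_bar1_inverse) (auto intro: assms(4) vN_scalar_closed)
qed (use assms in auto)

lemma cycles_smult:
  assumes r: "r \<in> carrier \<N>" and c: "c \<in> cycles"
  shows "r \<odot>\<^bsub>bar1 G\<^esub> c \<in> cycles"
proof -
  have c1: "c \<in> carrier (bar1 G)" using c by (simp add: cycles_def)
  have "pairing (r \<odot>\<^bsub>bar1 G\<^esub> c) (\<lambda>g x. right_trans G g f x - f x) = (\<lambda>x. 0)" if f: "f \<in> l2 G" for f
  proof -
    have "(\<lambda>x. right_trans G g f x - f x) \<in> l2 G" if "g \<in> carrier G" for g
      using that f by (intro l2_diff right_trans_l2)
    then have "pairing (r \<odot>\<^bsub>bar1 G\<^esub> c) (\<lambda>g x. right_trans G g f x - f x)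
        = r (pairing c (\<lambda>g x. right_trans G g f x - f x))"
      by (rule pairing_smult[OF r c1])
    also have "pairing c (\<lambda>g x. right_trans G g f x - f x) = (\<lambda>x. 0)"
      using c f bar_d1_zero_iff[OF c1] by (auto simp: cycles_def)
    finally show ?thesis by (simp add: vN_zero[OF r])
  qed
  then show ?thesis
    using bar_d1_zero_iff[OF bar1_smult_closed[OF r c1]] bar1_smult_closed[OF r c1]
    by (simp add: cycles_def)
qed

lemma cycles_add:
  assumes c: "c \<in> cycles" and d: "d \<in> cycles"
  shows "c \<oplus>\<^bsub>bar1 G\<^esub> d \<in> cycles"
proof -
  have cd1: "c \<in> carrier (bar1 G)" "d \<in> carrier (bar1 G)" using c d by (simp_all add: cycles_def)
  have "pairing (c \<oplus>\<^bsub>bar1 G\<^esub> d) (\<lambda>g x. right_trans G g f x - f x) = (\<lambda>x. 0)" if f: "f \<in> l2 G" for f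
  proof
    fix x
    have l2: "(\<lambda>x. right_trans G g f x - f x) \<in> l2 G" if "g \<in> carrier G" for g
      using that f by (intro l2_diff right_trans_l2)
    have "pairing c (\<lambda>g x. right_trans G g f x - f x) = (\<lambda>x. 0)"
      "pairing d (\<lambda>g x. right_trans G g f x - f x) = (\<lambda>x. 0)"
      using c d f bar_d1_zero_iff[OF cd1(1)] bar_d1_zero_iff[OF cd1(2)] by (auto simp: cycles_def)
    then show "pairing (c \<oplus>\<^bsub>bar1 G\<^esub> d) (\<lambda>g x. right_trans G g f x - f x) x = 0"
      using pairing_add[where \<beta> = "\<lambda>g x. right_trans G g f x - f x" and x = x, OF cd1 l2] by simp
  qed
  then show ?thesis
    using bar_d1_zero_iff[OF bar1_add_closed[OF cd1]] bar1_add_closed[OF cd1]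
    by (simp add: cycles_def)
qed

lemma boundaries_subset_cycles: "boundaries \<subseteq> cycles"
  by (auto simp: boundaries_def cycles_def bar_d2_closed bar_d1_d2)

lemma boundaries_smult:
  assumes "r \<in> carrier \<N>" "b \<in> boundaries"
  shows "r \<odot>\<^bsub>bar1 G\<^esub> b \<in> boundaries"
proof -
  obtain c where c: "c \<in> carrier (bar2 G)" "b = bar_d2 G c" using assms(2) by (auto simp: boundaries_def)
  have "r \<odot>\<^bsub>bar2 G\<^esub> c \<in> carrier (bar2 G)"
    using assms(1) c(1) unfolding bar2_def by (rule free_mod_smult_closed)
  then show ?thesis
    using bar_d2_smult[OF assms(1) c(1)] c(2) unfolding boundaries_def by (metis image_eqI)
qed

lemma subgroup_cycles: "subgroup cycles (add_monoid (bar1 G))"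
proof (rule subgroup_bar1I)
  have "bar_d2 G \<zero>\<^bsub>bar2 G\<^esub> \<in> boundaries"
    unfolding boundaries_def bar2_def by (intro imageI vN.free_mod_zero_closed)
  then show "cycles \<noteq> {}" using boundaries_subset_cycles by auto
qed (auto simp: cycles_add cycles_smult, simp add: cycles_def)

lemma subgroup_boundaries: "subgroup boundaries (add_monoid (bar1 G))"
proof (rule subgroup_bar1I)
  show "boundaries \<subseteq> carrier (bar1 G)" by (auto simp: boundaries_def bar_d2_closed)
  show "boundaries \<noteq> {}"
    using vN.free_mod_zero_closed[of "carrier G \<times> carrier G"] by (auto simp: boundaries_def bar2_def)
  show "c \<oplus>\<^bsub>bar1 G\<^esub> d \<in> boundaries" if "c \<in> boundaries" "d \<in> boundaries" for c d
  proof -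
    obtain a b where ab: "a \<in> carrier (bar2 G)" "c = bar_d2 G a" "b \<in> carrier (bar2 G)" "d = bar_d2 G b"
      using \<open>c \<in> boundaries\<close> \<open>d \<in> boundaries\<close> by (auto simp: boundaries_def)
    have "a \<oplus>\<^bsub>bar2 G\<^esub> b \<in> carrier (bar2 G)"
      using ab(1,3) unfolding bar2_def by (rule vN.free_mod_add_closed)
    then show ?thesis
      using bar_d2_add[OF ab(1,3)] ab(2,4) unfolding boundaries_def by (metis image_eqI)
  qed
qed (rule boundaries_smult)

section \<open>The first homology as a factor group\<close>

definition "cycle_group = (add_monoid (bar1 G))\<lparr>carrier := cycles\<rparr>"

lemma cycle_group_simps:
  "carrier cycle_group = cycles" "c \<otimes>\<^bsub>cycle_group\<^esub> d = c \<oplus>\<^bsub>bar1 G\<^esub> d"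
  by (simp_all add: cycle_group_def)

lemma group_cycle_group: "group cycle_group"
  unfolding cycle_group_def
  using subgroup.subgroup_is_group[OF subgroup_cycles abelian_group.a_group[OF abelian_group_bar1]] .

lemma comm_group_cycle_group: "comm_group cycle_group"
proof (rule group.group_comm_groupI[OF group_cycle_group])
  fix c d assume "c \<in> carrier cycle_group" "d \<in> carrier cycle_group"
  then show "c \<otimes>\<^bsub>cycle_group\<^esub> d = d \<otimes>\<^bsub>cycle_group\<^esub> c"
    using abelian_monoid.a_comm[OF abelian_group.axioms(1)[OF abelian_group_bar1]]
    by (auto simp: cycle_group_simps cycles_def)
qed

lemma subgroup_cycle_groupI:
  "subgroup V (add_monoid (bar1 G)) \<Longrightarrow> V \<subseteq> cycles \<Longrightarrow> subgroup V cycle_group"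
  unfolding cycle_group_def
  by (rule group.subgroup_incl[OF abelian_group.a_group[OF abelian_group_bar1] _ subgroup_cycles])

lemma normal_boundaries: "boundaries \<lhd> cycle_group"
  by (rule comm_group.subgroup_imp_normal[OF comm_group_cycle_group
        subgroup_cycle_groupI[OF subgroup_boundaries boundaries_subset_cycles]])

text \<open>Up to unfolding, the additive group of \<open>H1_vN G\<close> is the factor group of
  \<open>cycle_group\<close>; this makes the results on normal subgroups and cosets
  available.\<close>

lemma H1_simps:
  "carrier (H1_vN G) = carrier (cycle_group Mod boundaries)"
  "X \<oplus>\<^bsub>H1_vN G\<^esub> Y = X \<otimes>\<^bsub>cycle_group Mod boundaries\<^esub> Y"
  "\<zero>\<^bsub>H1_vN G\<^esub> = \<one>\<^bsub>cycle_group Mod boundaries\<^esub>"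
  by (simp_all add: H1_vN_def quot_mod_def FactGroup_def cycle_group_def A_RCOSETS_def set_add_def
      cycles_def boundaries_def)

lemma group_H1: "group (add_monoid (H1_vN G))"
proof -
  interpret Q: group "cycle_group Mod boundaries"
    by (rule normal.factorgroup_is_group[OF normal_boundaries])
  show ?thesis
  proof (rule groupI)
    fix X assume "X \<in> carrier (add_monoid (H1_vN G))"
    then have X: "X \<in> carrier (cycle_group Mod boundaries)" by (simp add: H1_simps)
    show "\<exists>Y\<in>carrier (add_monoid (H1_vN G)). Y \<otimes>\<^bsub>add_monoid (H1_vN G)\<^esub> X = \<one>\<^bsub>add_monoid (H1_vN G)\<^esub>"
      using Q.l_inv_ex[OF X] by (simp only: H1_simps monoid.simps partial_object.simps)
  qed (simp_all add: H1_simps Q.m_assoc del: mult_FactGroup one_FactGroup)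
qed

lemma smult_H1:
  "r \<odot>\<^bsub>H1_vN G\<^esub> X = (\<Union>x\<in>X. boundaries #>\<^bsub>cycle_group\<^esub> (r \<odot>\<^bsub>bar1 G\<^esub> x))"
  by (simp add: H1_vN_def quot_mod_def cycle_group_def a_r_coset_def cycles_def boundaries_def)

definition homology_class :: "('a \<Rightarrow> 'a l2_op) \<Rightarrow> ('a \<Rightarrow> 'a l2_op) set" where
  "homology_class z = boundaries #>\<^bsub>cycle_group\<^esub> z"

lemma homology_class_add:
  assumes "y \<in> cycles" "z \<in> cycles"
  shows "homology_class y \<oplus>\<^bsub>H1_vN G\<^esub> homology_class z = homology_class (y \<oplus>\<^bsub>bar1 G\<^esub> z)"
  using normal.rcos_sum[OF normal_boundaries] assms
  by (simp add: H1_simps FactGroup_def homology_class_def cycle_group_simps)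

text \<open>The product is defined as a union over all representatives. Since
  \<open>boundaries\<close> is closed under scalars, every representative contributes the same
  coset, and \<open>z\<close> itself shows that there is one.\<close>

lemma homology_class_smult:
  assumes r: "r \<in> carrier \<N>" and z: "z \<in> cycles"
  shows "r \<odot>\<^bsub>H1_vN G\<^esub> homology_class z = homology_class (r \<odot>\<^bsub>bar1 G\<^esub> z)"
proof -
  interpret C: comm_group cycle_group by (rule comm_group_cycle_group)
  have sub: "subgroup boundaries cycle_group"
    by (rule subgroup_cycle_groupI[OF subgroup_boundaries boundaries_subset_cycles])
  have self: "z \<in> homology_class z"
    unfolding homology_class_def
    using C.rcos_self[OF _ sub, of z] z by (simp add: cycle_group_simps)
  have "boundaries #>\<^bsub>cycle_group\<^esub> (r \<odot>\<^bsub>bar1 G\<^esub> x) = homology_class (r \<odot>\<^bsub>bar1 G\<^esub> z)"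
    if x: "x \<in> homology_class z" for x
  proof -
    obtain b where b: "b \<in> boundaries" "x = b \<oplus>\<^bsub>bar1 G\<^esub> z"
      using x by (auto simp: homology_class_def r_coset_def cycle_group_simps)
    have b1: "b \<in> carrier (bar1 G)" "z \<in> carrier (bar1 G)"
      using b z boundaries_subset_cycles by (auto simp: cycles_def)
    have "r \<odot>\<^bsub>bar1 G\<^esub> x = r \<odot>\<^bsub>bar1 G\<^esub> b \<oplus>\<^bsub>bar1 G\<^esub> r \<odot>\<^bsub>bar1 G\<^esub> z"
    proof (rule bar1_ext)
      fix g f y assume gf: "g \<in> carrier G" "f \<in> l2 G"
      have l2: "b g f \<in> l2 G" "z g f \<in> l2 G"
        using vN_closed[OF bar1_closed[OF b1(1) gf(1)] gf(2)]
          vN_closed[OF bar1_closed[OF b1(2) gf(1)] gf(2)] by simp_all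
      show "(r \<odot>\<^bsub>bar1 G\<^esub> x) g f y = (r \<odot>\<^bsub>bar1 G\<^esub> b \<oplus>\<^bsub>bar1 G\<^esub> r \<odot>\<^bsub>bar1 G\<^esub> z) g f y"
        using gf vN_add[OF r l2] by (simp add: b(2) bar1_simps vN_mult_eval vN_add_eval)
    next
      show "r \<odot>\<^bsub>bar1 G\<^esub> x \<in> carrier (bar1 G)"
        unfolding b(2) by (intro bar1_smult_closed bar1_add_closed r b1)
      show "r \<odot>\<^bsub>bar1 G\<^esub> b \<oplus>\<^bsub>bar1 G\<^esub> r \<odot>\<^bsub>bar1 G\<^esub> z \<in> carrier (bar1 G)"
        by (intro bar1_smult_closed bar1_add_closed r b1)
    qed
    then have "r \<odot>\<^bsub>bar1 G\<^esub> x \<in> boundaries #>\<^bsub>cycle_group\<^esub> (r \<odot>\<^bsub>bar1 G\<^esub> z)"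
      using boundaries_smult[OF r b(1)] by (auto simp: r_coset_def cycle_group_simps)
    then have "boundaries #>\<^bsub>cycle_group\<^esub> (r \<odot>\<^bsub>bar1 G\<^esub> z)
        = boundaries #>\<^bsub>cycle_group\<^esub> (r \<odot>\<^bsub>bar1 G\<^esub> x)"
      by (rule C.repr_independence[OF _ _ sub]) (simp add: cycle_group_simps(1) cycles_smult r z)
    then show ?thesis by (simp add: homology_class_def)
  qed
  then have "(\<Union>x\<in>homology_class z. boundaries #>\<^bsub>cycle_group\<^esub> (r \<odot>\<^bsub>bar1 G\<^esub> x))
      = homology_class (r \<odot>\<^bsub>bar1 G\<^esub> z)" using self by blast
  then show ?thesis by (simp only: smult_H1)
qed

text \<open>One finitely generated projective submodule of positive dimension bounds the supremum
  away from zero. It is the image of \<open>V\<close> under \<iota> followed by passage to homology;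
  this map is injective as only zero is sent to a boundary.\<close>

lemma first_L2_betti_neq_0I:
  fixes n A \<iota>
  defines "V \<equiv> carrier (row_image \<N> n A)"
  assumes A: "idempotent_matrix \<N> n A"
    and V_add: "\<And>c d. c \<in> V \<Longrightarrow> d \<in> V \<Longrightarrow> c \<oplus>\<^bsub>free_mod \<N> {..<n}\<^esub> d \<in> V"
    and V_smult: "\<And>r c. r \<in> carrier \<N> \<Longrightarrow> c \<in> V \<Longrightarrow>
      r \<odot>\<^bsub>free_mod \<N> {..<n}\<^esub> c \<in> V"
    and V_sub: "V \<subseteq> carrier (free_mod \<N> {..<n})"
    and \<iota>: "\<And>c. c \<in> V \<Longrightarrow> \<iota> c \<in> cycles"
    and \<iota>_add: "\<And>c d. c \<in> V \<Longrightarrow> d \<in> V \<Longrightarrow>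
      \<iota> (c \<oplus>\<^bsub>free_mod \<N> {..<n}\<^esub> d) = \<iota> c \<oplus>\<^bsub>bar1 G\<^esub> \<iota> d"
    and \<iota>_smult: "\<And>r c. r \<in> carrier \<N> \<Longrightarrow> c \<in> V \<Longrightarrow>
      \<iota> (r \<odot>\<^bsub>free_mod \<N> {..<n}\<^esub> c) = r \<odot>\<^bsub>bar1 G\<^esub> \<iota> c"
    and \<iota>_inj: "\<And>c. c \<in> V \<Longrightarrow> \<iota> c \<in> boundaries \<Longrightarrow> c = \<zero>\<^bsub>free_mod \<N> {..<n}\<^esub>"
    and tr: "Re (\<Sum>i<n. vN_trace G (A i i)) > 0"
  shows "first_L2_betti G \<noteq> 0"
proof -
  let ?F = "free_mod \<N> {..<n}"
  let ?M = "row_image \<N> n A"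
  interpret F: abelian_group ?F by (rule vN.abelian_group_free_mod)
  interpret C: comm_group cycle_group by (rule comm_group_cycle_group)
  have sub: "subgroup boundaries cycle_group"
    by (rule subgroup_cycle_groupI[OF subgroup_boundaries boundaries_subset_cycles])
  define \<Psi> where "\<Psi> c = homology_class (\<iota> c)" for c
  define P where "P = \<Psi> ` V"
  have M_simps: "c \<oplus>\<^bsub>?M\<^esub> d = c \<oplus>\<^bsub>?F\<^esub> d" "r \<odot>\<^bsub>?M\<^esub> c = r \<odot>\<^bsub>?F\<^esub> c" for r c d
    by (simp_all add: row_image_def)
  have "V \<noteq> {}" unfolding V_def row_image_def using vN.free_mod_zero_closed[of "{..<n}"] by auto
  have \<Psi>_add: "\<Psi> (c \<oplus>\<^bsub>?F\<^esub> d) = \<Psi> c \<oplus>\<^bsub>H1_vN G\<^esub> \<Psi> d" if "c \<in> V" "d \<in> V" for c d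
    using that by (simp add: \<Psi>_def \<iota>_add homology_class_add \<iota>)
  have \<Psi>_smult: "\<Psi> (r \<odot>\<^bsub>?F\<^esub> c) = r \<odot>\<^bsub>H1_vN G\<^esub> \<Psi> c" if "r \<in> carrier \<N>" "c \<in> V" for r c
    using that by (simp add: \<Psi>_def \<iota>_smult homology_class_smult \<iota>)
  have inj: "inj_on \<Psi> V"
  proof (rule inj_onI)
    fix c d assume cd: "c \<in> V" "d \<in> V" "\<Psi> c = \<Psi> d"
    let ?d = "vN_scalar (-1) \<odot>\<^bsub>?F\<^esub> d"
    have d: "?d \<in> V" by (rule V_smult[OF vN_scalar_closed cd(2)])
    have \<iota>d: "\<iota> ?d = inv\<^bsub>cycle_group\<^esub> (\<iota> d)"
    proof -
      have "inv\<^bsub>cycle_group\<^esub> (\<iota> d) = inv\<^bsub>add_monoid (bar1 G)\<^esub> (\<iota> d)"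
        unfolding cycle_group_def
        using \<iota>[OF cd(2)] abelian_group.a_group[OF abelian_group_bar1] subgroup_cycles
        by (intro group.m_inv_consistent) auto
      also have "\<dots> = vN_scalar (-1) \<odot>\<^bsub>bar1 G\<^esub> \<iota> d"
        using \<iota>[OF cd(2)] by (intro vN_scalar_bar1_inverse) (simp add: cycles_def)
      finally show ?thesis using \<iota>_smult[OF vN_scalar_closed cd(2)] by simp
    qed
    have "\<iota> c \<in> boundaries #>\<^bsub>cycle_group\<^esub> \<iota> d"
      using cd(3) C.rcos_self[OF _ sub, of "\<iota> c"] \<iota>[OF cd(1)]
      by (simp add: \<Psi>_def homology_class_def cycle_group_simps)
    then obtain b where b: "b \<in> boundaries" "\<iota> c = b \<otimes>\<^bsub>cycle_group\<^esub> \<iota> d"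
      by (auto simp: r_coset_def)
    have "\<iota> (c \<oplus>\<^bsub>?F\<^esub> ?d) = \<iota> c \<otimes>\<^bsub>cycle_group\<^esub> inv\<^bsub>cycle_group\<^esub> (\<iota> d)"
      using \<iota>_add[OF cd(1) d] \<iota>d by (simp add: cycle_group_simps)
    also have "\<dots> = b"
    proof -
      have "b \<in> carrier cycle_group" "\<iota> d \<in> carrier cycle_group"
        using b(1) \<iota>[OF cd(2)] boundaries_subset_cycles by (auto simp: cycle_group_simps(1))
      then show ?thesis by (simp add: b(2) C.m_assoc)
    qed
    finally have "\<iota> (c \<oplus>\<^bsub>?F\<^esub> ?d) \<in> boundaries" using b(1) by simp
    then have 0: "c \<oplus>\<^bsub>?F\<^esub> ?d = \<zero>\<^bsub>?F\<^esub>" by (rule \<iota>_inj[OF V_add[OF cd(1) d]])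
    have dF: "d \<in> carrier ?F" "c \<in> carrier ?F" using cd V_sub by auto
    have "c \<oplus>\<^bsub>?F\<^esub> \<ominus>\<^bsub>?F\<^esub> d = \<zero>\<^bsub>?F\<^esub>"
      using 0 by (simp only: free_mod_uminus_smult[OF dF(1)])
    from F.minus_equality[OF this] show "c = d" using dF by simp
  qed
  have sub_\<iota>: "subgroup (\<iota> ` V) cycle_group"
  proof (rule subgroup_cycle_groupI[OF subgroup_bar1I])
    show "\<iota> ` V \<subseteq> carrier (bar1 G)" "\<iota> ` V \<subseteq> cycles" using \<iota> by (auto simp: cycles_def)
    show "c \<oplus>\<^bsub>bar1 G\<^esub> d \<in> \<iota> ` V" if "c \<in> \<iota> ` V" "d \<in> \<iota> ` V" for c d
      using that V_add by (auto simp flip: \<iota>_add)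
    show "r \<odot>\<^bsub>bar1 G\<^esub> c \<in> \<iota> ` V" if "r \<in> carrier \<N>" "c \<in> \<iota> ` V" for r c
      using that V_smult by (auto simp flip: \<iota>_smult)
  qed (use \<open>V \<noteq> {}\<close> in auto)
  have "homology_class \<in> hom cycle_group (add_monoid (H1_vN G))"
    using normal.r_coset_hom_Mod[OF normal_boundaries]
    by (simp add: hom_def H1_simps homology_class_def Pi_def)
  then have "group_hom cycle_group (add_monoid (H1_vN G)) homology_class"
    by (simp add: group_hom_def group_hom_axioms_def group_cycle_group group_H1)
  from group_hom.subgroup_img_is_subgroup[OF this sub_\<iota>]
  have "subgroup P (add_monoid (H1_vN G))" by (simp add: P_def \<Psi>_def image_image)
  moreover have "r \<odot>\<^bsub>H1_vN G\<^esub> X \<in> P" if "r \<in> carrier \<N>" "X \<in> P" for r X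
    using that V_smult by (auto simp: P_def simp flip: \<Psi>_smult)
  ultimately have submod: "submodule P \<N> (H1_vN G)"
    by (simp add: submodule_def submodule_axioms_def)
  \<comment> \<open>The dimension predicate asks for an isomorphism from the submodule onto the row
    image, hence the inverse map.\<close>
  have "inv_into V \<Psi> \<in> module_isos \<N> ((H1_vN G)\<lparr>carrier := P\<rparr>) ?M"
  proof -
    have "bij_betw (inv_into V \<Psi>) P (carrier ?M)"
      using inj unfolding P_def V_def by (intro bij_betw_inv_into inj_on_imp_bij_betw)
    moreover have "inv_into V \<Psi> (X \<oplus>\<^bsub>H1_vN G\<^esub> Y) = inv_into V \<Psi> X \<oplus>\<^bsub>?F\<^esub> inv_into V \<Psi> Y"
      if "X \<in> P" "Y \<in> P" for X Y
      using that inj V_add by (auto simp: P_def inv_into_f_f simp flip: \<Psi>_add)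
    moreover have "inv_into V \<Psi> (r \<odot>\<^bsub>H1_vN G\<^esub> X) = r \<odot>\<^bsub>?F\<^esub> inv_into V \<Psi> X"
      if "r \<in> carrier \<N>" "X \<in> P" for r X
      using that inj V_smult by (auto simp: P_def inv_into_f_f simp flip: \<Psi>_smult)
    ultimately show ?thesis by (simp add: module_isos_def M_simps)
  qed
  then have fg: "fg_projective_dim G ((H1_vN G)\<lparr>carrier := P\<rparr>) (Re (\<Sum>i<n. vN_trace G (A i i)))"
    unfolding fg_projective_dim_def using A by (intro exI[of _ n] exI[of _ A]) auto
  have "ereal (Re (\<Sum>i<n. vN_trace G (A i i))) \<le> first_L2_betti G"
    unfolding first_L2_betti_def vN_dim_def
    by (rule Sup_upper, rule CollectI, intro exI conjI) (rule refl, rule submod, rule fg)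
  moreover have "(0 :: ereal) < ereal (Re (\<Sum>i<n. vN_trace G (A i i)))" using tr by simp
  ultimately show ?thesis by force
qed

end

section \<open>Square summable flows on a Cayley graph\<close>

lemma ip_add_right:
  assumes "sq_summable f" "sq_summable g" "sq_summable h"
  shows "ip f (\<lambda>i. g i + h i) = ip f g + ip f h"
  by (subst (1 2 3) ip_commute) (simp add: ip_add_left assms)

lemma add_swap_eq:
  "(a :: complex) + b = a' + b' \<Longrightarrow> c + d = c' + d' \<Longrightarrow> a + c + (b + d) = a' + c' + (b' + d')"
proof -
  assume "a + b = a' + b'" "c + d = c' + d'"
  then have "(a + b) + (c + d) = (a' + b') + (c' + d')" by simp
  then show ?thesis by (simp add: add_ac)
qed

lemma ip_zero_left: "ip (\<lambda>i. 0) g = 0"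
  by (simp add: ip_def)

lemma ip_point: "ip f (\<lambda>i. if i = p then 1 else 0) = f p"
proof -
  have "ip f (\<lambda>i. if i = p then 1 else 0) = (\<Sum>\<^sub>\<infinity>i\<in>{p}. f i)"
    unfolding ip_def by (rule infsum_cong_neutral) auto
  then show ?thesis by simp
qed

text \<open>Pairs of square summable functions are encoded as one function on letters and group
  elements, so that the projection theorem applies directly. \<open>embed\<close> and
  \<open>component\<close> are the coordinate inclusions and projections.\<close>

definition embed :: "bool \<Rightarrow> ('g \<Rightarrow> complex) \<Rightarrow> bool \<times> 'g \<Rightarrow> complex" where
  "embed x f = (\<lambda>p. if fst p = x then f (snd p) else 0)"

definition component :: "bool \<Rightarrow> (bool \<times> 'g \<Rightarrow> complex) \<Rightarrow> 'g \<Rightarrow> complex" where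
  "component x \<zeta> = (\<lambda>q. \<zeta> (x, q))"

lemma component_embed: "component x (embed y f) = (if x = y then f else (\<lambda>q. 0))"
  by (auto simp: component_def embed_def)

lemma sum_embed_component: "\<zeta> = (\<lambda>p. embed False (component False \<zeta>) p + embed True (component True \<zeta>) p)"
  for \<zeta> :: "bool \<times> 'g \<Rightarrow> complex"
  by (auto simp: component_def embed_def)

lemma sq_summable_embed:
  assumes "sq_summable f"
  shows "sq_summable (embed x f)" "nsq (embed x f) \<le> nsq f"
proof -
  have "(\<Sum>p\<in>S. (cmod (embed x f p))\<^sup>2) \<le> nsq f" if S: "finite S" for S
  proof -
    let ?T = "{p \<in> S. fst p = x}"
    have "(\<Sum>p\<in>S. (cmod (embed x f p))\<^sup>2) = (\<Sum>p\<in>?T. (cmod (f (snd p)))\<^sup>2)"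
      using S by (intro sum.mono_neutral_cong_right) (auto simp: embed_def)
    also have "\<dots> = (\<Sum>q\<in>snd ` ?T. (cmod (f q))\<^sup>2)"
      by (subst sum.reindex) (auto simp: inj_on_def)
    also have "\<dots> \<le> nsq f" by (rule sum_le_nsq[OF assms]) (use S in auto)
    finally show ?thesis .
  qed
  from sq_summableI[OF this] show "sq_summable (embed x f)" "nsq (embed x f) \<le> nsq f" by auto
qed

lemma sq_summable_component:
  assumes "sq_summable \<zeta>"
  shows "sq_summable (component x \<zeta>)" "nsq (component x \<zeta>) \<le> nsq \<zeta>"
proof -
  have "(\<Sum>q\<in>S. (cmod (component x \<zeta> q))\<^sup>2) \<le> nsq \<zeta>" if S: "finite S" for S
  proof -
    have "(\<Sum>q\<in>S. (cmod (component x \<zeta> q))\<^sup>2) = (\<Sum>p\<in>Pair x ` S. (cmod (\<zeta> p))\<^sup>2)"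
      by (subst sum.reindex) (auto simp: inj_on_def component_def)
    also have "\<dots> \<le> nsq \<zeta>" by (rule sum_le_nsq[OF assms]) (use S in auto)
    finally show ?thesis .
  qed
  from sq_summableI[OF this] show "sq_summable (component x \<zeta>)" "nsq (component x \<zeta>) \<le> nsq \<zeta>" by auto
qed

lemma ip_embed:
  assumes "sq_summable f" "sq_summable \<xi>"
  shows "ip (embed x f) \<xi> = ip f (component x \<xi>)"
proof -
  have "ip (embed x f) \<xi> = (\<Sum>\<^sub>\<infinity>p\<in>range (Pair x). embed x f p * cnj (\<xi> p))"
    unfolding ip_def by (rule infsum_cong_neutral) (auto simp: embed_def)
  also have "\<dots> = (\<Sum>\<^sub>\<infinity>q. embed x f (x, q) * cnj (\<xi> (x, q)))"
    by (subst infsum_reindex) (auto simp: inj_on_def o_def)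
  finally show ?thesis by (simp add: ip_def embed_def component_def)
qed

lemma (in group) ip_right_trans:
  assumes g: "g \<in> carrier G" and f: "f \<in> l2 G" and h: "h \<in> l2 G"
  shows "ip (right_trans G g f) h = ip f (right_trans G (inv g) h)"
proof -
  have "ip (right_trans G g f) h = (\<Sum>\<^sub>\<infinity>q\<in>carrier G. f (q \<otimes> g) * cnj (h q))"
    unfolding ip_def by (rule infsum_cong_neutral) (auto simp: right_trans_apply f)
  also have "\<dots> = (\<Sum>\<^sub>\<infinity>q\<in>carrier G. f (q \<otimes> g) * cnj (right_trans G (inv g) h (q \<otimes> g)))"
    by (rule infsum_cong) (simp add: right_trans_apply h g m_assoc)
  also have "\<dots> = (\<Sum>\<^sub>\<infinity>q\<in>carrier G. f q * cnj (right_trans G (inv g) h q))"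
    by (rule infsum_reindex_bij_betw[OF bij_betw_right[OF g]])
  also have "\<dots> = ip f (right_trans G (inv g) h)"
    unfolding ip_def using f by (intro infsum_cong_neutral) (auto simp: l2_iff)
  finally show ?thesis .
qed

lemma point_l2: "p \<in> carrier G \<Longrightarrow> (\<lambda>i. if i = p then 1 else 0) \<in> l2 G"
proof -
  assume p: "p \<in> carrier G"
  have "(\<lambda>i. (cmod (if i = p then 1 else 0))\<^sup>2) summable_on UNIV \<longleftrightarrow>
      (\<lambda>i. (cmod (if i = p then 1 else 0))\<^sup>2) summable_on {p}"
    by (rule summable_on_cong_neutral) auto
  then show ?thesis using p by (auto simp: l2_iff sq_summable_def)
qed

text \<open>Generation is meant by products without inverses, as provided by a quotient of the free
  monoid. Countability of the type is what the projection theorem asks for.\<close>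

locale generated_group = group G for G :: "('g::countable, 'm) monoid_scheme" (structure) +
  fixes \<gamma> :: "bool \<Rightarrow> 'g"
  assumes gen_closed [simp]: "\<gamma> x \<in> carrier G"
    and generated: "g \<in> carrier G \<Longrightarrow> \<exists>s. foldr (\<lambda>x. (\<otimes>) (\<gamma> x)) s \<one> = g"
begin

interpretation vN: abelian_group "\<N>"
  by (rule abelian_group_vN)

section \<open>Words, path sums and the space of flows\<close>

definition ev :: "bool list \<Rightarrow> 'g" where
  "ev s = foldr (\<lambda>x. (\<otimes>) (\<gamma> x)) s \<one>"

lemma ev_simps [simp]: "ev [] = \<one>" "ev (x # s) = \<gamma> x \<otimes> ev s"
  by (simp_all add: ev_def)

lemma ev_closed [simp]: "ev s \<in> carrier G"
  by (induction s) auto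

lemma ev_append: "ev (s @ t) = ev s \<otimes> ev t"
  by (induction s) (auto simp: m_assoc)

lemma foldl_gen: "q \<in> carrier G \<Longrightarrow> foldl (\<lambda>q x. q \<otimes> \<gamma> x) q s = q \<otimes> ev s"
  by (induction s arbitrary: q) (auto simp: m_assoc)

text \<open>The pair \<open>(x, q)\<close> is the edge from \<open>q\<close> to
  \<open>q \<otimes> \<gamma> x\<close>; with the letter first, the weights of one label form a
  function on \<open>G\<close>.\<close>

definition gsum :: "(bool \<times> 'g \<Rightarrow> complex) \<Rightarrow> 'g \<Rightarrow> bool list \<Rightarrow> complex" where
  "gsum \<xi> = path_sum (\<lambda>q x. q \<otimes> \<gamma> x) (\<lambda>q x. \<xi> (x, q))"

definition L2 :: "(bool \<times> 'g \<Rightarrow> complex) set" where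
  "L2 = {\<zeta>. sq_summable \<zeta> \<and> (\<forall>x q. q \<notin> carrier G \<longrightarrow> \<zeta> (x, q) = 0)}"

text \<open>These are the harmonic square summable 1-cochains of the Cayley graph: the first clause
  makes them orthogonal to gradients, the second makes them closed on all loops of
  \<open>G\<close>.\<close>

definition flows :: "(bool \<times> 'g \<Rightarrow> complex) set" where
  "flows = {\<xi> \<in> L2.
     (\<forall>q\<in>carrier G. \<xi> (False, q \<otimes> inv (\<gamma> False)) + \<xi> (True, q \<otimes> inv (\<gamma> True)) = \<xi> (False, q) + \<xi> (True, q)) \<and>
     (\<forall>s t. ev s = ev t \<longrightarrow> (\<forall>q\<in>carrier G. gsum \<xi> q s = gsum \<xi> q t))}"

lemma L2_zero: "(\<lambda>p. 0) \<in> L2"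
  and L2_add: "\<zeta> \<in> L2 \<Longrightarrow> \<eta> \<in> L2 \<Longrightarrow> (\<lambda>p. \<zeta> p + \<eta> p) \<in> L2"
  by (auto simp: L2_def sq_summable_add)

lemma L2_sq: "\<zeta> \<in> L2 \<Longrightarrow> sq_summable \<zeta>"
  by (simp add: L2_def)

lemma flows_L2: "\<xi> \<in> flows \<Longrightarrow> \<xi> \<in> L2"
  by (simp add: flows_def)

lemma flowsI:
  assumes "\<xi> \<in> L2"
    and "\<And>q. q \<in> carrier G \<Longrightarrow>
      \<xi> (False, q \<otimes> inv (\<gamma> False)) + \<xi> (True, q \<otimes> inv (\<gamma> True)) = \<xi> (False, q) + \<xi> (True, q)"
    and "\<And>s t q. ev s = ev t \<Longrightarrow> q \<in> carrier G \<Longrightarrow> gsum \<xi> q s = gsum \<xi> q t"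
  shows "\<xi> \<in> flows"
  unfolding flows_def using assms by blast

lemma flows_divergence: "\<xi> \<in> flows \<Longrightarrow> q \<in> carrier G \<Longrightarrow>
    \<xi> (False, q \<otimes> inv (\<gamma> False)) + \<xi> (True, q \<otimes> inv (\<gamma> True)) = \<xi> (False, q) + \<xi> (True, q)"
  and flows_loop: "\<xi> \<in> flows \<Longrightarrow> ev s = ev t \<Longrightarrow> q \<in> carrier G \<Longrightarrow> gsum \<xi> q s = gsum \<xi> q t"
  unfolding flows_def by blast+

lemma gsum_zero: "gsum (\<lambda>p. 0) q s = 0"
  unfolding gsum_def by (induction s arbitrary: q) auto

lemma gsum_add: "gsum (\<lambda>p. \<xi> p + \<eta> p) q s = gsum \<xi> q s + gsum \<eta> q s"
  by (simp only: gsum_def path_sum_add)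

lemma gsum_cmult: "gsum (\<lambda>p. c * \<xi> p) q s = c * gsum \<xi> q s"
  by (simp only: gsum_def path_sum_mult)

lemma tendsto_gsum:
  "(\<And>p. (\<lambda>n. f n p) \<longlonglongrightarrow> l p) \<Longrightarrow> (\<lambda>n. gsum (f n) q s) \<longlonglongrightarrow> gsum l q s"
  unfolding gsum_def by (rule tendsto_path_sum) blast

text \<open>Every defining equation is linear and involves finitely many edges, so it survives
  pointwise limits.\<close>

lemma pointwise_closed_flows: "pointwise_closed_subspace flows"
proof
  show "sq_summable h" if "h \<in> flows" for h by (rule L2_sq[OF flows_L2[OF that]])
  show "(\<lambda>p. 0) \<in> flows" by (rule flowsI) (simp_all add: L2_zero gsum_zero)
next
  fix g h assume g: "g \<in> flows" and h: "h \<in> flows"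
  show "(\<lambda>p. g p + h p) \<in> flows"
  proof (rule flowsI)
    show "(\<lambda>p. g p + h p) \<in> L2" by (intro L2_add flows_L2 g h)
    fix q assume q: "q \<in> carrier G"
    show "g (False, q \<otimes> inv (\<gamma> False)) + h (False, q \<otimes> inv (\<gamma> False))
        + (g (True, q \<otimes> inv (\<gamma> True)) + h (True, q \<otimes> inv (\<gamma> True)))
        = g (False, q) + h (False, q) + (g (True, q) + h (True, q))"
      by (rule add_swap_eq[OF flows_divergence[OF g q] flows_divergence[OF h q]])
    show "gsum (\<lambda>p. g p + h p) q s = gsum (\<lambda>p. g p + h p) q t" if "ev s = ev t" for s t
      by (simp only: gsum_add flows_loop[OF g that q] flows_loop[OF h that q])
  qed
next
  fix h c assume h: "h \<in> flows"
  show "(\<lambda>p. c * h p) \<in> flows"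
  proof (rule flowsI)
    show "(\<lambda>p. c * h p) \<in> L2" using flows_L2[OF h] by (simp add: L2_def sq_summable_cmult)
    fix q assume q: "q \<in> carrier G"
    show "c * h (False, q \<otimes> inv (\<gamma> False)) + c * h (True, q \<otimes> inv (\<gamma> True)) = c * h (False, q) + c * h (True, q)"
      by (simp only: distrib_left[symmetric] flows_divergence[OF h q])
    show "gsum (\<lambda>p. c * h p) q s = gsum (\<lambda>p. c * h p) q t" if "ev s = ev t" for s t
      by (simp only: gsum_cmult flows_loop[OF h that q])
  qed
next
  fix f l assume f: "\<And>n. f n \<in> flows" and lim: "\<And>p. (\<lambda>n. f n p) \<longlonglongrightarrow> l p" and l: "sq_summable l"
  show "l \<in> flows"
  proof (rule flowsI)
    have "l (x, q) = 0" if "q \<notin> carrier G" for x q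
    proof -
      have "f n (x, q) = 0" for n using flows_L2[OF f[of n]] that by (simp add: L2_def)
      then show ?thesis using lim[of "(x, q)"] by (simp add: LIMSEQ_const_iff)
    qed
    then show "l \<in> L2" using l by (simp add: L2_def)
    fix q assume q: "q \<in> carrier G"
    show "l (False, q \<otimes> inv (\<gamma> False)) + l (True, q \<otimes> inv (\<gamma> True)) = l (False, q) + l (True, q)"
    proof (rule LIMSEQ_unique)
      show "(\<lambda>n. f n (False, q) + f n (True, q)) \<longlonglongrightarrow> l (False, q) + l (True, q)"
        by (rule tendsto_add[OF lim lim])
      have "(\<lambda>n. f n (False, q \<otimes> inv (\<gamma> False)) + f n (True, q \<otimes> inv (\<gamma> True)))
          \<longlonglongrightarrow> l (False, q \<otimes> inv (\<gamma> False)) + l (True, q \<otimes> inv (\<gamma> True))"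
        by (rule tendsto_add[OF lim lim])
      then show "(\<lambda>n. f n (False, q) + f n (True, q))
          \<longlonglongrightarrow> l (False, q \<otimes> inv (\<gamma> False)) + l (True, q \<otimes> inv (\<gamma> True))"
        by (simp only: flows_divergence[OF f q])
    qed
    show "gsum l q s = gsum l q t" if st: "ev s = ev t" for s t
    proof (rule LIMSEQ_unique)
      show "(\<lambda>n. gsum (f n) q s) \<longlonglongrightarrow> gsum l q s" by (rule tendsto_gsum[OF lim])
      show "(\<lambda>n. gsum (f n) q s) \<longlonglongrightarrow> gsum l q t"
        unfolding flows_loop[OF f st q] by (rule tendsto_gsum[OF lim])
    qed
  qed
qed

sublocale flows: pointwise_closed_subspace flows
  by (rule pointwise_closed_flows)

abbreviation P :: "(bool \<times> 'g \<Rightarrow> complex) \<Rightarrow> bool \<times> 'g \<Rightarrow> complex" where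
  "P \<equiv> flows.proj"

lemma P_L2: "\<zeta> \<in> L2 \<Longrightarrow> P \<zeta> \<in> L2"
  by (rule flows_L2) (rule flows.proj_in[OF L2_sq])

lemma P_idem: "\<zeta> \<in> L2 \<Longrightarrow> P (P \<zeta>) = P \<zeta>"
  by (rule flows.proj_id[OF flows.proj_in[OF L2_sq]])

lemma embed_L2: "f \<in> l2 G \<Longrightarrow> embed x f \<in> L2"
  using sq_summable_embed(1)[of f x] by (simp add: L2_def l2_iff) (simp add: embed_def)

lemma component_l2: "\<zeta> \<in> L2 \<Longrightarrow> component x \<zeta> \<in> l2 G"
  by (simp add: L2_def l2_iff sq_summable_component(1)) (simp add: component_def)

definition shift :: "'g \<Rightarrow> (bool \<times> 'g \<Rightarrow> complex) \<Rightarrow> bool \<times> 'g \<Rightarrow> complex" where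
  "shift g \<zeta> = (\<lambda>p. if snd p \<in> carrier G then \<zeta> (fst p, inv g \<otimes> snd p) else 0)"

lemma component_shift: "\<zeta> \<in> L2 \<Longrightarrow> component x (shift g \<zeta>) = left_trans G g (component x \<zeta>)"
  by (rule ext, simp add: left_trans_apply component_l2) (simp add: component_def shift_def)

lemma shift_eq: "\<zeta> \<in> L2 \<Longrightarrow> shift g \<zeta> = (\<lambda>p. embed False (left_trans G g (component False \<zeta>)) p
    + embed True (left_trans G g (component True \<zeta>)) p)"
  by (subst sum_embed_component[of "shift g \<zeta>"]) (simp only: component_shift)

lemma shift_L2: "g \<in> carrier G \<Longrightarrow> \<zeta> \<in> L2 \<Longrightarrow> shift g \<zeta> \<in> L2"
  by (simp add: shift_eq) (intro L2_add embed_L2 left_trans_l2 component_l2)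

lemma shift_flows:
  assumes g: "g \<in> carrier G" and \<xi>: "\<xi> \<in> flows"
  shows "shift g \<xi> \<in> flows"
proof -
  have gs: "gsum (shift g \<xi>) q s = gsum \<xi> (inv g \<otimes> q) s" if "q \<in> carrier G" for q s
    using that
  proof (induction s arbitrary: q)
    case (Cons x s)
    then show ?case using g by (simp add: gsum_def shift_def m_assoc)
  qed (simp add: gsum_def)
  show ?thesis
  proof (rule flowsI)
    show "shift g \<xi> \<in> L2" by (rule shift_L2[OF g flows_L2[OF \<xi>]])
    fix q assume q: "q \<in> carrier G"
    have gq: "inv g \<otimes> q \<in> carrier G" using g q by simp
    show "shift g \<xi> (False, q \<otimes> inv (\<gamma> False)) + shift g \<xi> (True, q \<otimes> inv (\<gamma> True))
        = shift g \<xi> (False, q) + shift g \<xi> (True, q)"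
      using flows_divergence[OF \<xi> gq] g q by (simp add: shift_def m_assoc)
    show "gsum (shift g \<xi>) q s = gsum (shift g \<xi>) q t" if "ev s = ev t" for s t
      by (simp only: gs[OF q] flows_loop[OF \<xi> that gq])
  qed
qed

lemma ip_shift:
  assumes g: "g \<in> carrier G" and \<zeta>: "\<zeta> \<in> L2" and \<eta>: "\<eta> \<in> L2"
  shows "ip (shift g \<zeta>) \<eta> = ip \<zeta> (shift (inv g) \<eta>)"
proof -
  let ?U = "(UNIV :: bool set) \<times> carrier G"
  let ?h = "map_prod id (\<lambda>q. inv g \<otimes> q) :: bool \<times> 'g \<Rightarrow> bool \<times> 'g"
  have bij: "bij_betw ?h ?U ?U"
    by (rule bij_betw_map_prod[OF bij_betw_id bij_betw_left[OF g]])
  have "ip (shift g \<zeta>) \<eta> = (\<Sum>\<^sub>\<infinity>p\<in>?U. \<zeta> (?h p) * cnj (shift (inv g) \<eta> (?h p)))"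
    unfolding ip_def using g by (intro infsum_cong_neutral) (auto simp: shift_def simp flip: m_assoc)
  also have "\<dots> = (\<Sum>\<^sub>\<infinity>p\<in>?U. \<zeta> p * cnj (shift (inv g) \<eta> p))"
    by (rule infsum_reindex_bij_betw[OF bij])
  also have "\<dots> = ip \<zeta> (shift (inv g) \<eta>)"
    unfolding ip_def using \<zeta> by (intro infsum_cong_neutral) (auto simp: L2_def)
  finally show ?thesis .
qed

text \<open>Translations are unitary and preserve \<open>flows\<close>. Moving one to the other side
  of the inner product verifies the characterization of the projection.\<close>

lemma P_shift:
  assumes g: "g \<in> carrier G" and \<zeta>: "\<zeta> \<in> L2"
  shows "P (shift g \<zeta>) = shift g (P \<zeta>)"
proof (rule flows.proj_eqI)
  have P: "P \<zeta> \<in> flows" by (rule flows.proj_in[OF L2_sq[OF \<zeta>]])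
  show "sq_summable (shift g \<zeta>)" by (rule L2_sq[OF shift_L2[OF g \<zeta>]])
  show "shift g (P \<zeta>) \<in> flows" by (rule shift_flows[OF g P])
  fix h assume h: "h \<in> flows"
  have "ip (shift g \<zeta>) h = ip \<zeta> (shift (inv g) h)"
    by (rule ip_shift[OF g \<zeta> flows_L2[OF h]])
  also have "\<dots> = ip (P \<zeta>) (shift (inv g) h)"
    using flows.ip_proj[OF L2_sq[OF \<zeta>] shift_flows[OF inv_closed[OF g] h]] by simp
  also have "\<dots> = ip (shift g (P \<zeta>)) h"
    using ip_shift[OF g flows_L2[OF P] flows_L2[OF h]] by simp
  finally show "ip (shift g \<zeta>) h = ip (shift g (P \<zeta>)) h" .
qed

lemma P_add: "\<zeta> \<in> L2 \<Longrightarrow> \<eta> \<in> L2 \<Longrightarrow> P (\<lambda>p. \<zeta> p + \<eta> p) = (\<lambda>p. P \<zeta> p + P \<eta> p)"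
  by (intro flows.proj_add L2_sq)

section \<open>The projection onto flows as a matrix over the group von Neumann algebra\<close>

definition proj_entry :: "bool \<Rightarrow> bool \<Rightarrow> 'g l2_op" where
  "proj_entry x y = (\<lambda>f\<in>l2 G. component x (P (embed y f)))"

text \<open>Inclusion, projection and coordinate do not increase norms, which gives the bound 1;
  equivariance is inherited from \<open>P_shift\<close>.\<close>

lemma proj_entry_closed: "proj_entry x y \<in> carrier \<N>"
  unfolding proj_entry_def
proof (rule vN_carrierI)
  fix f assume f: "f \<in> l2 G"
  note e = embed_L2[OF f]
  show "component x (P (embed y f)) \<in> l2 G" by (rule component_l2[OF P_L2[OF e]])
  show "component x (P (embed y (\<lambda>q. f q + h q))) = (\<lambda>q. component x (P (embed y f)) q + component x (P (embed y h)) q)"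
    if h: "h \<in> l2 G" for h
  proof -
    have "embed y (\<lambda>q. f q + h q) = (\<lambda>p. embed y f p + embed y h p)" by (auto simp: embed_def)
    then show ?thesis by (simp add: P_add e embed_L2 h) (simp add: component_def)
  qed
  show "component x (P (embed y (\<lambda>q. c * f q))) = (\<lambda>q. c * component x (P (embed y f)) q)" for c
  proof -
    have "embed y (\<lambda>q. c * f q) = (\<lambda>p. c * embed y f p)" by (auto simp: embed_def)
    then show ?thesis using flows.proj_cmult[OF L2_sq[OF e]] by (simp add: component_def)
  qed
  have "nsq (component x (P (embed y f))) \<le> nsq (P (embed y f))"
    by (rule sq_summable_component(2)[OF L2_sq[OF P_L2[OF e]]])
  also have "\<dots> \<le> nsq (embed y f)" by (rule flows.nsq_proj_le[OF L2_sq[OF e]])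
  also have "\<dots> \<le> nsq f" using f by (intro sq_summable_embed(2)) (simp add: l2_iff)
  finally show "nsq (component x (P (embed y f))) \<le> 1 * nsq f" by simp
  fix g assume g: "g \<in> carrier G"
  show "left_trans G g f \<in> l2 G" by (rule left_trans_l2[OF g f])
  have "embed y (left_trans G g f) = shift g (embed y f)"
    by (rule ext) (simp add: embed_def shift_def left_trans_apply f)
  then show "component x (P (embed y (left_trans G g f))) = left_trans G g (component x (P (embed y f)))"
    by (simp add: P_shift g e component_shift P_L2)
qed

definition letter :: "nat \<Rightarrow> bool" where
  "letter i \<longleftrightarrow> i = 1"

lemma sum_letter: "(\<Sum>i<2. F i (letter i)) = F 0 False + F 1 True"
  by (simp add: numeral_2_eq_2 letter_def)

definition proj_matrix :: "nat \<Rightarrow> nat \<Rightarrow> 'g l2_op" where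
  "proj_matrix i j = proj_entry (letter i) (letter j)"

abbreviation F2 :: "('g l2_op, nat \<Rightarrow> 'g l2_op) module" where
  "F2 \<equiv> free_mod \<N> {..<2}"

text \<open>A row vector over \<N> is viewed as an operator from pairs of functions to functions.
  Right multiplication by \<open>proj_matrix\<close> then becomes precomposition with
  \<open>P\<close>.\<close>

definition row_op :: "(nat \<Rightarrow> 'g l2_op) \<Rightarrow> (bool \<times> 'g \<Rightarrow> complex) \<Rightarrow> 'g \<Rightarrow> complex" where
  "row_op c \<zeta> = (\<lambda>q. \<Sum>i<2. c i (component (letter i) \<zeta>) q)"

lemma P_decompose:
  assumes "\<zeta> \<in> L2"
  shows "P \<zeta> = (\<lambda>p. P (embed False (component False \<zeta>)) p + P (embed True (component True \<zeta>)) p)"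
proof -
  have "P (\<lambda>p. embed False (component False \<zeta>) p + embed True (component True \<zeta>) p)
      = (\<lambda>p. P (embed False (component False \<zeta>)) p + P (embed True (component True \<zeta>)) p)"
    by (intro P_add embed_L2 component_l2 assms)
  then show ?thesis by (simp only: sum_embed_component[symmetric])
qed

text \<open>Splitting the intermediate vector into its two coordinates turns the matrix product into
  \<open>P\<close> applied twice.\<close>

lemma idempotent_proj_matrix: "idempotent_matrix \<N> 2 proj_matrix"
  unfolding idempotent_matrix_def
proof (intro conjI allI impI)
  fix i j :: nat
  show "proj_matrix i j \<in> carrier \<N>" by (simp add: proj_matrix_def proj_entry_closed)
  have closed: "proj_matrix i k \<otimes>\<^bsub>\<N>\<^esub> proj_matrix k j \<in> carrier \<N>" for k
    unfolding proj_matrix_def by (intro vN_mult_closed proj_entry_closed)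
  show "(\<Oplus>\<^bsub>\<N>\<^esub>k\<in>{..<2}. proj_matrix i k \<otimes>\<^bsub>\<N>\<^esub> proj_matrix k j) = proj_matrix i j"
  proof (rule vN_ext)
    show "(\<Oplus>\<^bsub>\<N>\<^esub>k\<in>{..<2}. proj_matrix i k \<otimes>\<^bsub>\<N>\<^esub> proj_matrix k j) \<in> carrier \<N>"
      by (rule vN.finsum_closed) (simp add: closed)
    show "proj_matrix i j \<in> carrier \<N>" by (simp add: proj_matrix_def proj_entry_closed)
    fix f q assume f: "f \<in> l2 G"
    let ?\<zeta> = "P (embed (letter j) f)"
    have \<zeta>: "?\<zeta> \<in> L2" by (rule P_L2[OF embed_L2[OF f]])
    have "(\<Oplus>\<^bsub>\<N>\<^esub>k\<in>{..<2}. proj_matrix i k \<otimes>\<^bsub>\<N>\<^esub> proj_matrix k j) f q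
        = (\<Sum>k<2. component (letter i) (P (embed (letter k) (component (letter k) ?\<zeta>))) q)"
      using vN_finsum_eval[OF _ closed f, of "{..<2}" "\<lambda>k. k"] component_l2[OF \<zeta>] f
      by (simp add: vN_mult_eval proj_matrix_def proj_entry_def)
    also have "\<dots> = component (letter i) (P ?\<zeta>) q"
      unfolding sum_letter[of "\<lambda>_ x. component (letter i) (P (embed x (component x ?\<zeta>))) q"]
      using fun_cong[OF P_decompose[OF \<zeta>], of "(letter i, q)"]
      by (simp only: component_def[of "letter i"])
    also have "\<dots> = proj_matrix i j f q"
      using f by (simp add: P_idem[OF embed_L2[OF f]] proj_matrix_def proj_entry_def)
    finally show "(\<Oplus>\<^bsub>\<N>\<^esub>k\<in>{..<2}. proj_matrix i k \<otimes>\<^bsub>\<N>\<^esub> proj_matrix k j) f q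
        = proj_matrix i j f q" .
  qed
qed

end

context generated_group
begin

interpretation vN: abelian_group "\<N>"
  by (rule abelian_group_vN)

section \<open>The projective module of rows fixed by the projection, and its map to
  1-chains\<close>

definition row_mult :: "(nat \<Rightarrow> 'g l2_op) \<Rightarrow> nat \<Rightarrow> 'g l2_op" where
  "row_mult c = (\<lambda>j\<in>{..<2}. \<Oplus>\<^bsub>\<N>\<^esub>i\<in>{..<2}. c i \<otimes>\<^bsub>\<N>\<^esub> proj_matrix i j)"

lemma F2_closed: "c \<in> carrier F2 \<Longrightarrow> i < 2 \<Longrightarrow> c i \<in> carrier \<N>"
  by (rule vN.free_mod_closed) auto

lemma F2_ext:
  assumes "c \<in> carrier F2" "d \<in> carrier F2" "\<And>i f q. i < 2 \<Longrightarrow> f \<in> l2 G \<Longrightarrow> c i f q = d i f q"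
  shows "c = d"
  using assms(1,2)
proof (rule vN.free_mod_ext)
  fix i assume "i \<in> {..<2::nat}"
  then have i: "i < 2" by simp
  show "c i = d i" by (rule vN_ext[OF F2_closed[OF assms(1) i] F2_closed[OF assms(2) i] assms(3)[OF i]])
qed

lemma row_op_add:
  assumes c: "c \<in> carrier F2" and "\<zeta> \<in> L2" "\<eta> \<in> L2"
  shows "row_op c (\<lambda>p. \<zeta> p + \<eta> p) q = row_op c \<zeta> q + row_op c \<eta> q"
proof -
  have "c i (component x (\<lambda>p. \<zeta> p + \<eta> p)) q = c i (component x \<zeta>) q + c i (component x \<eta>) q" if "i < 2" for i x
  proof -
    have "component x (\<lambda>p. \<zeta> p + \<eta> p) = (\<lambda>q. component x \<zeta> q + component x \<eta> q)" by (simp add: component_def)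
    then show ?thesis
      using vN_add[OF F2_closed[OF c that] component_l2[OF assms(2)] component_l2[OF assms(3)]] by simp
  qed
  then show ?thesis by (simp add: row_op_def sum.distrib)
qed

lemma row_op_zero:
  assumes "c \<in> carrier F2"
  shows "row_op c (\<lambda>p. 0) q = 0"
proof -
  have "c i (component (letter i) (\<lambda>p. 0)) = (\<lambda>q. 0)" if "i < 2" for i
    using vN_zero[OF F2_closed[OF assms that]] by (simp add: component_def)
  then show ?thesis by (simp add: row_op_def)
qed

lemma row_op_embed:
  assumes c: "c \<in> carrier F2" and j: "j < 2" and f: "f \<in> l2 G"
  shows "row_op c (embed (letter j) f) q = c j f q"
proof -
  have "c i (component (letter i) (embed (letter j) f)) q = (if i = j then c j f q else 0)" if i: "i < 2" for i
  proof -
    have "letter i = letter j \<longleftrightarrow> i = j" using i j by (auto simp: letter_def less_2_cases_iff)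
    then show ?thesis using vN_zero[OF F2_closed[OF c i]] by (simp add: component_embed)
  qed
  then have "row_op c (embed (letter j) f) q = (\<Sum>i<2. if i = j then c j f q else 0)"
    by (simp add: row_op_def)
  then show ?thesis using j by simp
qed

lemma row_op_decompose:
  assumes "\<zeta> \<in> L2"
  shows "row_op c \<zeta> q = c 0 (component False \<zeta>) q + c 1 (component True \<zeta>) q"
  by (simp add: row_op_def sum_letter[of "\<lambda>i x. c i (component x \<zeta>) q"])

lemma row_mult_closed:
  assumes c: "c \<in> carrier F2"
  shows "row_mult c \<in> carrier F2"
  unfolding row_mult_def
proof (rule vN.free_modI[where J = "{..<2}"])
  show "(\<Oplus>\<^bsub>\<N>\<^esub>i\<in>{..<2}. c i \<otimes>\<^bsub>\<N>\<^esub> proj_matrix i j) \<in> carrier \<N>" for j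
    unfolding proj_matrix_def
    by (intro vN.finsum_closed Pi_I vN_mult_closed proj_entry_closed F2_closed[OF c]) simp
qed auto

lemma row_mult_eval:
  assumes c: "c \<in> carrier F2" and j: "j < 2" and f: "f \<in> l2 G"
  shows "row_mult c j f q = row_op c (P (embed (letter j) f)) q"
proof -
  have "(\<Oplus>\<^bsub>\<N>\<^esub>i\<in>{..<2}. c i \<otimes>\<^bsub>\<N>\<^esub> proj_matrix i j) f
      = (\<lambda>q. \<Sum>i\<in>{..<2}. (c i \<otimes>\<^bsub>\<N>\<^esub> proj_matrix i j) f q)"
    unfolding proj_matrix_def
    by (rule vN_finsum_eval[OF _ _ f]) (auto intro: vN_mult_closed proj_entry_closed F2_closed[OF c])
  moreover have "(c i \<otimes>\<^bsub>\<N>\<^esub> proj_matrix i j) f q = c i (component (letter i) (P (embed (letter j) f))) q" for i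
    using f by (simp add: vN_mult_eval proj_matrix_def proj_entry_def)
  ultimately show ?thesis using j by (simp add: row_mult_def row_op_def)
qed

lemma row_op_row_mult:
  assumes c: "c \<in> carrier F2" and \<zeta>: "\<zeta> \<in> L2"
  shows "row_op (row_mult c) \<zeta> q = row_op c (P \<zeta>) q"
proof -
  have e: "embed x (component x \<zeta>) \<in> L2" for x by (rule embed_L2[OF component_l2[OF \<zeta>]])
  have "row_op (row_mult c) \<zeta> q = row_mult c 0 (component (letter 0) \<zeta>) q + row_mult c 1 (component (letter 1) \<zeta>) q"
    using row_op_decompose[OF \<zeta>] by (simp add: letter_def)
  also have "\<dots> = row_op c (P (embed False (component False \<zeta>))) q + row_op c (P (embed True (component True \<zeta>))) q"
    using row_mult_eval[OF c _ component_l2[OF \<zeta>]] by (simp add: letter_def)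
  also have "\<dots> = row_op c (P \<zeta>) q"
    unfolding P_decompose[OF \<zeta>] row_op_add[OF c P_L2[OF e] P_L2[OF e]] ..
  finally show ?thesis .
qed

abbreviation V :: "(nat \<Rightarrow> 'g l2_op) set" where
  "V \<equiv> carrier (row_image \<N> 2 proj_matrix)"

text \<open>The image of an idempotent is its set of fixed points. In terms of operators, the rows
  in \<open>V\<close> are those that factor through \<open>P\<close>.\<close>

lemma V_iff: "c \<in> V \<longleftrightarrow> c \<in> carrier F2 \<and> (\<forall>\<zeta>\<in>L2. row_op c \<zeta> = row_op c (P \<zeta>))"
proof
  assume "c \<in> V"
  then obtain a where a: "a \<in> carrier F2" "c = row_mult a"
    by (auto simp: row_image_def row_mult_def)
  have "row_op c \<zeta> = row_op c (P \<zeta>)" if "\<zeta> \<in> L2" for \<zeta>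
    using row_op_row_mult[OF a(1) that] row_op_row_mult[OF a(1) P_L2[OF that]]
    by (intro ext) (simp add: a(2) P_idem[OF that])
  then show "c \<in> carrier F2 \<and> (\<forall>\<zeta>\<in>L2. row_op c \<zeta> = row_op c (P \<zeta>))"
    using row_mult_closed[OF a(1)] a(2) by blast
next
  assume c: "c \<in> carrier F2 \<and> (\<forall>\<zeta>\<in>L2. row_op c \<zeta> = row_op c (P \<zeta>))"
  have "c = row_mult c"
  proof (rule F2_ext)
    show "c \<in> carrier F2" "row_mult c \<in> carrier F2" using c row_mult_closed by auto
    fix i f q assume i: "i < (2::nat)" and f: "f \<in> l2 G"
    have "row_op c (embed (letter i) f) = row_op c (P (embed (letter i) f))"
      using c embed_L2[OF f] by blast
    then show "c i f q = row_mult c i f q"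
      using row_op_embed[of c i f q] row_mult_eval[of c i f q] c i f by simp
  qed
  then show "c \<in> V" using c by (auto simp: row_image_def row_mult_def)
qed

lemma row_op_free_add:
  assumes "c \<in> carrier F2" "d \<in> carrier F2" "\<zeta> \<in> L2"
  shows "row_op (c \<oplus>\<^bsub>F2\<^esub> d) \<zeta> = (\<lambda>q. row_op c \<zeta> q + row_op d \<zeta> q)"
proof
  fix q
  have "(c \<oplus>\<^bsub>F2\<^esub> d) i (component x \<zeta>) q = c i (component x \<zeta>) q + d i (component x \<zeta>) q" if "i < 2" for i x
    using that component_l2[OF assms(3)] by (simp add: vN.free_mod_add_eq vN_add_eval)
  then show "row_op (c \<oplus>\<^bsub>F2\<^esub> d) \<zeta> q = row_op c \<zeta> q + row_op d \<zeta> q"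
    by (simp add: row_op_def sum.distrib)
qed

lemma row_op_free_smult:
  assumes r: "r \<in> carrier \<N>" and c: "c \<in> carrier F2" and \<zeta>: "\<zeta> \<in> L2"
  shows "row_op (r \<odot>\<^bsub>F2\<^esub> c) \<zeta> = r (row_op c \<zeta>)"
proof -
  have l2: "c i (component (letter i) \<zeta>) \<in> l2 G" if "i \<in> {..<2}" for i
    using vN_closed[OF F2_closed[OF c] component_l2[OF \<zeta>]] that by simp
  have "(r \<odot>\<^bsub>F2\<^esub> c) i (component x \<zeta>) = r (c i (component x \<zeta>))" if "i < 2" for i x
    using that component_l2[OF \<zeta>] by (simp add: vN.free_mod_smult_eq vN_mult_eval)
  moreover have "r (\<lambda>q. \<Sum>i<2. c i (component (letter i) \<zeta>) q) = (\<lambda>q. \<Sum>i<2. r (c i (component (letter i) \<zeta>)) q)"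
    using l2 by (rule vN_sum[OF r])
  ultimately show ?thesis by (simp add: row_op_def)
qed

lemma V_add: "c \<in> V \<Longrightarrow> d \<in> V \<Longrightarrow> c \<oplus>\<^bsub>F2\<^esub> d \<in> V"
  unfolding V_iff
proof (elim conjE, intro conjI ballI)
  assume c: "c \<in> carrier F2" "\<forall>\<zeta>\<in>L2. row_op c \<zeta> = row_op c (P \<zeta>)"
    and d: "d \<in> carrier F2" "\<forall>\<zeta>\<in>L2. row_op d \<zeta> = row_op d (P \<zeta>)"
  show "c \<oplus>\<^bsub>F2\<^esub> d \<in> carrier F2" by (rule vN.free_mod_add_closed[OF c(1) d(1)])
  show "row_op (c \<oplus>\<^bsub>F2\<^esub> d) \<zeta> = row_op (c \<oplus>\<^bsub>F2\<^esub> d) (P \<zeta>)" if "\<zeta> \<in> L2" for \<zeta>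
    using c(2) d(2) that by (simp add: row_op_free_add[OF c(1) d(1)] P_L2)
qed

lemma V_smult: "r \<in> carrier \<N> \<Longrightarrow> c \<in> V \<Longrightarrow> r \<odot>\<^bsub>F2\<^esub> c \<in> V"
  unfolding V_iff
proof (elim conjE, intro conjI ballI)
  assume r: "r \<in> carrier \<N>"
    and c: "c \<in> carrier F2" "\<forall>\<zeta>\<in>L2. row_op c \<zeta> = row_op c (P \<zeta>)"
  show "r \<odot>\<^bsub>F2\<^esub> c \<in> carrier F2" by (rule free_mod_smult_closed[OF r c(1)])
  show "row_op (r \<odot>\<^bsub>F2\<^esub> c) \<zeta> = row_op (r \<odot>\<^bsub>F2\<^esub> c) (P \<zeta>)" if "\<zeta> \<in> L2" for \<zeta>
    using c(2) that by (simp add: row_op_free_smult[OF r c(1)] P_L2)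
qed

text \<open>The two generators may coincide, hence the sum.\<close>

definition chain :: "(nat \<Rightarrow> 'g l2_op) \<Rightarrow> 'g \<Rightarrow> 'g l2_op" where
  "chain c = (\<lambda>g\<in>carrier G. \<Oplus>\<^bsub>\<N>\<^esub>i\<in>{..<2}.
     if \<gamma> (letter i) = g then c i else \<zero>\<^bsub>\<N>\<^esub>)"

lemma chain_eval:
  assumes c: "c \<in> carrier F2" and g: "g \<in> carrier G" and f: "f \<in> l2 G"
  shows "chain c g f q = (\<Sum>i<2. if \<gamma> (letter i) = g then c i f q else 0)"
proof -
  have "(\<Oplus>\<^bsub>\<N>\<^esub>i\<in>{..<2}. if \<gamma> (letter i) = g then c i else \<zero>\<^bsub>\<N>\<^esub>) f
      = (\<lambda>q. \<Sum>i\<in>{..<2}. (if \<gamma> (letter i) = g then c i else \<zero>\<^bsub>\<N>\<^esub>) f q)"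
    by (rule vN_finsum_eval[OF _ _ f]) (auto intro: F2_closed[OF c] vN_zero_closed)
  then show ?thesis
    using g f by (simp add: chain_def vN_zero_eval if_distrib[of "\<lambda>T. T f _"] cong: if_cong)
qed

lemma chain_zero:
  assumes c: "c \<in> carrier F2" and g: "g \<in> carrier G" "g \<notin> range \<gamma>"
  shows "chain c g = \<zero>\<^bsub>\<N>\<^esub>"
proof -
  have "(\<Oplus>\<^bsub>\<N>\<^esub>i\<in>{..<2}. if \<gamma> (letter i) = g then c i else \<zero>\<^bsub>\<N>\<^esub>)
      = (\<Oplus>\<^bsub>\<N>\<^esub>i\<in>{..<2::nat}. \<zero>\<^bsub>\<N>\<^esub>)"
    using g(2) by (intro vN.finsum_cong') auto
  then show ?thesis using g(1) by (simp add: chain_def)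
qed

lemma chain_closed:
  assumes c: "c \<in> carrier F2"
  shows "chain c \<in> carrier (bar1 G)"
  unfolding bar1_def chain_def
proof (rule vN.free_modI[where J = "range \<gamma>"])
  show "(\<Oplus>\<^bsub>\<N>\<^esub>i\<in>{..<2}. if \<gamma> (letter i) = g then c i else \<zero>\<^bsub>\<N>\<^esub>) \<in> carrier \<N>" for g
    by (rule vN.finsum_closed) (auto intro: F2_closed[OF c] vN_zero_closed)
  show "finite (range \<gamma>)" by simp
  fix g assume "g \<in> carrier G" "g \<notin> range \<gamma>"
  then show "(\<Oplus>\<^bsub>\<N>\<^esub>i\<in>{..<2}. if \<gamma> (letter i) = g then c i else \<zero>\<^bsub>\<N>\<^esub>) = \<zero>\<^bsub>\<N>\<^esub>"
    using chain_zero[OF c] by (simp add: chain_def)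
qed

lemma chain_add:
  assumes c: "c \<in> carrier F2" and d: "d \<in> carrier F2"
  shows "chain (c \<oplus>\<^bsub>F2\<^esub> d) = chain c \<oplus>\<^bsub>bar1 G\<^esub> chain d"
proof (rule bar1_ext)
  have cd: "c \<oplus>\<^bsub>F2\<^esub> d \<in> carrier F2" by (rule vN.free_mod_add_closed[OF c d])
  show "chain (c \<oplus>\<^bsub>F2\<^esub> d) \<in> carrier (bar1 G)" by (rule chain_closed[OF cd])
  show "chain c \<oplus>\<^bsub>bar1 G\<^esub> chain d \<in> carrier (bar1 G)"
    by (intro bar1_add_closed chain_closed c d)
  fix g f q assume g: "g \<in> carrier G" and f: "f \<in> l2 G"
  have "(c \<oplus>\<^bsub>F2\<^esub> d) i f q = c i f q + d i f q" if "i < 2" for i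
    using that f by (simp add: vN.free_mod_add_eq vN_add_eval)
  then have "chain (c \<oplus>\<^bsub>F2\<^esub> d) g f q = chain c g f q + chain d g f q"
    unfolding chain_eval[OF c g f] chain_eval[OF d g f] chain_eval[OF cd g f] sum.distrib[symmetric]
    by (intro sum.cong) auto
  then show "chain (c \<oplus>\<^bsub>F2\<^esub> d) g f q = (chain c \<oplus>\<^bsub>bar1 G\<^esub> chain d) g f q"
    using g f by (simp add: bar1_simps vN_add_eval)
qed

lemma chain_smult:
  assumes r: "r \<in> carrier \<N>" and c: "c \<in> carrier F2"
  shows "chain (r \<odot>\<^bsub>F2\<^esub> c) = r \<odot>\<^bsub>bar1 G\<^esub> chain c"
proof (rule bar1_ext)
  have rc: "r \<odot>\<^bsub>F2\<^esub> c \<in> carrier F2" by (rule free_mod_smult_closed[OF r c])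
  show "chain (r \<odot>\<^bsub>F2\<^esub> c) \<in> carrier (bar1 G)" by (rule chain_closed[OF rc])
  show "r \<odot>\<^bsub>bar1 G\<^esub> chain c \<in> carrier (bar1 G)"
    by (rule bar1_smult_closed[OF r chain_closed[OF c]])
  fix g f q assume g: "g \<in> carrier G" and f: "f \<in> l2 G"
  let ?F = "\<lambda>i q. if \<gamma> (letter i) = g then c i f q else 0"
  have F: "?F i \<in> l2 G" if "i \<in> {..<2}" for i
    using vN_closed[OF F2_closed[OF c] f] that by (intro l2_if) simp
  have "chain c g f = (\<lambda>q. \<Sum>i<2. ?F i q)" by (rule ext) (rule chain_eval[OF c g f])
  then have "r (chain c g f) = (\<lambda>q. \<Sum>i<2. r (?F i) q)" by (simp only: vN_sum[OF r F])
  moreover have "chain (r \<odot>\<^bsub>F2\<^esub> c) g f q = (\<Sum>i<2. r (?F i) q)"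
    unfolding chain_eval[OF rc g f]
  proof (rule sum.cong[OF refl])
    fix i assume "i \<in> {..<2::nat}"
    then have "(r \<odot>\<^bsub>F2\<^esub> c) i f = r (c i f)"
      using f by (simp add: vN.free_mod_smult_eq vN_mult_eval)
    then show "(if \<gamma> (letter i) = g then (r \<odot>\<^bsub>F2\<^esub> c) i f q else 0) = r (?F i) q"
      using vN_zero[OF r] by simp
  qed
  ultimately show "chain (r \<odot>\<^bsub>F2\<^esub> c) g f q = (r \<odot>\<^bsub>bar1 G\<^esub> chain c) g f q"
    using g f by (simp add: bar1_simps vN_mult_eval)
qed

lemma pairing_chain:
  assumes c: "c \<in> carrier F2" and \<beta>: "\<And>g. g \<in> carrier G \<Longrightarrow> \<beta> g \<in> l2 G"
  shows "pairing (chain c) \<beta> q = (\<Sum>i<2. c i (\<beta> (\<gamma> (letter i))) q)"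
proof -
  have "free_supp \<N> (carrier G) (chain c) \<subseteq> range \<gamma>"
    using chain_zero[OF c] by (auto simp: free_supp_def)
  moreover have sub: "range \<gamma> \<subseteq> carrier G" by auto
  ultimately have "pairing (chain c) \<beta> q = (\<Sum>g\<in>range \<gamma>. chain c g (\<beta> g) q)"
    by (intro pairing_superset[OF chain_closed[OF c] \<beta>]) auto
  also have "\<dots> = (\<Sum>g\<in>range \<gamma>. \<Sum>i<2. if \<gamma> (letter i) = g then c i (\<beta> g) q else 0)"
    using sub \<beta> by (intro sum.cong refl chain_eval[OF c]) auto
  also have "\<dots> = (\<Sum>i<2. \<Sum>g\<in>range \<gamma>. if \<gamma> (letter i) = g then c i (\<beta> g) q else 0)"
    by (rule sum.swap)
  also have "\<dots> = (\<Sum>i<2. c i (\<beta> (\<gamma> (letter i))) q)"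
    by (intro sum.cong refl) (simp add: sum.delta')
  finally show ?thesis .
qed

section \<open>Gradients, and the cycle condition\<close>

definition gradient :: "('g \<Rightarrow> complex) \<Rightarrow> bool \<times> 'g \<Rightarrow> complex" where
  "gradient f = (\<lambda>p. right_trans G (\<gamma> (fst p)) f (snd p) - f (snd p))"

lemma component_gradient: "component x (gradient f) = (\<lambda>q. right_trans G (\<gamma> x) f q - f q)"
  by (simp add: component_def gradient_def)

lemma component_gradient_l2: "f \<in> l2 G \<Longrightarrow> component x (gradient f) \<in> l2 G"
  unfolding component_gradient by (intro l2_diff right_trans_l2 gen_closed)

lemma gradient_L2:
  assumes "f \<in> l2 G"
  shows "gradient f \<in> L2"
  by (subst sum_embed_component[of "gradient f"]) (intro L2_add embed_L2 component_gradient_l2 assms)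

text \<open>The adjoint of a right translation is translation by the inverse. Moving it to the other
  side leaves the inner product of \<open>f\<close> with inflow minus outflow of \<xi>, which is
  zero.\<close>

lemma ip_gradient:
  assumes f: "f \<in> l2 G" and \<xi>: "\<xi> \<in> flows"
  shows "ip (gradient f) \<xi> = 0"
proof -
  let ?R = "\<lambda>x. right_trans G (inv (\<gamma> x)) (component x \<xi>)"
  have sq: "sq_summable h" if "h \<in> l2 G" for h using that by (simp add: l2_iff)
  have \<xi>_l2: "component x \<xi> \<in> l2 G" for x by (rule component_l2[OF flows_L2[OF \<xi>]])
  have R_l2: "?R x \<in> l2 G" for x by (rule right_trans_l2[OF inv_closed[OF gen_closed] \<xi>_l2])
  have part: "ip (embed x (component x (gradient f))) \<xi> = ip f (?R x) - ip f (component x \<xi>)" for x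
  proof -
    have "ip (embed x (component x (gradient f))) \<xi> = ip (component x (gradient f)) (component x \<xi>)"
      by (rule ip_embed[OF sq[OF component_gradient_l2[OF f]] L2_sq[OF flows_L2[OF \<xi>]]])
    also have "\<dots> = ip (right_trans G (\<gamma> x) f) (component x \<xi>) - ip f (component x \<xi>)"
      unfolding component_gradient
      by (rule ip_diff_left[OF sq[OF right_trans_l2[OF gen_closed f]] sq[OF f] sq[OF \<xi>_l2]])
    also have "ip (right_trans G (\<gamma> x) f) (component x \<xi>) = ip f (?R x)"
      by (rule ip_right_trans[OF gen_closed f \<xi>_l2])
    finally show ?thesis .
  qed
  have "ip (gradient f) \<xi> = ip (embed False (component False (gradient f))) \<xi> + ip (embed True (component True (gradient f))) \<xi>"
    by (subst sum_embed_component[of "gradient f"])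
      (intro ip_add_left L2_sq embed_L2 component_gradient_l2 f flows_L2[OF \<xi>])
  also have "\<dots> = (ip f (?R False) + ip f (?R True)) - (ip f (component False \<xi>) + ip f (component True \<xi>))"
    by (simp add: part)
  also have "ip f (?R False) + ip f (?R True) = ip f (\<lambda>q. ?R False q + ?R True q)"
    by (rule ip_add_right[symmetric]) (intro sq f R_l2)+
  also have "ip f (component False \<xi>) + ip f (component True \<xi>) = ip f (\<lambda>q. component False \<xi> q + component True \<xi> q)"
    by (rule ip_add_right[symmetric]) (intro sq f \<xi>_l2)+
  also have "(\<lambda>q. ?R False q + ?R True q) = (\<lambda>q. component False \<xi> q + component True \<xi> q)"
  proof
    fix q show "?R False q + ?R True q = component False \<xi> q + component True \<xi> q"
    proof (cases "q \<in> carrier G")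
      case True
      have "?R x q = \<xi> (x, q \<otimes> inv (\<gamma> x))" for x
        using True by (simp add: right_trans_apply[OF \<xi>_l2]) (simp add: component_def)
      then show ?thesis using flows_divergence[OF \<xi> True] by (simp add: component_def)
    next
      case False
      then show ?thesis using \<xi>_l2 by (simp add: right_trans_apply[OF \<xi>_l2] l2_iff)
    qed
  qed
  finally show ?thesis by simp
qed

text \<open>Pairing the chain with the inner cocycle of \<open>f\<close> gives
  \<open>row_op c (gradient f)\<close>. The row factors through \<open>P\<close>, which kills
  gradients.\<close>

lemma chain_cycle:
  assumes "c \<in> V"
  shows "chain c \<in> cycles"
proof -
  have c: "c \<in> carrier F2" and cP: "\<And>\<zeta>. \<zeta> \<in> L2 \<Longrightarrow> row_op c \<zeta> = row_op c (P \<zeta>)"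
    using assms by (auto simp: V_iff)
  have "pairing (chain c) (\<lambda>g x. right_trans G g f x - f x) q = 0" if f: "f \<in> l2 G" for f q
  proof -
    have "(\<lambda>x. right_trans G g f x - f x) \<in> l2 G" if "g \<in> carrier G" for g
      by (rule l2_diff[OF right_trans_l2[OF that f] f])
    then have "pairing (chain c) (\<lambda>g x. right_trans G g f x - f x) q = row_op c (gradient f) q"
      by (subst pairing_chain[OF c]) (simp_all add: row_op_def component_gradient)
    also have "P (gradient f) = (\<lambda>p. 0)"
      by (rule flows.proj_eq_0[OF L2_sq[OF gradient_L2[OF f]] ip_gradient[OF f]])
    then have "row_op c (gradient f) q = 0"
      using cP[OF gradient_L2[OF f]] row_op_zero[OF c] by simp
    finally show ?thesis .
  qed
  then show ?thesis
    using bar_d1_zero_iff[OF chain_closed[OF c]] chain_closed[OF c] by (auto simp: cycles_def)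
qed

section \<open>Cocycles obtained by integrating flows\<close>

definition word_of :: "'g \<Rightarrow> bool list" where
  "word_of g = (SOME s. ev s = g)"

lemma ev_word_of: "g \<in> carrier G \<Longrightarrow> ev (word_of g) = g"
  unfolding word_of_def by (rule someI_ex) (use generated in \<open>simp add: ev_def\<close>)

text \<open>At \<open>q\<close> this is the sum along a path from \<open>q\<close> to
  \<open>q \<otimes> g\<close>. For a flow the choice of the word is immaterial, because loop sums
  vanish.\<close>

definition flow_integral :: "(bool \<times> 'g \<Rightarrow> complex) \<Rightarrow> 'g \<Rightarrow> 'g \<Rightarrow> complex" where
  "flow_integral \<xi> g q = (if q \<in> carrier G then gsum \<xi> q (word_of g) else 0)"

lemma gsum_append:
  "q \<in> carrier G \<Longrightarrow> gsum \<xi> q (s @ t) = gsum \<xi> q s + gsum \<xi> (q \<otimes> ev s) t"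
  by (simp add: gsum_def path_sum_append foldl_gen)

text \<open>For a fixed word the sum is a finite sum of right translates of the two
  components.\<close>

lemma gsum_l2:
  assumes "\<xi> \<in> L2"
  shows "(\<lambda>q. if q \<in> carrier G then gsum \<xi> q s else 0) \<in> l2 G"
proof (induction s)
  case Nil
  have "(\<lambda>q. if q \<in> carrier G then gsum \<xi> q [] else 0) = (\<lambda>q. 0)" by (auto simp: gsum_def)
  then show ?case by (simp only: l2_zero)
next
  case (Cons x s)
  let ?I = "\<lambda>q. if q \<in> carrier G then gsum \<xi> q s else 0"
  have "(\<lambda>q. if q \<in> carrier G then gsum \<xi> q (x # s) else 0) = (\<lambda>q. component x \<xi> q + right_trans G (\<gamma> x) ?I q)"
  proof
    fix q show "(if q \<in> carrier G then gsum \<xi> q (x # s) else 0) = component x \<xi> q + right_trans G (\<gamma> x) ?I q"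
      using assms by (simp only: right_trans_apply[OF Cons.IH]) (simp add: gsum_def component_def L2_def)
  qed
  moreover have "(\<lambda>q. component x \<xi> q + right_trans G (\<gamma> x) ?I q) \<in> l2 G"
    by (rule l2_add[OF component_l2[OF assms] right_trans_l2[OF gen_closed Cons.IH]])
  ultimately show ?case by (simp only:)
qed

lemma flow_integral_l2: "\<xi> \<in> L2 \<Longrightarrow> flow_integral \<xi> g \<in> l2 G"
  using gsum_l2[of \<xi> "word_of g"] by (simp add: flow_integral_def[abs_def])

lemma flow_integral_gen:
  assumes "\<xi> \<in> flows"
  shows "flow_integral \<xi> (\<gamma> x) = component x \<xi>"
proof
  fix q
  have "gsum \<xi> q (word_of (\<gamma> x)) = \<xi> (x, q)" if "q \<in> carrier G"
    using flows_loop[OF assms, of "word_of (\<gamma> x)" "[x]" q] that by (simp add: ev_word_of gsum_def)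
  then show "flow_integral \<xi> (\<gamma> x) q = component x \<xi> q"
    using flows_L2[OF assms] by (simp add: flow_integral_def component_def L2_def)
qed

text \<open>A path to \<open>q \<otimes> (g \<otimes> h)\<close> may be led through
  \<open>q \<otimes> g\<close>.\<close>

lemma flow_integral_cocycle:
  assumes \<xi>: "\<xi> \<in> flows" and g: "g \<in> carrier G" and h: "h \<in> carrier G"
  shows "flow_integral \<xi> (g \<otimes> h) = (\<lambda>q. right_trans G g (flow_integral \<xi> h) q + flow_integral \<xi> g q)"
proof
  fix q
  show "flow_integral \<xi> (g \<otimes> h) q = right_trans G g (flow_integral \<xi> h) q + flow_integral \<xi> g q"
  proof (cases "q \<in> carrier G")
    case True
    have "gsum \<xi> q (word_of (g \<otimes> h)) = gsum \<xi> q (word_of g @ word_of h)"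
      using g h True by (intro flows_loop[OF \<xi>]) (simp_all add: ev_word_of ev_append)
    then show ?thesis
      using True g by (simp add: right_trans_apply[OF flow_integral_l2[OF flows_L2[OF \<xi>]]]
          gsum_append ev_word_of flow_integral_def)
  qed (simp add: right_trans_apply[OF flow_integral_l2[OF flows_L2[OF \<xi>]]] flow_integral_def)
qed

text \<open>The cocycle of a flow takes the values \<open>component x \<xi>\<close> at the
  generators, so pairing the chain with it yields \<open>row_op c \<xi>\<close>. If the chain
  bounds, then \<open>row_op c\<close> vanishes on all flows; it factors through the projection onto
  them, hence is zero.\<close>

lemma chain_boundary:
  assumes "c \<in> V" "chain c \<in> boundaries"
  shows "c = \<zero>\<^bsub>F2\<^esub>"
proof -
  have c: "c \<in> carrier F2" and cP: "\<And>\<zeta>. \<zeta> \<in> L2 \<Longrightarrow> row_op c \<zeta> = row_op c (P \<zeta>)"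
    using assms(1) by (auto simp: V_iff)
  obtain e where e: "e \<in> carrier (bar2 G)" "chain c = bar_d2 G e"
    using assms(2) by (auto simp: boundaries_def)
  have 0: "row_op c \<xi> q = 0" if \<xi>: "\<xi> \<in> flows" for \<xi> q
  proof -
    note l2 = flow_integral_l2[OF flows_L2[OF \<xi>]]
    have "row_op c \<xi> q = pairing (chain c) (flow_integral \<xi>) q"
      unfolding pairing_chain[OF c l2] flow_integral_gen[OF \<xi>] row_op_def ..
    also have "\<dots> = 0"
      unfolding e(2) by (rule pairing_bar_d2[OF e(1) l2 flow_integral_cocycle[OF \<xi>]])
    finally show ?thesis .
  qed
  show ?thesis
  proof (rule F2_ext[OF c vN.free_mod_zero_closed])
    fix i f q assume i: "i < (2::nat)" and f: "f \<in> l2 G"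
    note emb = embed_L2[OF f, of "letter i"]
    have "c i f q = row_op c (embed (letter i) f) q" by (rule row_op_embed[OF c i f, symmetric])
    also have "\<dots> = row_op c (P (embed (letter i) f)) q" by (simp only: cP[OF emb])
    also have "\<dots> = 0" by (rule 0[OF flows.proj_in[OF L2_sq[OF emb]]])
    finally show "c i f q = \<zero>\<^bsub>F2\<^esub> i f q" using i f by (simp add: vN.free_mod_zero_eq vN_zero_eval)
  qed
qed

text \<open>The diagonal coefficient of an orthogonal projection at a unit vector is the squared
  norm of the projected vector.\<close>

lemma proj_entry_trace:
  "vN_trace G (proj_entry x x) = of_real (nsq (P (embed x (\<lambda>q. if q = \<one> then 1 else 0))))"
proof -
  let ?d = "(\<lambda>q. if q = \<one> then 1 else 0) :: 'g \<Rightarrow> complex"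
  have d: "?d \<in> l2 G" by (rule point_l2[OF one_closed])
  have e: "embed x ?d = (\<lambda>p. if p = (x, \<one>) then 1 else 0)" by (auto simp: embed_def)
  have "vN_trace G (proj_entry x x) = P (embed x ?d) (x, \<one>)"
    using d by (simp add: vN_trace_def proj_entry_def component_def)
  also have "\<dots> = ip (P (embed x ?d)) (embed x ?d)"
    unfolding e by (rule ip_point[symmetric])
  also have "\<dots> = of_real (nsq (P (embed x ?d)))"
    by (rule flows.ip_proj_self[OF L2_sq[OF embed_L2[OF d]]])
  finally show ?thesis .
qed

lemma first_L2_betti_neq_0:
  assumes \<xi>: "\<xi> \<in> flows" and nz: "\<xi> (x, \<one>) \<noteq> 0"
  shows "first_L2_betti G \<noteq> 0"
proof (rule first_L2_betti_neq_0I[where n = 2 and A = proj_matrix and \<iota> = chain])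
  let ?e = "\<lambda>x. embed x (\<lambda>q. if q = \<one> then 1 else 0) :: bool \<times> 'g \<Rightarrow> complex"
  have e: "?e x \<in> L2" for x by (rule embed_L2[OF point_l2[OF one_closed]])
  \<comment> \<open>If \<open>P\<close> killed this unit vector, the vector would be orthogonal to
    \<xi>, whose value at \<open>(x, \<one>)\<close> would then be zero.\<close>
  have "nsq (P (?e x)) > 0"
  proof (rule ccontr)
    assume "\<not> nsq (P (?e x)) > 0"
    then have "P (?e x) = (\<lambda>p. 0)"
      using nsq_eq_0[OF L2_sq[OF P_L2[OF e]]] by (intro ext) (simp add: not_less)
    then have "ip (?e x) \<xi> = 0"
      using flows.ip_proj[OF L2_sq[OF e] \<xi>, of x] by (simp add: ip_zero_left)
    then have "ip \<xi> (?e x) = 0" by (subst ip_commute) simp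
    moreover have "?e x = (\<lambda>p. if p = (x, \<one>) then 1 else 0)" by (auto simp: embed_def)
    ultimately show False using nz ip_point[of \<xi> "(x, \<one>)"] by simp
  qed
  moreover have "Re (\<Sum>i<2. vN_trace G (proj_matrix i i)) = nsq (P (?e False)) + nsq (P (?e True))"
    using sum_letter[of "\<lambda>_ x. vN_trace G (proj_entry x x)"] by (simp add: proj_matrix_def proj_entry_trace)
  ultimately show "Re (\<Sum>i<2. vN_trace G (proj_matrix i i)) > 0"
    using nsq_nonneg[of "P (?e False)"] nsq_nonneg[of "P (?e True)"] by (cases x) auto
  show sub: "V \<subseteq> carrier F2" by (auto simp: V_iff)
  show "chain (c \<oplus>\<^bsub>F2\<^esub> d) = chain c \<oplus>\<^bsub>bar1 G\<^esub> chain d" if "c \<in> V" "d \<in> V" for c d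
    using that sub by (intro chain_add) blast+
  show "chain (r \<odot>\<^bsub>F2\<^esub> c) = r \<odot>\<^bsub>bar1 G\<^esub> chain c" if "r \<in> carrier \<N>" "c \<in> V" for r c
    using that sub by (intro chain_smult) blast+
qed (fact idempotent_proj_matrix V_add V_smult chain_cycle chain_boundary)+

end

section \<open>The torsion group\<close>

context
  fixes N :: "(bool list \<times> bool list) set"
  assumes N: "torsion_congruence N"
begin

interpretation torsion_congruence N by (rule N)

text \<open>Classes are coded by natural numbers, because the group is to live on
  \<open>nat\<close>; decoding a class returns its representative word.\<close>

definition cls :: "bool list \<Rightarrow> nat" where
  "cls w = to_nat (rep w)"

definition word_group :: "nat monoid" where
  "word_group = \<lparr>carrier = range cls, mult = (\<lambda>a b. cls (from_nat a @ from_nat b)), one = cls []\<rparr>"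

lemma cls_eq_iff: "cls s = cls t \<longleftrightarrow> (s, t) \<in> N"
  by (simp add: cls_def rep_eq_iff)

lemma word_group_simps:
  "carrier word_group = range cls" "\<one>\<^bsub>word_group\<^esub> = cls []"
  "cls s \<otimes>\<^bsub>word_group\<^esub> cls t = cls (s @ t)"
proof -
  have "(rep s @ rep t, s @ t) \<in> N" using append_cong rep sym by blast
  then show "cls s \<otimes>\<^bsub>word_group\<^esub> cls t = cls (s @ t)"
    by (simp add: word_group_def cls_eq_iff) (simp add: cls_def)
qed (simp_all add: word_group_def)

lemma group_word_group: "group word_group"
proof (rule groupI)
  fix a assume "a \<in> carrier word_group"
  then obtain s where s: "a = cls s" by (auto simp: word_group_simps)
  obtain t where "(t @ s, []) \<in> N" using inverse_word by blast
  then have "cls t \<otimes>\<^bsub>word_group\<^esub> a = \<one>\<^bsub>word_group\<^esub>"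
    by (simp add: s word_group_simps cls_eq_iff)
  then show "\<exists>b\<in>carrier word_group. b \<otimes>\<^bsub>word_group\<^esub> a = \<one>\<^bsub>word_group\<^esub>"
    by (auto simp: word_group_simps)
qed (auto simp: word_group_simps)

lemma cls_pow: "cls w [^]\<^bsub>word_group\<^esub> (k::nat) = cls (wpow w k)"
  by (induction k) (simp_all add: word_group_simps wpow_commute nat_pow_def)

lemma torsion_word_group: "torsion_group word_group"
proof -
  have "\<exists>k>0. cls w [^]\<^bsub>word_group\<^esub> (k::nat) = \<one>\<^bsub>word_group\<^esub>" for w
    using torsion[of w] by (simp add: cls_pow word_group_simps cls_eq_iff)
  then show ?thesis
    using group_word_group by (auto simp: torsion_group_def word_group_simps)
qed

lemma foldr_cls: "foldr (\<lambda>x. (\<otimes>\<^bsub>word_group\<^esub>) (cls [x])) s \<one>\<^bsub>word_group\<^esub> = cls s"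
  by (induction s) (simp_all add: word_group_simps)

lemma finitely_generated_word_group: "finitely_generated word_group"
  unfolding finitely_generated_def
proof (intro exI conjI)
  let ?S = "range (\<lambda>x. cls [x])"
  show "finite ?S" by simp
  show sub: "?S \<subseteq> carrier word_group" by (auto simp: word_group_simps)
  have "cls s \<in> generate word_group ?S" for s
  proof (induction s)
    case Nil
    show ?case using generate.one[of word_group ?S] by (simp add: word_group_simps)
  next
    case (Cons x s)
    have "cls [x] \<in> generate word_group ?S" by (rule generate.incl) simp
    from generate.eng[OF this Cons.IH] show ?case by (simp add: word_group_simps)
  qed
  then show "generate word_group ?S = carrier word_group"
    using group.generate_in_carrier[OF group_word_group sub] by (auto simp: word_group_simps)
qed

text \<open>With the same congruence in both places, the clauses of \<open>unit_flow\<close> become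
  invariance, square summability, path independence and zero divergence on one group. Hence
  \<open>u\<close> descends to an element of \<open>flows\<close>.\<close>

lemma first_L2_betti_word_group:
  assumes u: "unit_flow N N u" and nz: "u [] x \<noteq> 0"
  shows "first_L2_betti word_group \<noteq> 0"
proof -
  interpret generated_group word_group "\<lambda>x. cls [x]"
  proof (intro generated_group.intro generated_group_axioms.intro group_word_group)
    show "cls [x] \<in> carrier word_group" for x by (simp add: word_group_simps)
    show "\<exists>s. foldr (\<lambda>x. (\<otimes>\<^bsub>word_group\<^esub>) (cls [x])) s \<one>\<^bsub>word_group\<^esub> = g" if "g \<in> carrier word_group" for g
      using that foldr_cls by (auto simp: word_group_simps(1))
  qed
  define \<xi> :: "bool \<times> nat \<Rightarrow> complex" where
    "\<xi> p = (if snd p \<in> carrier word_group then of_real (u (from_nat (snd p)) (fst p)) else 0)" for p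
  have \<xi>_cls: "\<xi> (x, cls s) = of_real (u s x)" for x s
  proof -
    have "u (rep s) = u s" by (rule unit_flowD(1)[OF u]) (simp add: rep sym)
    then show ?thesis by (simp add: \<xi>_def word_group_simps) (simp add: cls_def)
  qed
  have ev_cls: "ev s = cls s" for s by (simp add: ev_def foldr_cls)
  have gsum_cls: "gsum \<xi> (cls q) s = of_real (word_sum u q s)" for q s
  proof (induction s arbitrary: q)
    case (Cons x s)
    from Cons.IH[of "q @ [x]"] show ?case
      by (simp add: gsum_def \<xi>_cls word_group_simps)
  qed (simp add: gsum_def)
  have "\<xi> \<in> flows"
  proof (rule flowsI)
    have "sq_summable \<xi>"
    proof (rule sq_summableI(1))
      fix S :: "(bool \<times> nat) set" assume S: "finite S"
      \<comment> \<open>Only edges starting in the group carry weight. Decoding their vertices gives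
        representative words, which are pairwise inequivalent, so the norm bound of
        \<open>unit_flow\<close> applies to them; \<open>?h\<close> restores the order of letter and
        vertex.\<close>
      let ?S = "{p \<in> S. snd p \<in> range cls}"
      let ?W = "(\<lambda>p. from_nat (snd p)) ` ?S :: bool list set"
      let ?h = "\<lambda>p. (snd p, cls (fst p))"
      have W: "rep w = w" if "w \<in> ?W" for w using that by (auto simp: cls_def)
      then have inj: "s = t" if "s \<in> ?W" "t \<in> ?W" "(s, t) \<in> N" for s t
        using that by (metis rep_eq_iff)
      have inj_h: "inj_on ?h (?W \<times> UNIV)"
      proof (intro inj_onI)
        fix p p' assume p: "p \<in> ?W \<times> UNIV" "p' \<in> ?W \<times> UNIV" and "?h p = ?h p'"
        then have "snd p = snd p'" "(fst p, fst p') \<in> N" by (simp_all flip: cls_eq_iff)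
        then show "p = p'" using inj[of "fst p" "fst p'"] p by (simp add: prod_eq_iff mem_Times_iff)
      qed
      have sub: "?S \<subseteq> ?h ` (?W \<times> UNIV)"
      proof
        fix p assume p: "p \<in> ?S"
        then have "p = ?h (from_nat (snd p), fst p)"
          by (auto simp: cls_def prod_eq_iff)
        then show "p \<in> ?h ` (?W \<times> UNIV)" using p by blast
      qed
      have "(\<Sum>p\<in>S. (cmod (\<xi> p))\<^sup>2) = (\<Sum>p\<in>?S. (cmod (\<xi> p))\<^sup>2)"
        using S by (intro sum.mono_neutral_right) (auto simp: \<xi>_def word_group_simps)
      also have "\<dots> \<le> (\<Sum>p\<in>?h ` (?W \<times> UNIV). (cmod (\<xi> p))\<^sup>2)"
        using S by (intro sum_mono2 sub) auto
      also have "\<dots> = (\<Sum>w\<in>?W. \<Sum>x\<in>UNIV. (u w x)\<^sup>2)"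
        by (simp only: sum.reindex[OF inj_h] o_def sum.cartesian_product' fst_conv snd_conv \<xi>_cls norm_of_real power2_abs)
      also have "\<dots> \<le> 1" by (rule unit_flowD(2)[OF u]) (use S inj in auto)
      finally show "(\<Sum>p\<in>S. (cmod (\<xi> p))\<^sup>2) \<le> 1" .
    qed
    then show "\<xi> \<in> L2" by (simp add: L2_def \<xi>_def)
    fix q assume "q \<in> carrier word_group"
    then obtain s where s: "q = cls s" by (auto simp: word_group_simps)
    \<comment> \<open>Words representing the inverses of the letters translate the divergence clause
      of \<open>unit_flow\<close> into the one of \<open>flows\<close>.\<close>
    have "\<exists>v. (v @ [x], []) \<in> N" for x using inverse_word by blast
    then obtain v where v: "\<And>x. (v x @ [x], []) \<in> N" by metis
    have inv: "inv\<^bsub>word_group\<^esub> cls [x] = cls (v x)" for x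
      using v[of x] by (intro inv_equality) (auto simp: word_group_simps cls_eq_iff)
    have "(\<Sum>x\<in>UNIV. u (s @ v x) x) = (\<Sum>x\<in>UNIV. u s x)" by (rule unit_flowD(4)[OF u v])
    then have "complex_of_real (u (s @ v False) False + u (s @ v True) True) = of_real (u s False + u s True)"
      by (simp add: UNIV_bool)
    then show "\<xi> (False, q \<otimes>\<^bsub>word_group\<^esub> inv\<^bsub>word_group\<^esub> cls [False]) + \<xi> (True, q \<otimes>\<^bsub>word_group\<^esub> inv\<^bsub>word_group\<^esub> cls [True])
        = \<xi> (False, q) + \<xi> (True, q)"
      by (simp add: s inv word_group_simps(3) \<xi>_cls)
    show "gsum \<xi> q w = gsum \<xi> q w'" if "ev w = ev w'" for w w'
    proof -
      have "word_sum u s w = word_sum u s w'"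
        using that by (intro unit_flowD(3)[OF u]) (simp add: ev_cls cls_eq_iff)
      then show ?thesis by (simp add: s gsum_cls)
    qed
  qed
  moreover have "\<xi> (x, \<one>\<^bsub>word_group\<^esub>) \<noteq> 0" using nz by (simp add: word_group_simps \<xi>_cls)
  ultimately show ?thesis by (rule first_L2_betti_neq_0)
qed

end

theorem theorem1p4:
  shows "\<exists>G :: nat monoid.
    group G \<and> finitely_generated G \<and> torsion_group G \<and> first_L2_betti G \<noteq> 0"
proof -
  obtain N :: "(bool list \<times> bool list) set" and u x
    where N: "torsion_congruence N" and u: "unit_flow N N u" "u [] x \<noteq> 0"
    using torsion_quotient_flow by blast
  show ?thesis
    using group_word_group[OF N] finitely_generated_word_group[OF N] torsion_word_group[OF N]
      first_L2_betti_word_group[OF N u] by blast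
qed

end
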